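(* Let $d,q\ge1$ be integers, let $c,C>1$ be constants, let $(p_k)_{k\ge1}$ be a sequence of primes with $cp_k\le p_{k+1}<Cp_k$ for all $k$, and let $(\vec a_k)_{k\ge1}\subset\mathbb{Z}^d$ satisfy $|\vec a_{k-1}|+p_{k-1}^q<|\vec a_k|\le Cp_k^q$ for all $k$ (the left inequality for $k\ge 2$). For $0\le j<p_k$ define $$x_{k,j}=\left(\sum_{i=1}^q p_k^{i-1}[j^i]_{p_k},\ \sum_{i=1}^q p_k^{i-1}[j^{q+i}]_{p_k},\ \dots,\ \sum_{i=1}^q p_k^{i-1}[j^{(d-1)q+i}]_{p_k}\right)\in\mathbb{Z}^d.$$ Let $\{\vec n_i\}_{i\in\mathbb{N}}$ be the enumeration of the points $\vec a_k+x_{k,j}$ ($k\ge1$, $0\le j<p_k$) in the dictionary ordering of the index pairs $(k,j)$, and for $f\in\ell^2(\mathbb{Z}^d)$ let $$A_Nf(\vec v)=\frac1N\sum_{i=1}^N f(\vec v+\vec n_i),\qquad \vec v\in\mathbb{Z}^d.$$ Then for any lacunary $I\subset\mathbb{N}$ there is a constant $C_I<\infty$ such that for any sequence $t_1\le t_2\le\cdots$ with $t_n\in I$ for all $n$ and any $f\in\ell^2(\mathbb{Z}^d)$, $$\sum_{n\ge 2}\left\|\sup_{t_{n-1}\le t\le t_n,\ t\in I}|A_tf-A_{t_n}f|\right\|_{\ell^2(\mathbb{Z}^d)}^2\le C_I\|f\|_{\ell^2(\mathbb{Z}^d)}^2.$$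
   Context: $[n]_p\in\{0,\dots,p-1\}$ denotes the residue of $n$ modulo $p$; $|\cdot|$ is the Euclidean norm. Dictionary ordering: $(k,j)$ precedes $(k',j')$ if $k<k'$, or $k=k'$ and $j<j'$. A set $I=\{i_1<i_2<\cdots\}\subset\mathbb{N}$ is lacunary if $\inf_n i_{n+1}/i_n>1$. *)

theory Defs
  imports "HOL-Analysis.Analysis" "HOL-Computational_Algebra.Primes" "HOL-Library.Infinite_Set"
begin

text \<open>The lattice \<open>\<int>\<^sup>d\<close> is the type \<open>int ^ 'd\<close>. Since an abstract finite index type carries no
  order, the coordinates are put in order by a bijection \<open>pos\<close> from \<open>'d\<close> onto \<open>{..<d}\<close>, which is a
  parameter of \<open>xvec\<close>.\<close>

definition enorm :: "int ^ 'd \<Rightarrow> real" where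
  "enorm v = norm (\<chi> m. real_of_int (v $ m))"

definition in_ell2 :: "('a \<Rightarrow> 'b::real_normed_vector) \<Rightarrow> bool" where
  "in_ell2 f \<longleftrightarrow> (\<lambda>v. (norm (f v))\<^sup>2) summable_on UNIV"

text \<open>Meaningful only under \<open>in_ell2 f\<close>: a divergent \<open>infsum\<close> is \<open>0\<close>.\<close>

definition ell2_norm :: "('a \<Rightarrow> 'b::real_normed_vector) \<Rightarrow> real" where
  "ell2_norm f = sqrt (\<Sum>\<^sub>\<infinity>v\<in>UNIV. (norm (f v))\<^sup>2)"

text \<open>\<open>\<nat>\<close> is \<open>{1, 2, \<dots>}\<close> here, so \<open>0\<close> is excluded; \<open>enumerate I\<close> lists \<open>I\<close> increasingly.\<close>

definition lacunary :: "nat set \<Rightarrow> bool" where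
  "lacunary I \<longleftrightarrow> infinite I \<and> 0 \<notin> I \<and>
     (INF n. real (enumerate I (Suc n)) / real (enumerate I n)) > 1"

text \<open>The point \<open>x\<^bsub>k,j\<^esub>\<close> for the prime \<open>p = p\<^sub>k\<close>.\<close>

definition xvec :: "('d \<Rightarrow> nat) \<Rightarrow> nat \<Rightarrow> nat \<Rightarrow> nat \<Rightarrow> int ^ 'd" where
  "xvec pos q p j = (\<chi> m. int (\<Sum>i=1..q. p ^ (i - 1) * (j ^ (pos m * q + i) mod p)))"

text \<open>\<open>e\<close> lists the pairs \<open>(k, j)\<close> with \<open>k \<ge> 1\<close> and \<open>j < p\<^sub>k\<close> as \<open>e 1, e 2, \<dots>\<close> in dictionary
  order; this determines \<open>e\<close> on \<open>{1..}\<close>.\<close>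

definition dict_enum :: "(nat \<Rightarrow> nat) \<Rightarrow> (nat \<Rightarrow> nat \<times> nat) \<Rightarrow> bool" where
  "dict_enum p e \<longleftrightarrow>
     bij_betw e {1..} {(k, j). 1 \<le> k \<and> j < p k} \<and>
     (\<forall>i\<ge>1. \<forall>i'>i. (e i, e i') \<in> less_than <*lex*> less_than)"

definition avg :: "(nat \<Rightarrow> int ^ 'd) \<Rightarrow> nat \<Rightarrow> (int ^ 'd \<Rightarrow> complex) \<Rightarrow> int ^ 'd \<Rightarrow> complex" where
  "avg n N f v = 1 / of_nat N * (\<Sum>i=1..N. f (v + n i))"

text \<open>The function \<open>v \<mapsto> sup |A\<^sub>s f v - A\<^sub>b f v|\<close> over \<open>s \<in> I\<close> with \<open>a \<le> s \<le> b\<close>. For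
  \<open>a \<le> b \<in> I\<close> the supremum is over a finite nonempty set.\<close>

definition osc ::
  "(nat \<Rightarrow> int ^ 'd) \<Rightarrow> nat set \<Rightarrow> nat \<Rightarrow> nat \<Rightarrow> (int ^ 'd \<Rightarrow> complex) \<Rightarrow> int ^ 'd \<Rightarrow> real" where
  "osc n I a b f v = (SUP s\<in>{s \<in> I. a \<le> s \<and> s \<le> b}. norm (avg n s f v - avg n b f v))"

end

theory Submission
  imports Defs "HOL-Library.Poly_Mapping" "HOL-Computational_Algebra.Polynomial"
begin

text \<open>A finitely supported kernel on \<open>\<int>\<^sup>d\<close> is an element of the group ring, convolution is its product, and
  Plancherel bounds a square function by the supremum of its multipliers. The averages \<open>A\<^sub>N\<close>,
  \<open>N \<in> I\<close>, are compared with the averages over cubes of radius \<open>N\<^sup>q\<close>.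

  For cubes, \<open>R\<^sub>j - R\<^sub>b = R\<^sub>j (R\<^sub>a - R\<^sub>b) + R\<^sub>j (1 - R\<^sub>a) - R\<^sub>b (1 - R\<^sub>j)\<close> reduces the oscillation over the
  block \<open>a \<le> j \<le> b\<close> to the maximal function of \<open>(R\<^sub>a - R\<^sub>b) f\<close> and to terms that are square summable over
  all pairs of lacunary radii. The maximal inequality itself comes from a \<open>T T\<^sup>*\<close> argument: the square of the
  linearised maximal operator is dominated by the operator with doubled radii.

  The coordinates of \<open>x\<^bsub>k,j\<^esub>\<close> have the base \<open>p\<close> digits \<open>j, j\<^sup>2, \<dots>, j\<^bsup>dq\<^esup>\<close> modulo \<open>p\<close>. Weyl differencing gives a
  power saving for the complete exponential sums modulo \<open>p\<close>, and characters of the digits have Fourier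
  coefficients modulo \<open>p\<close> with \<open>\<ell>\<^sup>1\<close> norm \<open>O(log p)\<close>. Hence, up to \<open>O(p\<^bsup>1-\<delta>\<^esup>)\<close>, the sum over a block
  is the sum over the full digit box, whose geometric sums decay.\<close>

section \<open>Fourier analysis on the group ring\<close>

text \<open>The multipliers of the averages are close to 1 at low frequencies, so they are not
  square summable over lacunary \<open>N\<close>; their differences from suitable comparison
  multipliers are. Cubes of radius N^q fit because the prime p_k of the block reached by
  \<open>N\<close> is at most a constant times \<open>N\<close>: the first \<open>N\<close> points
  then have size O(N^q), and both multipliers are near 1 when N^q |\<theta>| is small and decay when
  it is large. A lacunary sequence sees each frequency at few scales, up to geometric tails.

  The obstacle is the last block, which \<open>N\<close> may cut off. Since \<open>j\<close> is
  itself the first digit, cutting off truncates that digit alone, and the resulting digit box no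
  longer fills an interval in one coordinate: its multiplier can have peaks away from 0. They need
  p_k |\<theta>| > pi and contribute at most about 1 / (N |\<theta>|), which brings in a second
  lacunary scale, N |\<theta>|.

  All the Fourier analysis is finite: finitely many averages at finitely many points see
  \<open>f\<close> only on a finite set, so \<open>f\<close> may be replaced by a group ring
  element. The bounds do not depend on that set and pass to infinite sums at the end.\<close>

abbreviation lookup :: "('a \<Rightarrow>\<^sub>0 'b::zero) \<Rightarrow> 'a \<Rightarrow> 'b" where
  "lookup \<equiv> Poly_Mapping.lookup"

abbreviation keys :: "('a \<Rightarrow>\<^sub>0 'b::zero) \<Rightarrow> 'a set" where
  "keys \<equiv> Poly_Mapping.keys"

lemma sum_single_lookup: "(\<Sum>v\<in>keys f. Poly_Mapping.single v (lookup f v)) = f"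
proof (rule poly_mapping_eqI)
  fix w
  have "lookup (\<Sum>v\<in>keys f. Poly_Mapping.single v (lookup f v)) w =
      (\<Sum>v\<in>keys f. if v = w then lookup f v else 0)"
    by (simp add: lookup_sum lookup_single when_def)
  then show "lookup (\<Sum>v\<in>keys f. Poly_Mapping.single v (lookup f v)) w = lookup f w"
    by (auto simp: in_keys_iff)
qed

lemma lookup_single_mult:
  fixes f :: "'a::ab_group_add \<Rightarrow>\<^sub>0 'b::semiring_1"
  shows "lookup (Poly_Mapping.single w c * f) v = c * lookup f (v - w)"
proof -
  have "lookup (Poly_Mapping.single w c * f) v =
      (\<Sum>l. (c * (\<Sum>q. lookup f q when v = l + q)) when l = w)"
    unfolding lookup_mult lookup_single
  proof (rule Sum_any.cong)
    fix l
    show "(c when w = l) * (\<Sum>q. lookup f q when v = l + q)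
        = (c * (\<Sum>q. lookup f q when v = l + q) when l = w)"
      by (cases "l = w") simp_all
  qed
  also have "\<dots> = c * (\<Sum>q. lookup f q when v = w + q)"
    by simp
  also have "(\<lambda>q. lookup f q when v = w + q) = (\<lambda>q. lookup f q when q = v - w)"
  proof (rule ext)
    fix q
    have "v = w + q \<longleftrightarrow> q = v - w" by (auto simp: algebra_simps)
    then show "(lookup f q when v = w + q) = (lookup f q when q = v - w)" by (simp only:)
  qed
  also have "c * Sum_any \<dots> = c * lookup f (v - w)"
    by simp
  finally show ?thesis .
qed

lemma lookup_sum_single_mult:
  fixes f :: "'a::ab_group_add \<Rightarrow>\<^sub>0 'b::comm_semiring_1"
  shows "lookup ((\<Sum>x\<in>X. Poly_Mapping.single (w x) (c x)) * f) v = (\<Sum>x\<in>X. c x * lookup f (v - w x))"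
  by (simp add: sum_distrib_right lookup_sum lookup_single_mult)

section \<open>Characters and the Fourier transform of finitely supported functions\<close>

definition chr :: "real ^ 'd \<Rightarrow> int ^ 'd \<Rightarrow> complex" where
  "chr \<theta> v = cis (\<Sum>m\<in>UNIV. \<theta> $ m * real_of_int (v $ m))"

lemma chr_0 [simp]: "chr \<theta> 0 = 1"
  by (simp add: chr_def)

lemma chr_add: "chr \<theta> (v + w) = chr \<theta> v * chr \<theta> w"
  by (simp add: chr_def cis_mult sum.distrib algebra_simps)

lemma norm_chr [simp]: "norm (chr \<theta> v) = 1"
  by (simp add: chr_def)

lemma cnj_chr: "cnj (chr \<theta> v) = chr \<theta> (- v)"
  by (simp add: chr_def cis_cnj sum_negf)

definition fourier :: "real ^ 'd \<Rightarrow> (int ^ 'd \<Rightarrow>\<^sub>0 complex) \<Rightarrow> complex" where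
  "fourier \<theta> f = (\<Sum>v\<in>keys f. lookup f v * chr \<theta> v)"

lemma fourier_superset:
  assumes "finite S" "keys f \<subseteq> S"
  shows "fourier \<theta> f = (\<Sum>v\<in>S. lookup f v * chr \<theta> v)"
  unfolding fourier_def using assms
  by (intro sum.mono_neutral_left) (auto simp: in_keys_iff)

lemma fourier_add: "fourier \<theta> (f + g) = fourier \<theta> f + fourier \<theta> g"
proof -
  have "keys (f + g) \<subseteq> keys f \<union> keys g"
    by (rule Poly_Mapping.keys_add)
  then show ?thesis
    by (simp add: fourier_superset[of "keys f \<union> keys g"] lookup_add algebra_simps sum.distrib)
qed

lemma fourier_single [simp]: "fourier \<theta> (Poly_Mapping.single v c) = c * chr \<theta> v"
  by (simp add: fourier_superset[of "{v}"])

lemma fourier_0 [simp]: "fourier \<theta> 0 = 0"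
  by (simp add: fourier_def)

lemma fourier_1 [simp]: "fourier \<theta> 1 = 1"
  using fourier_single[of \<theta> 0 1] by simp

lemma fourier_sum: "fourier \<theta> (\<Sum>x\<in>X. f x) = (\<Sum>x\<in>X. fourier \<theta> (f x))"
  by (induction X rule: infinite_finite_induct) (auto simp: fourier_add)

lemma fourier_diff: "fourier \<theta> (f - g) = fourier \<theta> f - fourier \<theta> g"
  using fourier_add[of \<theta> "f - g" g] by (simp add: algebra_simps)

lemma fourier_mult: "fourier \<theta> (f * g) = fourier \<theta> f * fourier \<theta> g"
proof -
  have "f * g = (\<Sum>v\<in>keys f. Poly_Mapping.single v (lookup f v)) *
      (\<Sum>w\<in>keys g. Poly_Mapping.single w (lookup g w))"
    by (simp add: sum_single_lookup)
  also have "\<dots> = (\<Sum>v\<in>keys f. \<Sum>w\<in>keys g. Poly_Mapping.single (v + w) (lookup f v * lookup g w))"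
    by (simp add: sum_product mult_single)
  also have "fourier \<theta> \<dots> = (\<Sum>v\<in>keys f. \<Sum>w\<in>keys g. (lookup f v * chr \<theta> v) * (lookup g w * chr \<theta> w))"
    by (simp add: fourier_sum chr_add mult_ac)
  also have "\<dots> = fourier \<theta> f * fourier \<theta> g"
    by (simp add: fourier_def sum_product)
  finally show ?thesis .
qed

section \<open>Cubes of lattice points\<close>

definition icube :: "nat \<Rightarrow> (int ^ 'd) set" where
  "icube M = {v. \<forall>m. \<bar>v $ m\<bar> \<le> int M}"

lemma bij_betw_vec_nth:
  "bij_betw vec_nth {v :: 'b ^ 'd. \<forall>m. v $ m \<in> B} (PiE UNIV (\<lambda>_. B))"
  by (rule bij_betwI[where g = vec_lambda]) (auto simp: PiE_def)

lemma icube_altdef: "icube M = {v. \<forall>m. v $ m \<in> {- int M..int M}}"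
  by (simp add: icube_def abs_le_iff minus_le_iff conj_commute)

lemma sum_icube_prod:
  fixes g :: "'d::finite \<Rightarrow> int \<Rightarrow> complex"
  shows "(\<Sum>v\<in>icube M. \<Prod>m\<in>UNIV. g m (v $ m)) = (\<Prod>m\<in>UNIV. \<Sum>b\<in>{- int M..int M}. g m b)"
  unfolding icube_altdef
  by (subst prod_sum_PiE)
     (simp_all del: atLeastAtMost_iff add: sum.reindex_bij_betw[OF bij_betw_vec_nth, symmetric])

lemma finite_icube [simp]: "finite (icube M :: (int ^ 'd::finite) set)"
  unfolding icube_altdef using bij_betw_finite[OF bij_betw_vec_nth, of "{- int M..int M}"]
  by (auto intro: finite_PiE)

lemma card_icube: "card (icube M :: (int ^ 'd::finite) set) = (2 * M + 1) ^ CARD('d)"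
proof -
  have "card (PiE (UNIV :: 'd set) (\<lambda>_. {- int M..int M})) = (2 * M + 1) ^ CARD('d)"
    by (simp add: card_PiE del: card_atLeastAtMost_int)
       (subst card_atLeastAtMost_int, rule arg_cong[of _ _ "\<lambda>x. x ^ CARD('d)"], arith)
  then show ?thesis
    unfolding icube_altdef using bij_betw_same_card[OF bij_betw_vec_nth[where 'd = 'd], of "{- int M..int M}"]
    by simp
qed

lemma finite_subset_icube:
  fixes S :: "(int ^ 'd::finite) set"
  assumes "finite S"
  obtains M where "S \<subseteq> icube M"
proof -
  define M where "M = (\<Sum>v\<in>S. \<Sum>m\<in>UNIV. nat \<bar>v $ m\<bar>)"
  have "v \<in> icube M" if "v \<in> S" for v
    unfolding icube_def
  proof (safe)
    fix m
    have "nat \<bar>v $ m\<bar> \<le> (\<Sum>m\<in>UNIV. nat \<bar>v $ m\<bar>)"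
      by (rule member_le_sum) auto
    also have "\<dots> \<le> M"
      unfolding M_def using assms that
      by (intro member_le_sum[where f = "\<lambda>v. \<Sum>m\<in>UNIV. nat \<bar>v $ m\<bar>"]) auto
    finally show "\<bar>v $ m\<bar> \<le> int M" by linarith
  qed
  then show thesis using that by blast
qed

section \<open>Plancherel on a finite grid of frequencies\<close>

definition sqnorm :: "('a \<Rightarrow>\<^sub>0 complex) \<Rightarrow> real" where
  "sqnorm f = (\<Sum>v\<in>keys f. (cmod (lookup f v))\<^sup>2)"

lemma sqnorm_superset:
  assumes "finite S" "keys f \<subseteq> S"
  shows "sqnorm f = (\<Sum>v\<in>S. (cmod (lookup f v))\<^sup>2)"
  unfolding sqnorm_def using assms
  by (intro sum.mono_neutral_left) (auto simp: in_keys_iff)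

lemma sqnorm_nonneg [simp]: "sqnorm f \<ge> 0"
  by (simp add: sqnorm_def sum_nonneg)

lemma sum_le_sqnorm:
  assumes "finite V"
  shows "(\<Sum>v\<in>V. (cmod (lookup f v))\<^sup>2) \<le> sqnorm f"
proof -
  have "(\<Sum>v\<in>V. (cmod (lookup f v))\<^sup>2) \<le> (\<Sum>v\<in>V \<union> keys f. (cmod (lookup f v))\<^sup>2)"
    using assms by (intro sum_mono2) auto
  then show ?thesis using assms by (simp add: sqnorm_superset[of "V \<union> keys f"])
qed

text \<open>For \<open>j\<close> in \<open>icube M\<close> these frequencies give all characters of
  the residues modulo 2M + 1 in each coordinate, so Plancherel becomes a finite identity without an
  integral over the torus.\<close>

definition grid :: "nat \<Rightarrow> int ^ 'd \<Rightarrow> real ^ 'd" where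
  "grid M j = (\<chi> m. 2 * pi * real_of_int (j $ m) / (2 * real M + 1))"

lemma sum_cis_full_period:
  assumes "\<bar>u\<bar> \<le> 2 * int M"
  shows "(\<Sum>b\<in>{- int M..int M}. cis (2 * pi * real_of_int b / (2 * real M + 1) * real_of_int u))
    = (if u = 0 then 2 * of_nat M + 1 else 0)"
proof (cases "u = 0")
  case True
  then show ?thesis by simp
next
  case False
  define z where "z = cis (2 * pi * real_of_int u / (2 * real M + 1))"
  have z1: "z \<noteq> 1"
  proof
    assume "z = 1"
    then have "cos (2 * pi * real_of_int u / (2 * real M + 1)) = 1"
      unfolding z_def by (metis cis.simps(1) one_complex.sel(1))
    then obtain k :: int where "2 * pi * real_of_int u / (2 * real M + 1) = real_of_int k * (2 * pi)"
      by (auto simp: cos_one_2pi_int)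
    then have "(2 * pi) * real_of_int u = (2 * pi) * (real_of_int k * (2 * real M + 1))"
      by (simp add: field_simps)
    then have "real_of_int u = real_of_int k * (2 * real M + 1)"
      by (subst (asm) mult_cancel_left) simp
    then have "real_of_int u = real_of_int (k * (2 * int M + 1))"
      by simp
    then have u: "u = k * (2 * int M + 1)"
      by linarith
    then have "k \<noteq> 0" using False by auto
    then have "\<bar>k\<bar> \<ge> 1" by simp
    then have "\<bar>u\<bar> \<ge> 1 * (2 * int M + 1)"
      unfolding u abs_mult by (intro mult_mono) auto
    then show False using assms by simp
  qed
  have "(\<Sum>b\<in>{- int M..int M}. cis (2 * pi * real_of_int b / (2 * real M + 1) * real_of_int u))
      = (\<Sum>i<2 * M + 1. cis (2 * pi * (real i - real M) / (2 * real M + 1) * real_of_int u))"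
    by (rule sum.reindex_bij_witness[where i = "\<lambda>i. int i - int M" and j = "\<lambda>b. nat (b + int M)"])
       auto
  also have "\<dots> = (\<Sum>i<2 * M + 1. cis (- (2 * pi * real M / (2 * real M + 1) * real_of_int u)) * z ^ i)"
  proof (rule sum.cong[OF refl])
    fix i
    have "2 * pi * (real i - real M) / (2 * real M + 1) * real_of_int u
        = - (2 * pi * real M / (2 * real M + 1) * real_of_int u) + real i * (2 * pi * real_of_int u / (2 * real M + 1))"
      by (simp add: divide_inverse algebra_simps)
    then show "cis (2 * pi * (real i - real M) / (2 * real M + 1) * real_of_int u)
        = cis (- (2 * pi * real M / (2 * real M + 1) * real_of_int u)) * z ^ i"
      by (simp only: z_def Complex.DeMoivre cis_mult)
  qed
  also have "\<dots> = cis (- (2 * pi * real M / (2 * real M + 1) * real_of_int u)) * (\<Sum>i<2 * M + 1. z ^ i)"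
    by (rule sum_distrib_left[symmetric])
  also have "(\<Sum>i<2 * M + 1. z ^ i) = (z ^ (2 * M + 1) - 1) / (z - 1)"
    using z1 by (rule geometric_sum)
  also have "z ^ (2 * M + 1) = cis (2 * pi * real_of_int u)"
    unfolding z_def Complex.DeMoivre by (rule arg_cong[of _ _ cis]) (simp add: field_simps)
  also have "\<dots> = 1" by (simp add: cis_multiple_2pi)
  finally show ?thesis using False by simp
qed

lemma sum_chr_grid:
  fixes u :: "int ^ 'd::finite"
  assumes "u \<in> icube (2 * M)"
  shows "(\<Sum>j\<in>icube M. chr (grid M j) u) = (if u = 0 then (2 * of_nat M + 1) ^ CARD('d) else 0)"
proof -
  have cis_sum: "cis (\<Sum>m\<in>A. f m) = (\<Prod>m\<in>A. cis (f m))" for f :: "'d \<Rightarrow> real" and A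
    by (induction A rule: infinite_finite_induct) (auto simp flip: cis_mult)
  define g where "g = (\<lambda>m b. cis (2 * pi * real_of_int b / (2 * real M + 1) * real_of_int (u $ m)))"
  have "(\<Sum>j\<in>icube M. chr (grid M j) u) = (\<Sum>j\<in>icube M. \<Prod>m\<in>UNIV. g m (j $ m))"
    by (simp add: chr_def grid_def cis_sum g_def)
  also have "\<dots> = (\<Prod>m\<in>UNIV. \<Sum>b\<in>{- int M..int M}. g m b)"
    by (rule sum_icube_prod)
  also have "\<dots> = (\<Prod>m\<in>UNIV. if u $ m = 0 then 2 * of_nat M + 1 else 0)"
    unfolding g_def using assms
    by (intro prod.cong refl sum_cis_full_period) (auto simp: icube_def)
  also have "\<dots> = (if u = 0 then (2 * of_nat M + 1) ^ CARD('d) else 0)"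
    by (auto simp: vec_eq_iff)
  finally show ?thesis .
qed

text \<open>Two points of \<open>icube M\<close> differ by an element of
  \<open>icube (2 * M)\<close>, whose coordinates stay below the period 2M + 1. Distinct points are
  therefore distinct modulo the period, and the off-diagonal terms of the expanded square
  cancel.\<close>

lemma plancherel:
  fixes f :: "int ^ 'd::finite \<Rightarrow>\<^sub>0 complex"
  assumes "keys f \<subseteq> icube M"
  shows "(\<Sum>j\<in>icube M. (cmod (fourier (grid M j) f))\<^sup>2) = (2 * real M + 1) ^ CARD('d) * sqnorm f"
proof -
  have "complex_of_real (\<Sum>j\<in>icube M. (cmod (fourier (grid M j) f))\<^sup>2)
      = (\<Sum>j\<in>icube M. fourier (grid M j) f * cnj (fourier (grid M j) f))"
    by (simp only: of_real_sum complex_norm_square)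
  also have "\<dots> = (\<Sum>j\<in>icube M. \<Sum>v\<in>keys f. \<Sum>w\<in>keys f.
      lookup f v * cnj (lookup f w) * chr (grid M j) (v - w))"
    unfolding fourier_def cnj_sum complex_cnj_mult sum_product cnj_chr diff_conv_add_uminus chr_add
    by (simp add: mult_ac)
  also have "\<dots> = (\<Sum>v\<in>keys f. \<Sum>w\<in>keys f. lookup f v * cnj (lookup f w) *
      (\<Sum>j\<in>icube M. chr (grid M j) (v - w)))"
  proof -
    have "(\<Sum>j\<in>icube M. \<Sum>w\<in>keys f. lookup f v * cnj (lookup f w) * chr (grid M j) (v - w))
        = (\<Sum>w\<in>keys f. lookup f v * cnj (lookup f w) * (\<Sum>j\<in>icube M. chr (grid M j) (v - w)))" for v
      unfolding sum_distrib_left by (rule sum.swap)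
    then show ?thesis by (subst sum.swap) (simp only:)
  qed
  also have "\<dots> = (\<Sum>v\<in>keys f. \<Sum>w\<in>keys f. if v = w
      then (2 * of_nat M + 1) ^ CARD('d) * (lookup f v * cnj (lookup f v)) else 0)"
  proof (intro sum.cong refl)
    fix v w assume "v \<in> keys f" "w \<in> keys f"
    then have "v \<in> icube M" "w \<in> icube M" using assms by auto
    have "\<bar>(v - w) $ m\<bar> \<le> int (2 * M)" for m
    proof -
      have "\<bar>v $ m\<bar> \<le> int M" "\<bar>w $ m\<bar> \<le> int M"
        using \<open>v \<in> icube M\<close> \<open>w \<in> icube M\<close> by (auto simp: icube_def)
      then show ?thesis by simp
    qed
    then have "v - w \<in> icube (2 * M)" by (simp add: icube_def)
    from sum_chr_grid[OF this] show "lookup f v * cnj (lookup f w) * (\<Sum>j\<in>icube M. chr (grid M j) (v - w))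
        = (if v = w then (2 * of_nat M + 1) ^ CARD('d) * (lookup f v * cnj (lookup f v)) else 0)"
      by auto
  qed
  also have "\<dots> = complex_of_real ((2 * real M + 1) ^ CARD('d) * sqnorm f)"
    unfolding complex_norm_square[symmetric] by (simp add: sqnorm_def sum_distrib_left)
  finally show ?thesis unfolding of_real_eq_iff .
qed

lemma grid_bound:
  assumes "j \<in> icube M"
  shows "\<bar>grid M j $ m\<bar> \<le> pi"
proof -
  have "\<bar>real_of_int (j $ m)\<bar> \<le> real M"
    using assms by (auto simp: icube_def) (metis of_int_abs of_int_le_iff of_int_of_nat_eq)
  then have "2 * pi * \<bar>real_of_int (j $ m)\<bar> \<le> 2 * pi * real M"
    by (intro mult_left_mono) auto
  also have "\<dots> \<le> pi * (2 * real M + 1)" by (simp add: algebra_simps)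
  finally show ?thesis by (simp add: grid_def abs_mult field_simps)
qed

text \<open>Only finitely many supports occur, so one grid serves \<open>f\<close> and all products;
  the estimate is made frequency by frequency and the size of the grid cancels. Grid frequencies lie
  in [-pi, pi], so \<open>bound\<close> is asked only there, where |cis x - 1| is comparable to
  |x|.\<close>

lemma multiplier_bound:
  fixes K :: "'i \<Rightarrow> (int ^ 'd::finite \<Rightarrow>\<^sub>0 complex)" and g :: "'i \<Rightarrow> (int ^ 'd \<Rightarrow>\<^sub>0 complex)"
  assumes "finite F"
    and bound: "\<And>\<theta>. (\<And>m. \<bar>\<theta> $ m\<bar> \<le> pi) \<Longrightarrow> (\<Sum>k\<in>F. (cmod (fourier \<theta> (K k)))\<^sup>2) \<le> B"
  shows "(\<Sum>k\<in>F. sqnorm (K k * f)) \<le> B * sqnorm f"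
proof -
  have "finite (keys f \<union> (\<Union>k\<in>F. keys (K k * f)))" using assms(1) by auto
  then obtain M where "keys f \<union> (\<Union>k\<in>F. keys (K k * f)) \<subseteq> icube M"
    by (rule finite_subset_icube)
  then have M: "keys f \<subseteq> icube M" "\<And>k. k \<in> F \<Longrightarrow> keys (K k * f) \<subseteq> icube M" by auto
  define D where "D = (2 * real M + 1) ^ CARD('d)"
  have "D > 0" by (simp add: D_def add_pos_pos add.commute)
  have "D * (\<Sum>k\<in>F. sqnorm (K k * f)) = (\<Sum>k\<in>F. \<Sum>j\<in>icube M. (cmod (fourier (grid M j) (K k * f)))\<^sup>2)"
    unfolding sum_distrib_left D_def using M(2) by (intro sum.cong refl plancherel[symmetric])
  also have "\<dots> = (\<Sum>j\<in>icube M. (\<Sum>k\<in>F. (cmod (fourier (grid M j) (K k)))\<^sup>2) * (cmod (fourier (grid M j) f))\<^sup>2)"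
    by (subst sum.swap) (simp add: fourier_mult norm_mult power_mult_distrib sum_distrib_right)
  also have "\<dots> \<le> (\<Sum>j\<in>icube M. B * (cmod (fourier (grid M j) f))\<^sup>2)"
    by (intro sum_mono mult_right_mono bound grid_bound) auto
  also have "\<dots> = D * (B * sqnorm f)"
    unfolding D_def sum_distrib_left[symmetric] plancherel[OF M(1)] by (simp only: mult_ac)
  finally show ?thesis using \<open>D > 0\<close> by simp
qed

section \<open>The maximal inequality for cubes\<close>

definition cube_weight :: "nat \<Rightarrow> int ^ 'd::finite \<Rightarrow> real" where
  "cube_weight R u = (if u \<in> icube R then 1 / (2 * real R + 1) ^ CARD('d) else 0)"

lemma cube_weight_nonneg [simp]: "cube_weight R u \<ge> 0"
  by (simp add: cube_weight_def)

lemma cube_weight_le_1: "cube_weight R u \<le> 1"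
  by (simp add: cube_weight_def divide_le_eq_1)

lemma icube_minus_iff: "v - w \<in> icube R \<longleftrightarrow> w - v \<in> icube R"
  by (simp add: icube_def abs_minus_commute)

lemma cube_weight_minus: "cube_weight R (v - w) = cube_weight R (w - v)"
  by (simp add: cube_weight_def icube_minus_iff)

lemma icube_mono: "R \<le> R' \<Longrightarrow> icube R \<subseteq> icube R'"
  by (auto simp: icube_def) (meson of_nat_mono order_trans)

lemma icube_add:
  assumes "u \<in> icube R" "v \<in> icube R'"
  shows "u + v \<in> icube (R + R')"
  unfolding icube_def
proof safe
  fix m
  have "\<bar>u $ m\<bar> \<le> int R" "\<bar>v $ m\<bar> \<le> int R'" using assms by (auto simp: icube_def)
  then show "\<bar>(u + v) $ m\<bar> \<le> int (R + R')" by simp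
qed

lemma sum_cube_weight_le_1:
  assumes "finite S"
  shows "(\<Sum>w\<in>S. cube_weight R (v - w :: int ^ 'd::finite)) \<le> 1"
proof -
  have "(\<Sum>w\<in>S. cube_weight R (v - w)) = (\<Sum>w\<in>{w \<in> S. v - w \<in> icube R}. 1 / (2 * real R + 1) ^ CARD('d))"
    using assms by (simp add: cube_weight_def sum.If_cases Int_def)
  also have "\<dots> = card {w \<in> S. v - w \<in> icube R} / (2 * real R + 1) ^ CARD('d)"
    by simp
  also have "\<dots> \<le> card (icube R :: (int ^ 'd) set) / (2 * real R + 1) ^ CARD('d)"
  proof (intro divide_right_mono of_nat_mono card_inj_on_le)
    show "inj_on (\<lambda>w. v - w) {w \<in> S. v - w \<in> icube R}" by (auto simp: inj_on_def)
  qed (auto simp: add_nonneg_nonneg)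
  also have "\<dots> = 1" by (simp add: card_icube add.commute add_pos_nonneg)
  finally show ?thesis .
qed

lemma sum_cube_weight_le_1':
  assumes "finite S"
  shows "(\<Sum>w\<in>S. cube_weight R (w - v :: int ^ 'd::finite)) \<le> 1"
  using sum_cube_weight_le_1[OF assms, of R v] by (simp add: cube_weight_minus)

text \<open>The convolution lives on the cube of radius R + R' \<le> 2R, and its height is at most
  that of the wider kernel, the other having mass at most 1. The factor 2^d is the loss in volume
  from radius \<open>R\<close> to radius 2R.\<close>

lemma cube_weight_convolution_le:
  fixes v v' :: "int ^ 'd::finite"
  assumes "finite S" "R' \<le> R"
  shows "(\<Sum>w\<in>S. cube_weight R (v - w) * cube_weight R' (v' - w)) \<le> 2 ^ CARD('d) * cube_weight (2 * R) (v - v')"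
proof (cases "v - v' \<in> icube (2 * R)")
  case True
  have "(\<Sum>w\<in>S. cube_weight R (v - w) * cube_weight R' (v' - w)) \<le> (\<Sum>w\<in>S. 1 / (2 * real R + 1) ^ CARD('d) * cube_weight R' (v' - w))"
    by (intro sum_mono mult_right_mono) (auto simp: cube_weight_def)
  also have "\<dots> \<le> 1 / (2 * real R + 1) ^ CARD('d) * 1"
    unfolding sum_distrib_left[symmetric] by (intro mult_left_mono sum_cube_weight_le_1 assms) auto
  also have "\<dots> = 2 ^ CARD('d) * (1 / (2 * (2 * real R + 1)) ^ CARD('d))"
    by (simp add: power_mult_distrib del: distrib_left_numeral)
  also have "\<dots> \<le> 2 ^ CARD('d) * (1 / (2 * real (2 * R) + 1) ^ CARD('d))"
    by (intro mult_left_mono divide_left_mono power_mono mult_pos_pos zero_less_power) auto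
  finally show ?thesis using True by (simp add: cube_weight_def)
next
  case False
  have "cube_weight R (v - w) * cube_weight R' (v' - w) = 0" for w
  proof (rule ccontr)
    assume "cube_weight R (v - w) * cube_weight R' (v' - w) \<noteq> 0"
    then have "v - w \<in> icube R" "w - v' \<in> icube R'"
      by (auto simp: cube_weight_def icube_minus_iff split: if_splits)
    then have "v - w \<in> icube R" "w - v' \<in> icube R" using icube_mono[OF assms(2)] by auto
    from icube_add[OF this] show False using False by (simp add: mult_2)
  qed
  then have "(\<Sum>w\<in>S. cube_weight R (v - w) * cube_weight R' (v' - w)) = 0" by (intro sum.neutral) blast
  then show ?thesis by simp
qed

text \<open>A bound for the adjoint of the linearised maximal operator with radii \<open>\<rho> \<le> L\<close>.\<close>

definition maximal_bound :: "'d::finite itself \<Rightarrow> nat \<Rightarrow> real \<Rightarrow> bool" where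
  "maximal_bound _ L B \<longleftrightarrow> (\<forall>(\<rho> :: int ^ 'd \<Rightarrow> nat) V S f. finite V \<longrightarrow> finite S \<longrightarrow>
     (\<forall>v. \<rho> v \<le> L) \<longrightarrow> (\<forall>v. 0 \<le> f v) \<longrightarrow>
     (\<Sum>w\<in>S. (\<Sum>v\<in>V. cube_weight (\<rho> v) (v - w) * f v)\<^sup>2) \<le> B * (\<Sum>v\<in>V. (f v)\<^sup>2))"

text \<open>A bound that depends on \<open>L\<close> is enough to make the set of admissible
  constants nonempty; the bootstrap then removes the dependence. The proof is Cauchy-Schwarz with
  the weights split evenly, counting the at most (2L + 1)^d points \<open>v\<close> that reach a
  given \<open>w\<close>.\<close>

lemma maximal_bound_trivial: "maximal_bound TYPE('d::finite) L ((2 * real L + 1) ^ CARD('d))"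
  unfolding maximal_bound_def
proof (intro allI impI)
  fix \<rho> :: "int ^ 'd \<Rightarrow> nat" and V S :: "(int ^ 'd) set" and f :: "int ^ 'd \<Rightarrow> real"
  assume fin: "finite V" "finite S" and \<rho>: "\<forall>v. \<rho> v \<le> L" and f: "\<forall>v. 0 \<le> f v"
  have "(\<Sum>v\<in>V. cube_weight (\<rho> v) (v - w) * f v)\<^sup>2 \<le> (2 * real L + 1) ^ CARD('d) * (\<Sum>v\<in>V. cube_weight (\<rho> v) (v - w) * (f v)\<^sup>2)" for w
  proof -
    have "(\<Sum>v\<in>V. cube_weight (\<rho> v) (v - w) * f v)\<^sup>2 = (\<Sum>v\<in>V. sqrt (cube_weight (\<rho> v) (v - w)) * (sqrt (cube_weight (\<rho> v) (v - w)) * f v))\<^sup>2"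
      by (simp flip: mult.assoc)
    also have "\<dots> \<le> (\<Sum>v\<in>V. (sqrt (cube_weight (\<rho> v) (v - w)))\<^sup>2) * (\<Sum>v\<in>V. (sqrt (cube_weight (\<rho> v) (v - w)) * f v)\<^sup>2)"
      by (rule Cauchy_Schwarz_ineq_sum)
    also have "\<dots> = (\<Sum>v\<in>V. cube_weight (\<rho> v) (v - w)) * (\<Sum>v\<in>V. cube_weight (\<rho> v) (v - w) * (f v)\<^sup>2)"
      by (simp add: power_mult_distrib)
    also have "\<dots> \<le> (2 * real L + 1) ^ CARD('d) * (\<Sum>v\<in>V. cube_weight (\<rho> v) (v - w) * (f v)\<^sup>2)"
    proof (intro mult_right_mono sum_nonneg)
      have "(\<Sum>v\<in>V. cube_weight (\<rho> v) (v - w)) \<le> (\<Sum>v\<in>V. if v - w \<in> icube L then 1 else 0)"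
        using \<rho> icube_mono[of "\<rho> v" L for v] by (intro sum_mono) (auto simp: cube_weight_le_1 cube_weight_def divide_le_eq_1)
      also have "\<dots> = card {v \<in> V. v - w \<in> icube L}"
        using fin by (simp add: sum.If_cases Int_def)
      also have "\<dots> \<le> card (icube L :: (int ^ 'd) set)"
        by (intro of_nat_mono card_inj_on_le[of "\<lambda>v. v - w"]) (auto simp: inj_on_def)
      finally show "(\<Sum>v\<in>V. cube_weight (\<rho> v) (v - w)) \<le> (2 * real L + 1) ^ CARD('d)"
        by (simp add: card_icube add.commute)
    qed auto
    finally show ?thesis .
  qed
  then have "(\<Sum>w\<in>S. (\<Sum>v\<in>V. cube_weight (\<rho> v) (v - w) * f v)\<^sup>2)
      \<le> (2 * real L + 1) ^ CARD('d) * (\<Sum>w\<in>S. \<Sum>v\<in>V. cube_weight (\<rho> v) (v - w) * (f v)\<^sup>2)"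
    unfolding sum_distrib_left by (rule sum_mono)
  also have "(\<Sum>w\<in>S. \<Sum>v\<in>V. cube_weight (\<rho> v) (v - w) * (f v)\<^sup>2) = (\<Sum>v\<in>V. (\<Sum>w\<in>S. cube_weight (\<rho> v) (v - w)) * (f v)\<^sup>2)"
    by (subst sum.swap) (simp add: sum_distrib_right)
  also have "\<dots> \<le> (\<Sum>v\<in>V. 1 * (f v)\<^sup>2)"
    by (intro sum_mono mult_right_mono sum_cube_weight_le_1 fin) auto
  finally show "(\<Sum>w\<in>S. (\<Sum>v\<in>V. cube_weight (\<rho> v) (v - w) * f v)\<^sup>2) \<le> (2 * real L + 1) ^ CARD('d) * (\<Sum>v\<in>V. (f v)\<^sup>2)"
    by (simp add: mult_left_mono)
qed

text \<open>Expanding the square produces convolutions of two weights, each at most 2^d times one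
  weight of twice the larger radius. What remains is the form \<open>\<Phi>\<close>, linear in the
  adjoint operator, so the assumed bound \<open>B\<close> enters only through its square root.
  Doubling may push radii beyond \<open>L\<close>; those are handled by a single fixed radius
  2L.\<close>

lemma maximal_bound_bootstrap:
  assumes B: "maximal_bound TYPE('d::finite) L B" "B \<ge> 0"
  shows "maximal_bound TYPE('d) L (2 ^ (CARD('d) + 1) * (sqrt B + 2 ^ CARD('d)))"
  unfolding maximal_bound_def
proof (intro allI impI)
  fix \<rho> :: "int ^ 'd \<Rightarrow> nat" and V S :: "(int ^ 'd) set" and f :: "int ^ 'd \<Rightarrow> real"
  assume fin: "finite V" "finite S" and \<rho>: "\<forall>v. \<rho> v \<le> L" and f: "\<forall>v. 0 \<le> f v"
  define F where "F = (\<Sum>v\<in>V. (f v)\<^sup>2)"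
  have F: "F \<ge> 0" by (simp add: F_def sum_nonneg)
  define \<Phi> where "\<Phi> = (\<lambda>\<rho>. \<Sum>v\<in>V. \<Sum>v'\<in>V. cube_weight (\<rho> v) (v - v') * (f v * f v'))"
  \<comment> \<open>Points with 2 \<rho> v > L get the dummy radius 0, which keeps
    \<open>\<rho>'\<close> below \<open>L\<close>. They are charged to the fixed radius 2L instead:
    as L < 2 \<rho> v \<le> 2L, the heights of the two kernels differ by a factor of at most
    2^d.\<close>
  define \<rho>' where "\<rho>' = (\<lambda>v. if 2 * \<rho> v \<le> L then 2 * \<rho> v else 0)"
  have "(\<Sum>w\<in>S. (\<Sum>v\<in>V. cube_weight (\<rho> v) (v - w) * f v)\<^sup>2) =
      (\<Sum>w\<in>S. \<Sum>v\<in>V. \<Sum>v'\<in>V. f v * f v' * (cube_weight (\<rho> v) (v - w) * cube_weight (\<rho> v') (v' - w)))"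
    unfolding power2_eq_square sum_product by (simp add: mult_ac)
  also have "\<dots> = (\<Sum>v\<in>V. \<Sum>w\<in>S. \<Sum>v'\<in>V. f v * f v' * (cube_weight (\<rho> v) (v - w) * cube_weight (\<rho> v') (v' - w)))"
    by (rule sum.swap)
  also have "\<dots> = (\<Sum>v\<in>V. \<Sum>v'\<in>V. f v * f v' * (\<Sum>w\<in>S. cube_weight (\<rho> v) (v - w) * cube_weight (\<rho> v') (v' - w)))"
    unfolding sum_distrib_left by (intro sum.cong refl sum.swap)
  also have "\<dots> \<le> (\<Sum>v\<in>V. \<Sum>v'\<in>V. f v * f v' *
      (2 ^ CARD('d) * (cube_weight (2 * \<rho> v) (v - v') + cube_weight (2 * \<rho> v') (v' - v))))"
  proof (intro sum_mono mult_left_mono)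
    fix v v'
    show "(\<Sum>w\<in>S. cube_weight (\<rho> v) (v - w) * cube_weight (\<rho> v') (v' - w))
        \<le> 2 ^ CARD('d) * (cube_weight (2 * \<rho> v) (v - v') + cube_weight (2 * \<rho> v') (v' - v))"
    proof (cases "\<rho> v' \<le> \<rho> v")
      case True
      from cube_weight_convolution_le[OF fin(2) this, of v v'] show ?thesis
        by (rule order_trans) (auto intro: mult_left_mono)
    next
      case False
      then have "\<rho> v \<le> \<rho> v'" by simp
      from cube_weight_convolution_le[OF fin(2) this, of v' v] show ?thesis
        by (subst mult.commute) (rule order_trans, auto intro: mult_left_mono)
    qed
  qed (use f in auto)
  also have "\<dots> = 2 ^ CARD('d) * (\<Phi> (\<lambda>v. 2 * \<rho> v) + (\<Sum>v\<in>V. \<Sum>v'\<in>V. cube_weight (2 * \<rho> v') (v' - v) * (f v' * f v)))"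
    unfolding \<Phi>_def sum_distrib_left sum.distrib[symmetric] by (simp add: algebra_simps)
  also have "(\<Sum>v\<in>V. \<Sum>v'\<in>V. cube_weight (2 * \<rho> v') (v' - v) * (f v' * f v)) = \<Phi> (\<lambda>v. 2 * \<rho> v)"
    unfolding \<Phi>_def by (rule sum.swap)
  also have "2 ^ CARD('d) * (\<Phi> (\<lambda>v. 2 * \<rho> v) + \<Phi> (\<lambda>v. 2 * \<rho> v)) = 2 ^ (CARD('d) + 1) * \<Phi> (\<lambda>v. 2 * \<rho> v)"
    by simp
  also have "\<dots> \<le> 2 ^ (CARD('d) + 1) * (sqrt B * F + 2 ^ CARD('d) * F)"
  proof (intro mult_left_mono)
    have "\<Phi> (\<lambda>v. 2 * \<rho> v) \<le> (\<Sum>v\<in>V. \<Sum>v'\<in>V. (cube_weight (\<rho>' v) (v - v') + 2 ^ CARD('d) * cube_weight (2 * L) (v - v')) * (f v * f v'))"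
      unfolding \<Phi>_def
    proof (intro sum_mono mult_right_mono)
      fix v v'
      show "cube_weight (2 * \<rho> v) (v - v') \<le> cube_weight (\<rho>' v) (v - v') + 2 ^ CARD('d) * cube_weight (2 * L) (v - v')"
      proof (cases "2 * \<rho> v \<le> L \<or> v - v' \<notin> icube (2 * \<rho> v)")
        case True
        then show ?thesis by (auto simp: \<rho>'_def) (simp add: cube_weight_def)
      next
        case False
        then have "v - v' \<in> icube (2 * L)" using icube_mono[of "2 * \<rho> v" "2 * L"] \<rho> by auto
        have "1 / (2 * real (2 * \<rho> v) + 1) ^ CARD('d) = 2 ^ CARD('d) * (1 / (2 * (2 * real (2 * \<rho> v) + 1)) ^ CARD('d))"
          by (simp add: power_mult_distrib del: distrib_left_numeral)
        also have "\<dots> \<le> 2 ^ CARD('d) * (1 / (2 * real (2 * L) + 1) ^ CARD('d))"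
          using False by (intro mult_left_mono divide_left_mono power_mono mult_pos_pos zero_less_power) auto
        finally have "cube_weight (2 * \<rho> v) (v - v') \<le> 2 ^ CARD('d) * cube_weight (2 * L) (v - v')"
          using False \<open>v - v' \<in> icube (2 * L)\<close> by (simp add: cube_weight_def)
        then show ?thesis using cube_weight_nonneg[of "\<rho>' v" "v - v'"] by linarith
      qed
    qed (use f in auto)
    also have "\<dots> = \<Phi> \<rho>' + 2 ^ CARD('d) * \<Phi> (\<lambda>_. 2 * L)"
      unfolding \<Phi>_def sum_distrib_left sum.distrib[symmetric] by (simp add: algebra_simps)
    also have "\<dots> \<le> sqrt B * F + 2 ^ CARD('d) * F"
    proof (intro add_mono mult_left_mono)
      \<comment> \<open>The bound \<open>B\<close> is used with \<open>S\<close> equal to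
        \<open>V\<close>; pairing with \<open>f\<close> by Cauchy-Schwarz turns it into
        \<open>sqrt B\<close>.\<close>
      have "(\<Sum>w\<in>V. (\<Sum>v\<in>V. cube_weight (\<rho>' v) (v - w) * f v)\<^sup>2) \<le> B * F"
        using B(1) fin f unfolding maximal_bound_def F_def by (auto simp: \<rho>'_def)
      then have "F * (\<Sum>w\<in>V. (\<Sum>v\<in>V. cube_weight (\<rho>' v) (v - w) * f v)\<^sup>2) \<le> F * (B * F)"
        using F by (rule mult_left_mono)
      also have "\<dots> = (sqrt B * F)\<^sup>2"
        using B(2) by (simp add: power_mult_distrib power2_eq_square)
      finally have "F * (\<Sum>w\<in>V. (\<Sum>v\<in>V. cube_weight (\<rho>' v) (v - w) * f v)\<^sup>2) \<le> (sqrt B * F)\<^sup>2" .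
      moreover have "\<Phi> \<rho>' = (\<Sum>w\<in>V. f w * (\<Sum>v\<in>V. cube_weight (\<rho>' v) (v - w) * f v))"
        unfolding \<Phi>_def by (subst sum.swap) (simp add: sum_distrib_left mult_ac)
      then have "(\<Phi> \<rho>')\<^sup>2 \<le> F * (\<Sum>w\<in>V. (\<Sum>v\<in>V. cube_weight (\<rho>' v) (v - w) * f v)\<^sup>2)"
        unfolding F_def by (simp only: Cauchy_Schwarz_ineq_sum)
      ultimately have "(\<Phi> \<rho>')\<^sup>2 \<le> (sqrt B * F)\<^sup>2" by linarith
      then show "\<Phi> \<rho>' \<le> sqrt B * F"
        by (rule power2_le_imp_le) (use F B(2) in simp)
    next
      \<comment> \<open>Schur's test: for a fixed radius both the row sums and the column sums of
        the weights are at most 1.\<close>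
      have "\<Phi> (\<lambda>_. 2 * L) \<le> (\<Sum>v\<in>V. \<Sum>v'\<in>V. cube_weight (2 * L) (v - v') * (((f v)\<^sup>2 + (f v')\<^sup>2) / 2))"
        unfolding \<Phi>_def
      proof (intro sum_mono mult_left_mono)
        fix v v'
        show "f v * f v' \<le> ((f v)\<^sup>2 + (f v')\<^sup>2) / 2"
          using sum_squares_bound[of "f v" "f v'"] by simp
      qed auto
      also have "\<dots> = (\<Sum>v\<in>V. \<Sum>v'\<in>V. cube_weight (2 * L) (v - v') * ((f v)\<^sup>2 / 2)) + (\<Sum>v\<in>V. \<Sum>v'\<in>V. cube_weight (2 * L) (v - v') * ((f v')\<^sup>2 / 2))"
        unfolding sum.distrib[symmetric] by (simp add: algebra_simps add_divide_distrib)
      also have "(\<Sum>v\<in>V. \<Sum>v'\<in>V. cube_weight (2 * L) (v - v') * ((f v')\<^sup>2 / 2)) = (\<Sum>v'\<in>V. \<Sum>v\<in>V. cube_weight (2 * L) (v - v') * ((f v')\<^sup>2 / 2))"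
        by (rule sum.swap)
      also have "(\<Sum>v\<in>V. \<Sum>v'\<in>V. cube_weight (2 * L) (v - v') * ((f v)\<^sup>2 / 2)) + \<dots>
          \<le> (\<Sum>v\<in>V. 1 * ((f v)\<^sup>2 / 2)) + (\<Sum>v\<in>V. 1 * ((f v)\<^sup>2 / 2))"
        unfolding sum_distrib_right[symmetric]
        by (intro add_mono sum_mono mult_right_mono sum_cube_weight_le_1 sum_cube_weight_le_1' fin) auto
      also have "\<dots> = F" by (simp add: F_def flip: sum.distrib)
      finally show "\<Phi> (\<lambda>_. 2 * L) \<le> F" .
    qed auto
    finally show "\<Phi> (\<lambda>v. 2 * \<rho> v) \<le> sqrt B * F + 2 ^ CARD('d) * F" .
  qed auto
  finally show "(\<Sum>w\<in>S. (\<Sum>v\<in>V. cube_weight (\<rho> v) (v - w) * f v)\<^sup>2)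
      \<le> 2 ^ (CARD('d) + 1) * (sqrt B + 2 ^ CARD('d)) * (\<Sum>v\<in>V. (f v)\<^sup>2)"
    by (simp add: F_def algebra_simps)
qed

text \<open>With A = 2^(d+1), the best constant \<open>B\<close> satisfies B \<le> A (sqrt B + A).
  The right side grows only like \<open>sqrt B\<close>, which forces sqrt B \<le> 2A, whatever
  \<open>L\<close> is.\<close>

lemma maximal_bound_uniform: "maximal_bound TYPE('d::finite) L (4 * (2 ^ (CARD('d) + 1))\<^sup>2)"
proof -
  define A where "A = (2 :: real) ^ (CARD('d) + 1)"
  define X where "X = {B. B \<ge> 0 \<and> maximal_bound TYPE('d) L B}"
  have "(2 * real L + 1) ^ CARD('d) \<in> X" by (simp add: X_def maximal_bound_trivial)
  then have X: "X \<noteq> {}" by blast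
  have "bdd_below X" by (rule bdd_belowI[of _ 0]) (simp add: X_def)
  note X = X this
  define B where "B = Inf X"
  have B0: "B \<ge> 0" unfolding B_def using X by (intro cInf_greatest) (auto simp: X_def)
  \<comment> \<open>For fixed data the inequality is closed in the constant, so the infimum is
    itself admissible and can be bootstrapped.\<close>
  have "maximal_bound TYPE('d) L B"
    unfolding maximal_bound_def
  proof (intro allI impI)
    fix \<rho> :: "int ^ 'd \<Rightarrow> nat" and V S :: "(int ^ 'd) set" and f :: "int ^ 'd \<Rightarrow> real"
    assume fin: "finite V" "finite S" and \<rho>: "\<forall>v. \<rho> v \<le> L" and f: "\<forall>v. 0 \<le> f v"
    define F where "F = (\<Sum>v\<in>V. (f v)\<^sup>2)"
    define T where "T = (\<Sum>w\<in>S. (\<Sum>v\<in>V. cube_weight (\<rho> v) (v - w) * f v)\<^sup>2)"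
    have F: "F \<ge> 0" by (simp add: F_def sum_nonneg)
    have T: "T \<le> b * F" if "b \<in> X" for b
      using that fin \<rho> f unfolding X_def maximal_bound_def T_def F_def by auto
    have "T \<le> B * F"
    proof (cases "F = 0")
      case True
      then show ?thesis using X(1) T by auto
    next
      case False
      then have "T / F \<le> B"
        unfolding B_def using X F T by (intro cInf_greatest) (auto simp: field_simps)
      then show ?thesis using F False by (simp add: field_simps)
    qed
    then show "(\<Sum>w\<in>S. (\<Sum>v\<in>V. cube_weight (\<rho> v) (v - w) * f v)\<^sup>2) \<le> B * (\<Sum>v\<in>V. (f v)\<^sup>2)"
      by (simp add: T_def F_def)
  qed
  from maximal_bound_bootstrap[OF this B0] have "A * (sqrt B + 2 ^ CARD('d)) \<in> X"
    using B0 by (simp add: X_def A_def)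
  then have "B \<le> A * (sqrt B + 2 ^ CARD('d))"
    unfolding B_def using X by (intro cInf_lower) auto
  also have "\<dots> \<le> A * (sqrt B + A)"
    by (intro mult_left_mono add_mono) (auto simp: A_def)
  finally have le: "(sqrt B)\<^sup>2 \<le> A * (sqrt B + A)" using B0 by simp
  have A: "A > 0" by (simp add: A_def)
  have "sqrt B \<le> 2 * A"
  proof (rule ccontr)
    assume "\<not> sqrt B \<le> 2 * A"
    then have "2 * A < sqrt B" "0 < sqrt B" using A by linarith+
    then have "sqrt B * sqrt B > (2 * A) * sqrt B" by (rule mult_strict_right_mono)
    moreover have "A * sqrt B \<ge> A * (2 * A)" using A \<open>\<not> sqrt B \<le> 2 * A\<close> by (intro mult_left_mono) auto
    moreover have "A * A > 0" using A by simp
    ultimately show False using le by (simp add: power2_eq_square algebra_simps)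
  qed
  then have "(sqrt B)\<^sup>2 \<le> (2 * A)\<^sup>2" using B0 by (intro power_mono) auto
  then have "B \<le> 4 * A\<^sup>2" using B0 by (simp add: power_mult_distrib)
  have "maximal_bound TYPE('d) L (4 * A\<^sup>2)"
    unfolding maximal_bound_def
  proof (intro allI impI)
    fix \<rho> :: "int ^ 'd \<Rightarrow> nat" and V S :: "(int ^ 'd) set" and f :: "int ^ 'd \<Rightarrow> real"
    assume fin: "finite V" "finite S" and \<rho>: "\<forall>v. \<rho> v \<le> L" and f: "\<forall>v. 0 \<le> f v"
    have "(\<Sum>w\<in>S. (\<Sum>v\<in>V. cube_weight (\<rho> v) (v - w) * f v)\<^sup>2) \<le> B * (\<Sum>v\<in>V. (f v)\<^sup>2)"
      using \<open>maximal_bound TYPE('d) L B\<close> fin \<rho> f unfolding maximal_bound_def by auto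
    also have "\<dots> \<le> 4 * A\<^sup>2 * (\<Sum>v\<in>V. (f v)\<^sup>2)"
      using \<open>B \<le> 4 * A\<^sup>2\<close> by (intro mult_right_mono) (auto intro: sum_nonneg)
    finally show "(\<Sum>w\<in>S. (\<Sum>v\<in>V. cube_weight (\<rho> v) (v - w) * f v)\<^sup>2) \<le> 4 * A\<^sup>2 * (\<Sum>v\<in>V. (f v)\<^sup>2)" .
  qed
  then show ?thesis by (simp add: A_def)
qed

section \<open>Cube averages as group ring elements, and their maximal inequality\<close>

definition cube :: "nat \<Rightarrow> int ^ 'd::finite \<Rightarrow>\<^sub>0 complex" where
  "cube R = (\<Sum>w\<in>icube R. Poly_Mapping.single w (1 / (2 * of_nat R + 1) ^ CARD('d)))"

lemma lookup_cube_mult: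
  fixes h :: "int ^ 'd::finite \<Rightarrow>\<^sub>0 complex"
  shows "lookup (cube R * h) v = (\<Sum>w\<in>keys h. of_real (cube_weight R (v - w)) * lookup h w)"
proof -
  have "lookup (cube R * h) v = (\<Sum>w\<in>icube R. 1 / (2 * of_nat R + 1) ^ CARD('d) * lookup h (v - w))"
    unfolding cube_def by (rule lookup_sum_single_mult)
  also have "\<dots> = (\<Sum>w\<in>{w. v - w \<in> icube R}. 1 / (2 * of_nat R + 1) ^ CARD('d) * lookup h w)"
    by (rule sum.reindex_bij_witness[of _ "\<lambda>w. v - w" "\<lambda>w. v - w"]) auto
  also have "\<dots> = (\<Sum>w\<in>{w. v - w \<in> icube R} \<inter> keys h. 1 / (2 * of_nat R + 1) ^ CARD('d) * lookup h w)"
  proof (rule sum.mono_neutral_right)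
    show "finite {w. v - w \<in> icube R}"
      using finite_vimageI[of "icube R" "\<lambda>w. v - w"] by (simp add: vimage_def inj_def)
  qed (auto simp: in_keys_iff)
  also have "\<dots> = (\<Sum>w\<in>keys h. if v - w \<in> icube R then 1 / (2 * of_nat R + 1) ^ CARD('d) * lookup h w else 0)"
    by (subst Int_commute) (simp only: sum.inter_restrict finite_keys mem_Collect_eq)
  also have "\<dots> = (\<Sum>w\<in>keys h. of_real (cube_weight R (v - w)) * lookup h w)"
    by (intro sum.cong refl) (auto simp: cube_weight_def)
  finally show ?thesis .
qed

text \<open>The supremum over the radii is linearised by the choice \<open>\<rho>\<close>.\<close>

lemma cube_maximal:
  fixes h :: "int ^ 'd::finite \<Rightarrow>\<^sub>0 complex"
  assumes "finite V"
  shows "(\<Sum>v\<in>V. (cmod (lookup (cube (\<rho> v) * h) v))\<^sup>2) \<le> 4 * (2 ^ (CARD('d) + 1))\<^sup>2 * sqnorm h"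
proof -
  define B where "B = (4 * (2 ^ (CARD('d) + 1))\<^sup>2 :: real)"
  have B: "B \<ge> 0" by (simp add: B_def)
  \<comment> \<open>Any common bound for the radii on \<open>V\<close> will do, since the constant
    does not depend on it; off \<open>V\<close> the radii are set to 0 because
    \<open>maximal_bound\<close> asks for the bound everywhere.\<close>
  define L where "L = (\<Sum>v\<in>V. \<rho> v)"
  define \<rho>' where "\<rho>' = (\<lambda>v. if v \<in> V then \<rho> v else 0)"
  have \<rho>': "\<rho>' v \<le> L" for v
    using assms by (auto simp: \<rho>'_def L_def intro: member_le_sum)
  define f where "f = (\<lambda>v. \<Sum>w\<in>keys h. cube_weight (\<rho>' v) (v - w) * cmod (lookup h w))"
  have f0: "f v \<ge> 0" for v by (auto simp: f_def intro: sum_nonneg)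
  define X where "X = (\<Sum>v\<in>V. (f v)\<^sup>2)"
  have X0: "X \<ge> 0" by (simp add: X_def sum_nonneg)
  have "X = (\<Sum>v\<in>V. \<Sum>w\<in>keys h. f v * (cube_weight (\<rho>' v) (v - w) * cmod (lookup h w)))"
    unfolding X_def power2_eq_square by (subst (2) f_def) (simp add: sum_distrib_left)
  also have "\<dots> = (\<Sum>w\<in>keys h. cmod (lookup h w) * (\<Sum>v\<in>V. cube_weight (\<rho>' v) (v - w) * f v))"
    by (subst sum.swap) (simp add: sum_distrib_left mult_ac)
  \<comment> \<open>Duality: the square sum \<open>X\<close> of the maximal function is paired with
    \<open>h\<close> through the adjoint, whose norm is again controlled by \<open>X\<close>; one
    factor \<open>X\<close> then cancels.\<close>
  finally have "X\<^sup>2 \<le> (\<Sum>w\<in>keys h. (cmod (lookup h w))\<^sup>2) * (\<Sum>w\<in>keys h. (\<Sum>v\<in>V. cube_weight (\<rho>' v) (v - w) * f v)\<^sup>2)"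
    by (simp only: Cauchy_Schwarz_ineq_sum)
  also have "\<dots> \<le> sqnorm h * (B * X)"
    using maximal_bound_uniform[where 'd = 'd and L = L] assms \<rho>' f0
    unfolding maximal_bound_def sqnorm_def B_def X_def
    by (intro mult_left_mono) (auto intro: sum_nonneg)
  finally have "X * X \<le> (B * sqnorm h) * X" by (simp add: power2_eq_square mult_ac)
  then have "X \<le> B * sqnorm h"
  proof (cases "X = 0")
    case False
    then show ?thesis using X0 \<open>X * X \<le> (B * sqnorm h) * X\<close> by (simp add: mult_le_cancel_right)
  qed (use B in simp)
  moreover have "(\<Sum>v\<in>V. (cmod (lookup (cube (\<rho> v) * h) v))\<^sup>2) \<le> X"
    unfolding X_def
  proof (intro sum_mono power_mono)
    fix v assume "v \<in> V"
    have "cmod (lookup (cube (\<rho> v) * h) v) \<le> (\<Sum>w\<in>keys h. cmod (of_real (cube_weight (\<rho> v) (v - w)) * lookup h w))"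
      unfolding lookup_cube_mult by (rule norm_sum)
    also have "\<dots> = f v" using \<open>v \<in> V\<close> by (simp add: f_def \<rho>'_def norm_mult)
    finally show "cmod (lookup (cube (\<rho> v) * h) v) \<le> f v" .
  qed auto
  ultimately show ?thesis by (simp add: B_def)
qed

section \<open>Lacunary sums\<close>

lemma sum_geometric_growth_le:
  fixes z :: "nat \<Rightarrow> real"
  assumes "L > 1" and "\<And>i. z i \<ge> 0" and "\<And>i. i < n \<Longrightarrow> L * z i \<le> z (Suc i)"
  shows "(\<Sum>i\<le>n. z i) \<le> L / (L - 1) * z n"
  using assms(3)
proof (induction n)
  case 0
  have "z 0 * (L - 1) \<le> L * z 0" using assms(1) assms(2)[of 0] by (simp add: algebra_simps)
  then show ?case using assms(1) by (simp add: field_simps)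
next
  case (Suc n)
  have "(\<Sum>i\<le>n. z i) \<le> L / (L - 1) * z n" using Suc by simp
  also have "\<dots> = 1 / (L - 1) * (L * z n)" by simp
  also have "\<dots> \<le> 1 / (L - 1) * z (Suc n)"
    using Suc.prems[of n] assms(1) by (intro mult_left_mono) auto
  finally have "(\<Sum>i\<le>Suc n. z i) \<le> 1 / (L - 1) * z (Suc n) + z (Suc n)" by simp
  also have "\<dots> = L / (L - 1) * z (Suc n)" using assms(1) by (simp add: field_simps)
  finally show ?case .
qed

lemma sum_geometric_decay_le:
  fixes z :: "nat \<Rightarrow> real"
  assumes "L > 1" and "\<And>i. z i \<ge> 0" and "\<And>i. L * z (Suc i) \<le> z i"
  shows "(\<Sum>i<n. z i) \<le> L / (L - 1) * z 0"
proof -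
  have "(\<Sum>i<n. z i) \<le> L / (L - 1) * (z 0 - z n) + z 0 - z 0"
  proof (induction n)
    case 0 show ?case by simp
  next
    case (Suc n)
    have "z n * (L - 1) \<le> L * (z n - z (Suc n))"
      using assms(3)[of n] by (simp add: algebra_simps)
    then have "z n \<le> L / (L - 1) * (z n - z (Suc n))"
      using assms(1) by (simp add: field_simps)
    then show ?case using Suc by (simp add: algebra_simps diff_divide_distrib)
  qed
  also have "\<dots> \<le> L / (L - 1) * z 0"
    using assms(1) assms(2)[of n] by (simp add: divide_right_mono)
  finally show ?thesis .
qed

text \<open>Where z \<le> 1 the sum is dominated by its last term, where z > 1 by its first
  reciprocal, and both are at most 1. In the applications \<open>z i\<close> is a scale times a
  frequency, so each frequency matters at few scales.\<close>

lemma sum_min_inverse_le: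
  fixes z :: "nat \<Rightarrow> real"
  assumes "L > 1" and pos: "\<And>i. z i > 0" and grow: "\<And>i. L * z i \<le> z (Suc i)"
  shows "(\<Sum>i<n. min (z i) (1 / z i)) \<le> 2 * (L / (L - 1))"
proof -
  have G: "L / (L - 1) \<ge> 0" using assms(1) by simp
  have step: "z i \<le> z (Suc i)" for i
    using grow[of i] pos[of i] assms(1) mult_right_mono[of 1 L "z i"] by linarith
  then have mono: "i \<le> j \<Longrightarrow> z i \<le> z j" for i j by (rule lift_Suc_mono_le)
  define A where "A = {i. i < n \<and> z i \<le> 1}"
  define B where "B = {i. i < n \<and> z i > 1}"
  have fin: "finite A" "finite B" by (auto simp: A_def B_def)
  have "(\<Sum>i\<in>A. z i) \<le> L / (L - 1)"
  proof (cases "A = {}")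
    case False
    define j where "j = Max A"
    have j: "j \<in> A" using Max_in[OF fin(1) False] by (simp add: j_def)
    have "A \<subseteq> {..j}" using fin by (auto simp: j_def)
    then have "(\<Sum>i\<in>A. z i) \<le> (\<Sum>i\<le>j. z i)"
      using pos less_imp_le by (intro sum_mono2) auto
    also have "\<dots> \<le> L / (L - 1) * z j"
      using assms less_imp_le by (intro sum_geometric_growth_le) auto
    also have "\<dots> \<le> L / (L - 1) * 1"
      using j G by (intro mult_left_mono) (auto simp: A_def)
    finally show ?thesis by simp
  qed (use G in simp)
  moreover have "(\<Sum>i\<in>B. 1 / z i) \<le> L / (L - 1)"
  proof (cases "B = {}")
    case False
    define j where "j = Min B"
    have j: "j \<in> B" using Min_in[OF fin(2) False] by (simp add: j_def)
    have "B \<subseteq> (\<lambda>i. j + i) ` {..<n}"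
    proof
      fix i assume i: "i \<in> B"
      then have "j \<le> i" "i < n" using fin by (auto simp: j_def B_def)
      then have "i = j + (i - j)" "i - j < n" by auto
      then show "i \<in> (\<lambda>i. j + i) ` {..<n}" by blast
    qed
    then have "(\<Sum>i\<in>B. 1 / z i) \<le> (\<Sum>i\<in>(\<lambda>i. j + i) ` {..<n}. 1 / z i)"
      using pos less_imp_le by (intro sum_mono2) auto
    also have "\<dots> = (\<Sum>i<n. 1 / z (j + i))" by (subst sum.reindex) (auto simp: inj_on_def)
    also have "\<dots> \<le> L / (L - 1) * (1 / z (j + 0))"
    proof (rule sum_geometric_decay_le[OF assms(1)])
      fix i
      show "1 / z (j + i) \<ge> 0" using pos[of "j + i"] by simp
      show "L * (1 / z (j + Suc i)) \<le> 1 / z (j + i)"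
        using pos[of "j + i"] pos[of "j + Suc i"] grow[of "j + i"] by (simp add: field_simps)
    qed
    also have "\<dots> \<le> L / (L - 1) * 1"
      using j G by (intro mult_left_mono) (auto simp: B_def)
    finally show ?thesis by simp
  qed (use G in simp)
  moreover have "(\<Sum>i<n. min (z i) (1 / z i)) \<le> (\<Sum>i\<in>A. z i) + (\<Sum>i\<in>B. 1 / z i)"
  proof -
    have "{..<n} = A \<union> B" "A \<inter> B = {}" by (auto simp: A_def B_def)
    then have "(\<Sum>i<n. min (z i) (1 / z i)) = (\<Sum>i\<in>A. min (z i) (1 / z i)) + (\<Sum>i\<in>B. min (z i) (1 / z i))"
      using fin by (simp add: sum.union_disjoint)
    also have "\<dots> \<le> (\<Sum>i\<in>A. z i) + (\<Sum>i\<in>B. 1 / z i)"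
      by (intro add_mono sum_mono) auto
    finally show ?thesis .
  qed
  ultimately show ?thesis by simp
qed

section \<open>Oscillation of cube averages\<close>

text \<open>The slope 1/2 is cos (pi / 3), so sin x - x / 2 increases up to pi / 3; beyond that, x /
  2 \<le> pi / 4 < 0.8 < sin (pi / 3).\<close>

lemma sin_ge_half:
  assumes "0 \<le> x" "x \<le> pi / 2"
  shows "x / 2 \<le> sin x"
proof (cases "x \<le> pi / 3")
  case True
  have "sin 0 - 0 / 2 \<le> sin x - x / 2"
  proof (rule DERIV_nonneg_imp_nondecreasing[OF assms(1)])
    fix y assume y: "0 \<le> y" "y \<le> x"
    have "cos (pi / 3) \<le> cos y" using y True pi_gt_zero by (intro cos_monotone_0_pi_le) auto
    then have "cos y - 1 / 2 \<ge> 0" by (simp add: cos_60)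
    moreover have "((\<lambda>x. sin x - x / 2) has_real_derivative (cos y - 1 / 2)) (at y)"
      by (auto intro!: derivative_eq_intros)
    ultimately show "\<exists>d. ((\<lambda>x. sin x - x / 2) has_real_derivative d) (at y) \<and> 0 \<le> d" by blast
  qed
  then show ?thesis by simp
next
  case False
  have "x / 2 \<le> 0.8" using assms(2) pi_approx by simp
  also have "\<dots> \<le> sqrt 3 / 2"
    using real_le_rsqrt[of "1.6" 3] by (simp add: power2_eq_square)
  also have "\<dots> = sin (pi / 3)" by (simp add: sin_60)
  also have "\<dots> \<le> sin x" using assms False pi_gt_zero by (intro sin_monotone_2pi_le) auto
  finally show ?thesis .
qed

lemma norm_cis_minus_1: "cmod (cis x - 1) = 2 * \<bar>sin (x / 2)\<bar>"
  unfolding cis_conv_exp by (rule dist_exp_i_1)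

lemma norm_cis_minus_1_le: "cmod (cis x - 1) \<le> \<bar>x\<bar>"
  using abs_sin_x_le_abs_x[of "x / 2"] by (simp add: norm_cis_minus_1)

lemma norm_cis_minus_1_ge:
  assumes "\<bar>x\<bar> \<le> pi"
  shows "\<bar>x\<bar> / 2 \<le> cmod (cis x - 1)"
proof -
  have "\<bar>x\<bar> / 2 / 2 \<le> sin (\<bar>x\<bar> / 2)" using assms by (intro sin_ge_half) auto
  also have "\<dots> \<le> \<bar>sin (x / 2)\<bar>" by (cases "x \<ge> 0") auto
  finally show ?thesis by (simp add: norm_cis_minus_1)
qed

lemma sum_squares_3_le: "(a + b + c)\<^sup>2 \<le> 3 * (a\<^sup>2 + b\<^sup>2 + c\<^sup>2)" for a b c :: real
  using sum_squares_bound[of a b] sum_squares_bound[of a c] sum_squares_bound[of b c]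
  by (simp add: power2_eq_square algebra_simps)

lemma norm_chr_minus_1_le: "cmod (chr \<theta> v - 1) \<le> (\<Sum>m\<in>UNIV. \<bar>\<theta> $ m\<bar> * \<bar>real_of_int (v $ m)\<bar>)"
proof -
  have "cmod (chr \<theta> v - 1) \<le> \<bar>\<Sum>m\<in>UNIV. \<theta> $ m * real_of_int (v $ m)\<bar>"
    unfolding chr_def by (rule norm_cis_minus_1_le)
  also have "\<dots> \<le> (\<Sum>m\<in>UNIV. \<bar>\<theta> $ m * real_of_int (v $ m)\<bar>)" by (rule sum_abs)
  finally show ?thesis by (simp add: abs_mult)
qed

lemma chr_eq_prod: "chr \<theta> v = (\<Prod>m\<in>UNIV. cis (\<theta> $ m * real_of_int (v $ m)))"
proof -
  have "cis (\<Sum>m\<in>A. f m) = (\<Prod>m\<in>A. cis (f m))" for f :: "'a \<Rightarrow> real" and A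
    by (induction A rule: infinite_finite_induct) (auto simp flip: cis_mult)
  then show ?thesis by (simp add: chr_def)
qed

lemma fourier_cube:
  "fourier \<theta> (cube R :: int ^ 'd::finite \<Rightarrow>\<^sub>0 complex)
    = (\<Sum>v\<in>icube R. chr \<theta> v) / (2 * of_nat R + 1) ^ CARD('d)"
  by (simp add: cube_def fourier_sum sum_divide_distrib)

lemma norm_fourier_cube_le_1: "cmod (fourier \<theta> (cube R :: int ^ 'd::finite \<Rightarrow>\<^sub>0 complex)) \<le> 1"
proof -
  have "cmod (\<Sum>v\<in>icube R. chr \<theta> v) \<le> (\<Sum>v\<in>icube R. cmod (chr \<theta> (v :: int ^ 'd)))" by (rule norm_sum)
  also have "\<dots> = (2 * real R + 1) ^ CARD('d)" by (simp add: card_icube add.commute)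
  finally have "cmod (\<Sum>v\<in>icube R. chr \<theta> (v :: int ^ 'd)) \<le> (2 * real R + 1) ^ CARD('d)" .
  moreover have "cmod ((2 * of_nat R + 1) ^ CARD('d)) = (2 * real R + 1) ^ CARD('d)"
  proof -
    have "(2 * of_nat R + 1 :: complex) = of_real (2 * real R + 1)" by simp
    then show ?thesis by (simp only: norm_power norm_of_real abs_of_nonneg add_nonneg_nonneg mult_nonneg_nonneg of_nat_0_le_iff zero_le_numeral zero_le_one)
  qed
  ultimately show ?thesis by (simp add: fourier_cube norm_divide divide_le_eq_1 add_nonneg_pos)
qed

lemma norm_1_minus_fourier_cube_le:
  assumes "\<And>m. \<bar>\<theta> $ m\<bar> \<le> \<tau>"
  shows "cmod (1 - fourier \<theta> (cube R :: int ^ 'd::finite \<Rightarrow>\<^sub>0 complex)) \<le> real CARD('d) * (real R * \<tau>)"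
proof -
  define D where "D = (2 * real R + 1) ^ CARD('d)"
  have D: "D > 0" by (simp add: D_def add_nonneg_pos)
  have cD: "(2 * of_nat R + 1) ^ CARD('d) = complex_of_real D" by (simp add: D_def)
  have "(\<Sum>v\<in>icube R. 1 - chr \<theta> (v :: int ^ 'd)) = of_real D - (\<Sum>v\<in>icube R. chr \<theta> v)"
    by (simp add: sum_subtractf card_icube D_def add.commute)
  then have "1 - fourier \<theta> (cube R :: int ^ 'd \<Rightarrow>\<^sub>0 complex) = (\<Sum>v\<in>icube R. 1 - chr \<theta> (v :: int ^ 'd)) / of_real D"
    using D unfolding fourier_cube cD by (simp add: field_simps)
  then have "cmod (1 - fourier \<theta> (cube R :: int ^ 'd \<Rightarrow>\<^sub>0 complex)) = cmod (\<Sum>v\<in>icube R. 1 - chr \<theta> (v :: int ^ 'd)) / D"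
    using D by (simp add: norm_divide)
  also have "\<dots> \<le> (\<Sum>v\<in>icube R. cmod (1 - chr \<theta> (v :: int ^ 'd))) / D"
    using D by (intro divide_right_mono norm_sum) auto
  also have "\<dots> \<le> (\<Sum>v\<in>(icube R :: (int ^ 'd) set). real CARD('d) * (real R * \<tau>)) / D"
  proof (intro divide_right_mono sum_mono)
    fix v :: "int ^ 'd" assume v: "v \<in> icube R"
    have "cmod (1 - chr \<theta> v) \<le> (\<Sum>m\<in>UNIV. \<bar>\<theta> $ m\<bar> * \<bar>real_of_int (v $ m)\<bar>)"
      using norm_chr_minus_1_le[of \<theta> v] by (simp add: norm_minus_commute)
    also have "\<dots> \<le> (\<Sum>m\<in>(UNIV :: 'd set). \<tau> * real R)"
    proof (intro sum_mono mult_mono assms)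
      fix m
      have "\<bar>v $ m\<bar> \<le> int R" using v by (auto simp: icube_def)
      then show "\<bar>real_of_int (v $ m)\<bar> \<le> real R" by linarith
      show "0 \<le> \<tau>" using assms[of m] by linarith
    qed auto
    finally show "cmod (1 - chr \<theta> v) \<le> real CARD('d) * (real R * \<tau>)" by (simp add: mult_ac)
  qed (use D in auto)
  also have "\<dots> = real CARD('d) * (real R * \<tau>)"
    using D by (simp add: card_icube D_def add.commute)
  finally show ?thesis .
qed

text \<open>The multiplier is a product of one-dimensional Dirichlet kernels, each of modulus at
  most 1 after normalisation. The factor of the single coordinate \<open>m\<close> already gives the
  decay, its geometric sum being O(1 / |\<theta>_m|).\<close>

lemma norm_fourier_cube_decay:
  assumes "\<bar>\<theta> $ m\<bar> \<le> pi"
  shows "cmod (fourier \<theta> (cube R :: int ^ 'd::finite \<Rightarrow>\<^sub>0 complex)) * (real R * \<bar>\<theta> $ m\<bar>) \<le> 2"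
proof -
  define t where "t = \<theta> $ m"
  define N where "N = 2 * real R + 1"
  have N: "N > 0" by (simp add: N_def)
  define S where "S = (\<lambda>m. \<Sum>b\<in>{- int R..int R}. cis (\<theta> $ m * real_of_int b))"
  have S: "cmod (S m') \<le> N" for m'
  proof -
    have "cmod (S m') \<le> (\<Sum>b\<in>{- int R..int R}. cmod (cis (\<theta> $ m' * real_of_int b)))"
      unfolding S_def by (rule norm_sum)
    then show ?thesis by (simp add: N_def)
  qed
  have "(cis t - 1) * S m = cis (t * (real R + 1)) - cis (- (t * real R))"
  proof -
    have "S m = (\<Sum>i<2 * R + 1. cis (t * (real i - real R)))"
      unfolding S_def t_def
      by (rule sum.reindex_bij_witness[where i = "\<lambda>i. int i - int R" and j = "\<lambda>b. nat (b + int R)"]) auto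
    then have "(cis t - 1) * S m = (\<Sum>i<2 * R + 1. cis (t * (real (Suc i) - real R)) - cis (t * (real i - real R)))"
      by (simp only: sum_distrib_left left_diff_distrib cis_mult) (simp add: algebra_simps)
    also have "\<dots> = cis (t * (real (2 * R + 1) - real R)) - cis (t * (real 0 - real R))"
      by (rule sum_lessThan_telescope)
    finally show ?thesis by (simp add: algebra_simps)
  qed
  then have "cmod (cis t - 1) * cmod (S m) = cmod (cis (t * (real R + 1)) - cis (- (t * real R)))"
    by (simp only: norm_mult[symmetric])
  also have "\<dots> \<le> cmod (cis (t * (real R + 1))) + cmod (cis (- (t * real R)))" by (rule norm_triangle_ineq4)
  finally have 1: "cmod (cis t - 1) * cmod (S m) \<le> 2" by simp
  have "\<bar>t\<bar> / 2 * cmod (S m) \<le> cmod (cis t - 1) * cmod (S m)"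
    using assms by (intro mult_right_mono norm_cis_minus_1_ge) (auto simp: t_def)
  then have 2: "\<bar>t\<bar> * cmod (S m) \<le> 4" using 1 by linarith
  have "(\<Sum>v\<in>icube R. chr \<theta> (v :: int ^ 'd)) = (\<Prod>m\<in>UNIV. S m)"
    unfolding chr_eq_prod S_def by (rule sum_icube_prod)
  then have "fourier \<theta> (cube R :: int ^ 'd \<Rightarrow>\<^sub>0 complex) = (\<Prod>m\<in>UNIV. S m) / of_real (N ^ CARD('d))"
    by (simp add: fourier_cube N_def)
  then have "cmod (fourier \<theta> (cube R :: int ^ 'd \<Rightarrow>\<^sub>0 complex)) = (\<Prod>m\<in>UNIV. cmod (S m) / N)"
    using N by (simp add: norm_divide norm_power prod_norm prod_dividef)
  also have "\<dots> = cmod (S m) / N * (\<Prod>m\<in>UNIV - {m}. cmod (S m) / N)"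
    by (rule prod.remove) auto
  also have "\<dots> \<le> cmod (S m) / N * 1"
    using S N by (intro mult_left_mono prod_le_1) auto
  finally have "cmod (fourier \<theta> (cube R :: int ^ 'd \<Rightarrow>\<^sub>0 complex)) * (real R * \<bar>t\<bar>) \<le> cmod (S m) / N * (real R * \<bar>t\<bar>)"
    by (intro mult_right_mono) auto
  also have "\<dots> = (\<bar>t\<bar> * cmod (S m)) * (real R / N)" by simp
  also have "\<dots> \<le> 4 * (1 / 2)"
    using 2 N by (intro mult_mono) (auto simp: N_def field_simps)
  finally show ?thesis by (simp add: t_def)
qed

lemma max_coordinate:
  fixes \<theta> :: "real ^ 'd::finite"
  shows "\<exists>m. \<forall>m'. \<bar>\<theta> $ m'\<bar> \<le> \<bar>\<theta> $ m\<bar>"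
proof -
  have "Max (range (\<lambda>m. \<bar>\<theta> $ m\<bar>)) \<in> range (\<lambda>m. \<bar>\<theta> $ m\<bar>)" by (rule Max_in) auto
  then obtain m where "Max (range (\<lambda>m. \<bar>\<theta> $ m\<bar>)) = \<bar>\<theta> $ m\<bar>" by (rule rangeE)
  then have "\<bar>\<theta> $ m'\<bar> \<le> \<bar>\<theta> $ m\<bar>" for m' by (metis Max_ge finite_imageI finite_class.finite_UNIV rangeI)
  then show ?thesis by blast
qed

lemma fourier_cube_zero_frequency:
  assumes "\<And>m. \<theta> $ m = 0"
  shows "fourier \<theta> (cube R :: int ^ 'd::finite \<Rightarrow>\<^sub>0 complex) = 1"
  using norm_1_minus_fourier_cube_le[of \<theta> 0 R] assms by simp

text \<open>Put x_j = R_j |\<theta>_m| with \<open>m\<close> the largest coordinate. As |1 - r_a|^2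
  is at most 2 d x_a, the inner sum is geometric and O(x_j); the decay of \<open>r j\<close> turns
  it into O(min (x_j) (1 / x_j)), which sums over \<open>j\<close>. The order a \<le> j is
  essential: a large index must come with decay and a small one with nearness to 1.\<close>

lemma sum_cube_pairs_multiplier_le:
  fixes R :: "nat \<Rightarrow> nat"
  assumes L: "L > 1" and R: "\<And>j. R j \<ge> 1" "\<And>j. L * real (R j) \<le> real (R (Suc j))"
    and \<theta>: "\<And>m. \<bar>\<theta> $ m\<bar> \<le> pi"
  defines "r \<equiv> \<lambda>j. fourier \<theta> (cube (R j) :: int ^ 'd::finite \<Rightarrow>\<^sub>0 complex)"
  shows "(\<Sum>j\<le>M. \<Sum>a\<le>j. (cmod (r j * (1 - r a)))\<^sup>2) \<le> 16 * real CARD('d) * (L / (L - 1))\<^sup>2"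
proof -
  define G where "G = L / (L - 1)"
  have G: "G \<ge> 0" using L by (simp add: G_def)
  obtain m where m: "\<And>m'. \<bar>\<theta> $ m'\<bar> \<le> \<bar>\<theta> $ m\<bar>" using max_coordinate[of \<theta>] by blast
  show ?thesis
  proof (cases "\<theta> $ m = 0")
    case True
    then have "\<theta> $ m' = 0" for m' using m[of m'] by simp
    then show ?thesis using L by (simp add: r_def fourier_cube_zero_frequency)
  next
    case False
    define x where "x = (\<lambda>j. real (R j) * \<bar>\<theta> $ m\<bar>)"
    have R0: "R j > 0" for j using R(1)[of j] by simp
    have x0: "x j > 0" for j using R0[of j] False by (simp add: x_def)
    have xL: "L * x j \<le> x (Suc j)" for j
      using mult_right_mono[OF R(2)[of j], of "\<bar>\<theta> $ m\<bar>"] by (simp add: x_def mult_ac)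
    have r1: "cmod (r j) \<le> 1" for j by (simp add: r_def norm_fourier_cube_le_1)
    have r2: "cmod (r j) * x j \<le> 2" for j unfolding r_def x_def by (rule norm_fourier_cube_decay[OF \<theta>])
    have r3: "cmod (1 - r j) \<le> real CARD('d) * x j" for j
      unfolding r_def x_def by (rule norm_1_minus_fourier_cube_le[OF m])
    have one: "(\<Sum>a\<le>j. (cmod (r j * (1 - r a)))\<^sup>2) \<le> 8 * real CARD('d) * G * min (x j) (1 / x j)" for j
    proof -
      have "(cmod (1 - r a))\<^sup>2 \<le> 2 * (real CARD('d) * x a)" for a
      proof -
        have "cmod (1 - r a) \<le> 2" using r1[of a] norm_triangle_ineq4[of 1 "r a"] by simp
        then show ?thesis unfolding power2_eq_square using r3[of a] by (intro mult_mono) auto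
      qed
      then have "(\<Sum>a\<le>j. (cmod (1 - r a))\<^sup>2) \<le> (\<Sum>a\<le>j. 2 * (real CARD('d) * x a))" by (intro sum_mono)
      also have "\<dots> = 2 * real CARD('d) * (\<Sum>a\<le>j. x a)" by (simp add: sum_distrib_left mult_ac)
      also have "\<dots> \<le> 2 * real CARD('d) * (G * x j)"
        unfolding G_def using x0 less_imp_le xL L by (intro mult_left_mono sum_geometric_growth_le) auto
      finally have S: "(\<Sum>a\<le>j. (cmod (1 - r a))\<^sup>2) \<le> 2 * real CARD('d) * G * x j" by (simp add: mult_ac)
      have rr: "(cmod (r j))\<^sup>2 * x j \<le> 4 * min (x j) (1 / x j)"
      proof (cases "x j \<le> 1 / x j")
        case True
        have "(cmod (r j))\<^sup>2 * x j \<le> 1 * x j"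
          using r1[of j] x0[of j] by (intro mult_right_mono) (auto simp: power_le_one)
        then show ?thesis using True x0[of j] by (simp add: min_def)
      next
        case False
        have "(cmod (r j) * x j)\<^sup>2 \<le> 2\<^sup>2" using r2[of j] x0[of j] by (intro power_mono) auto
        then have "(cmod (r j))\<^sup>2 * x j \<le> 4 / x j"
          using x0[of j] by (simp add: power_mult_distrib power2_eq_square field_simps)
        then show ?thesis using False by (simp add: min_def)
      qed
      have "(\<Sum>a\<le>j. (cmod (r j * (1 - r a)))\<^sup>2) = (cmod (r j))\<^sup>2 * (\<Sum>a\<le>j. (cmod (1 - r a))\<^sup>2)"
        by (simp add: norm_mult power_mult_distrib sum_distrib_left)
      also have "\<dots> \<le> (cmod (r j))\<^sup>2 * (2 * real CARD('d) * G * x j)" by (intro mult_left_mono S) auto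
      also have "\<dots> = 2 * real CARD('d) * G * ((cmod (r j))\<^sup>2 * x j)" by simp
      also have "\<dots> \<le> 2 * real CARD('d) * G * (4 * min (x j) (1 / x j))"
        using G by (intro mult_left_mono rr) auto
      finally show ?thesis by simp
    qed
    have "(\<Sum>j\<le>M. \<Sum>a\<le>j. (cmod (r j * (1 - r a)))\<^sup>2) \<le> (\<Sum>j\<le>M. 8 * real CARD('d) * G * min (x j) (1 / x j))"
      by (intro sum_mono one)
    also have "\<dots> = 8 * real CARD('d) * G * (\<Sum>j<Suc M. min (x j) (1 / x j))"
      by (simp add: sum_distrib_left lessThan_Suc_atMost)
    also have "\<dots> \<le> 8 * real CARD('d) * G * (2 * G)"
      unfolding G_def using L x0 xL by (intro mult_left_mono sum_min_inverse_le) auto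
    finally show ?thesis by (simp add: G_def power2_eq_square mult_ac)
  qed
qed

text \<open>The times may repeat, so one index can bound arbitrarily many empty blocks. Among the
  nonempty blocks all left ends are distinct, and so are all right ends, so each weight is counted
  at most once.\<close>

lemma sum_sub_block_starts_le:
  fixes k :: "nat \<Rightarrow> nat" and w :: "nat \<Rightarrow> real"
  assumes k: "mono k" and w: "\<And>j. w j \<ge> 0"
  shows "(\<Sum>i | i < n \<and> k i < k (Suc i). w (k i)) \<le> (\<Sum>j\<le>k n. w j)"
    and "(\<Sum>i | i < n \<and> k i < k (Suc i). w (k (Suc i))) \<le> (\<Sum>j\<le>k n. w j)"
proof -
  define F where "F = {i. i < n \<and> k i < k (Suc i)}"
  have lt: "k i < k (Suc i)" "k (Suc i) \<le> k i'" "k i' < k (Suc i')" if "i \<in> F" "i' \<in> F" "i < i'" for i i'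
    using that monoD[OF k, of "Suc i" i'] by (auto simp: F_def)
  have inj: "inj_on k F" "inj_on (\<lambda>i. k (Suc i)) F"
    by (rule linorder_inj_onI; use lt in fastforce)+
  have fin: "finite F" by (simp add: F_def)
  have "(\<Sum>i\<in>F. w (k i)) = (\<Sum>j\<in>k ` F. w j)" using inj by (simp add: sum.reindex)
  also have "\<dots> \<le> (\<Sum>j\<le>k n. w j)" using fin w by (intro sum_mono2) (auto simp: F_def intro: monoD[OF k])
  finally show "(\<Sum>i | i < n \<and> k i < k (Suc i). w (k i)) \<le> (\<Sum>j\<le>k n. w j)" by (simp add: F_def)
  have "(\<Sum>i\<in>F. w (k (Suc i))) = (\<Sum>j\<in>(\<lambda>i. k (Suc i)) ` F. w j)" using inj by (simp add: sum.reindex)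
  also have "\<dots> \<le> (\<Sum>j\<le>k n. w j)" using fin w by (intro sum_mono2) (auto simp: F_def intro: monoD[OF k])
  finally show "(\<Sum>i | i < n \<and> k i < k (Suc i). w (k (Suc i))) \<le> (\<Sum>j\<le>k n. w j)" by (simp add: F_def)
qed

text \<open>The multiplier is compared with the step function \<open>u\<close>, which is 1 below the
  critical scale x_j = 1 and 0 above it. The errors are summable over all \<open>j\<close>, and the
  monotone \<open>u\<close> has total variation at most 1, however the blocks are chosen.\<close>

lemma sum_cube_blocks_multiplier_le:
  fixes R k :: "nat \<Rightarrow> nat"
  assumes L: "L > 1" and R: "\<And>j. R j \<ge> 1" "\<And>j. L * real (R j) \<le> real (R (Suc j))"
    and \<theta>: "\<And>m. \<bar>\<theta> $ m\<bar> \<le> pi" and k: "mono k"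
  defines "r \<equiv> \<lambda>j. fourier \<theta> (cube (R j) :: int ^ 'd::finite \<Rightarrow>\<^sub>0 complex)"
  shows "(\<Sum>i | i < n \<and> k i < k (Suc i). (cmod (r (k i) - r (k (Suc i))))\<^sup>2)
    \<le> 48 * (real CARD('d))\<^sup>2 * (L / (L - 1)) + 3"
proof -
  define G where "G = L / (L - 1)"
  have G: "G \<ge> 0" using L by (simp add: G_def)
  define d where "d = real CARD('d)"
  have d: "d \<ge> 1" by (simp add: d_def Suc_leI)
  obtain m where m: "\<And>m'. \<bar>\<theta> $ m'\<bar> \<le> \<bar>\<theta> $ m\<bar>" using max_coordinate[of \<theta>] by blast
  show ?thesis
  proof (cases "\<theta> $ m = 0")
    case True
    then have "\<theta> $ m' = 0" for m' using m[of m'] by simp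
    then show ?thesis using L by (simp add: r_def fourier_cube_zero_frequency)
  next
    case False
    define x where "x = (\<lambda>j. real (R j) * \<bar>\<theta> $ m\<bar>)"
    have R0: "R j > 0" for j using R(1)[of j] by simp
    have x0: "x j > 0" for j using R0[of j] False by (simp add: x_def)
    have xL: "L * x j \<le> x (Suc j)" for j
      using mult_right_mono[OF R(2)[of j], of "\<bar>\<theta> $ m\<bar>"] by (simp add: x_def mult_ac)
    have "x j \<le> x (Suc j)" for j
      using xL[of j] x0[of j] L mult_right_mono[of 1 L "x j"] by linarith
    then have xmono: "i \<le> j \<Longrightarrow> x i \<le> x j" for i j by (rule lift_Suc_mono_le)
    define w where "w = (\<lambda>j. min (x j) (1 / x j))"
    have w: "0 \<le> w j" "w j \<le> 1" for j
      using x0[of j] by (cases "x j \<le> 1"; simp add: w_def min_le_iff_disj)+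
    define u where "u = (\<lambda>j. if x j < 1 then 1 else 0 :: real)"
    have ru: "cmod (r j - of_real (u j)) \<le> 2 * d * w j" for j
    proof (cases "x j < 1")
      case True
      have "x j * x j \<le> 1" using True x0[of j] by (simp add: mult_le_one)
      then have "w j = x j" using x0[of j] by (simp add: w_def min_def field_simps)
      moreover have "cmod (1 - r j) \<le> d * x j"
        unfolding r_def x_def d_def by (rule norm_1_minus_fourier_cube_le[OF m])
      moreover have "d * x j \<ge> 0" using d x0[of j] by simp
      ultimately have "cmod (1 - r j) \<le> 2 * d * w j" by simp
      then show ?thesis using True by (simp add: u_def norm_minus_commute)
    next
      case False
      then have "x j * x j \<ge> 1" using mult_mono[of 1 "x j" 1 "x j"] by simp
      then have wj: "w j = 1 / x j" using x0[of j] by (simp add: w_def min_def field_simps)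
      have "cmod (r j) * x j \<le> 2" unfolding r_def x_def by (rule norm_fourier_cube_decay[OF \<theta>])
      then have "cmod (r j) \<le> 2 * w j" using x0[of j] by (simp add: wj field_simps)
      also have "\<dots> \<le> 2 * d * w j" using d w(1)[of j] mult_right_mono[of 1 d "w j"] by simp
      finally show ?thesis using False by (simp add: u_def)
    qed
    have ru2: "(cmod (r j - of_real (u j)))\<^sup>2 \<le> 4 * d\<^sup>2 * w j" for j
    proof -
      have "(cmod (r j - of_real (u j)))\<^sup>2 \<le> (2 * d * w j)\<^sup>2" using ru[of j] by (intro power_mono) auto
      also have "\<dots> = 4 * d\<^sup>2 * (w j * w j)" by (simp add: power2_eq_square)
      also have "\<dots> \<le> 4 * d\<^sup>2 * (w j * 1)" using w[of j] by (intro mult_left_mono) auto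
      finally show ?thesis by simp
    qed
    have umono: "u (k (Suc i)) \<le> u (k i)" for i
      using xmono[of "k i" "k (Suc i)"] monoD[OF k, of i "Suc i"] by (auto simp: u_def)
    have one: "(cmod (r (k i) - r (k (Suc i))))\<^sup>2
        \<le> 12 * d\<^sup>2 * w (k i) + 12 * d\<^sup>2 * w (k (Suc i)) + 3 * (u (k i) - u (k (Suc i)))" for i
    proof -
      have "cmod (r (k i) - r (k (Suc i))) \<le> cmod (r (k i) - of_real (u (k i)))
          + cmod (r (k (Suc i)) - of_real (u (k (Suc i)))) + \<bar>u (k i) - u (k (Suc i))\<bar>"
      proof -
        have "r (k i) - r (k (Suc i)) = (r (k i) - of_real (u (k i))) - (r (k (Suc i)) - of_real (u (k (Suc i))))
            + of_real (u (k i) - u (k (Suc i)))" by simp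
        then show ?thesis
          by (metis (no_types) norm_triangle_ineq norm_triangle_ineq4 norm_of_real add_right_mono order_trans)
      qed
      then have "(cmod (r (k i) - r (k (Suc i))))\<^sup>2 \<le> (cmod (r (k i) - of_real (u (k i)))
          + cmod (r (k (Suc i)) - of_real (u (k (Suc i)))) + \<bar>u (k i) - u (k (Suc i))\<bar>)\<^sup>2"
        by (intro power_mono) auto
      also have "\<dots> \<le> 3 * ((cmod (r (k i) - of_real (u (k i))))\<^sup>2
          + (cmod (r (k (Suc i)) - of_real (u (k (Suc i)))))\<^sup>2 + \<bar>u (k i) - u (k (Suc i))\<bar>\<^sup>2)"
        by (rule sum_squares_3_le)
      \<comment> \<open>As \<open>u\<close> decreases and takes only the values 0 and 1, each jump
        equals its own square; the sum of squares thus telescopes.\<close>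
      also have "\<bar>u (k i) - u (k (Suc i))\<bar>\<^sup>2 = u (k i) - u (k (Suc i))"
        using umono[of i] by (auto simp: u_def split: if_splits)
      finally show ?thesis using ru2[of "k i"] ru2[of "k (Suc i)"] by (simp add: algebra_simps)
    qed
    have W: "(\<Sum>j\<le>k n. w j) \<le> 2 * G"
      using sum_min_inverse_le[where z = x and n = "Suc (k n)", OF L x0 xL] by (simp add: w_def G_def lessThan_Suc_atMost)
    define F where "F = {i. i < n \<and> k i < k (Suc i)}"
    have "(\<Sum>i\<in>F. (cmod (r (k i) - r (k (Suc i))))\<^sup>2)
        \<le> (\<Sum>i\<in>F. 12 * d\<^sup>2 * w (k i) + 12 * d\<^sup>2 * w (k (Suc i)) + 3 * (u (k i) - u (k (Suc i))))"
      by (intro sum_mono one)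
    also have "\<dots> = 12 * d\<^sup>2 * (\<Sum>i\<in>F. w (k i)) + 12 * d\<^sup>2 * (\<Sum>i\<in>F. w (k (Suc i)))
        + 3 * (\<Sum>i\<in>F. u (k i) - u (k (Suc i)))"
      by (simp add: sum.distrib sum_distrib_left)
    also have "\<dots> \<le> 12 * d\<^sup>2 * (2 * G) + 12 * d\<^sup>2 * (2 * G) + 3 * 1"
    proof (intro add_mono mult_left_mono)
      show "(\<Sum>i\<in>F. w (k i)) \<le> 2 * G" "(\<Sum>i\<in>F. w (k (Suc i))) \<le> 2 * G"
        using sum_sub_block_starts_le[where w = w and n = n, OF k w(1)] W unfolding F_def by linarith+
      have "(\<Sum>i\<in>F. u (k i) - u (k (Suc i))) \<le> (\<Sum>i<n. u (k i) - u (k (Suc i)))"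
        using umono by (intro sum_mono2) (auto simp: F_def)
      also have "\<dots> = u (k 0) - u (k n)" by (rule sum_lessThan_telescope')
      also have "\<dots> \<le> 1" by (simp add: u_def)
      finally show "(\<Sum>i\<in>F. u (k i) - u (k (Suc i))) \<le> 1" .
    qed auto
    finally show ?thesis by (simp add: F_def G_def d_def mult_ac)
  qed
qed

lemma norm_sum_3_squared_le:
  assumes "x = a + b + c"
  shows "(norm x)\<^sup>2 \<le> 3 * ((norm a)\<^sup>2 + (norm b)\<^sup>2 + (norm c)\<^sup>2)"
proof -
  have "norm x \<le> norm a + norm b + norm c"
    unfolding assms by (intro norm_triangle_le add_mono norm_triangle_ineq order_refl)
  then have "(norm x)\<^sup>2 \<le> (norm a + norm b + norm c)\<^sup>2" by (intro power_mono) auto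
  also have "\<dots> \<le> 3 * ((norm a)\<^sup>2 + (norm b)\<^sup>2 + (norm c)\<^sup>2)" by (rule sum_squares_3_le)
  finally show ?thesis .
qed

text \<open>The outer 3 comes from squaring a sum of three terms. Inside stand the maximal constant
  times the block constant of \<open>sum_cube_blocks_multiplier_le\<close>, and twice the pair
  constant of \<open>sum_cube_pairs_multiplier_le\<close>.\<close>

definition cube_osc_const :: "nat \<Rightarrow> real \<Rightarrow> real" where
  "cube_osc_const d L = 3 * (4 * (2 ^ (d + 1))\<^sup>2 * (48 * (real d)\<^sup>2 * (L / (L - 1)) + 3)
    + 16 * real d * (L / (L - 1))\<^sup>2 + 16 * real d * (L / (L - 1))\<^sup>2)"

text \<open>\<open>J\<close> linearises the supremum: an arbitrary index in every block at every
  point. The maximal inequality handles the dependence on \<open>J\<close> only for the term with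
  \<open>h i\<close>. In the two terms with \<open>E\<close> it is enough to sum over all candidate
  indices, because these pairs are square summable.\<close>

lemma cube_oscillation:
  fixes R k :: "nat \<Rightarrow> nat" and f :: "int ^ 'd::finite \<Rightarrow>\<^sub>0 complex"
  assumes L: "L > 1" and R: "\<And>j. R j \<ge> 1" "\<And>j. L * real (R j) \<le> real (R (Suc j))"
    and k: "mono k" and V: "finite V"
    and J: "\<And>i v. k i \<le> J i v" "\<And>i v. J i v \<le> k (Suc i)"
  shows "(\<Sum>i | i < n \<and> k i < k (Suc i). \<Sum>v\<in>V.
      (cmod (lookup ((cube (R (J i v)) - cube (R (k (Suc i)))) * f) v))\<^sup>2)
    \<le> cube_osc_const CARD('d) L * sqnorm f"
proof -
  define F where "F = {i. i < n \<and> k i < k (Suc i)}"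
  have finF: "finite F" by (simp add: F_def)
  define c where "c = (\<lambda>j. cube (R j) :: int ^ 'd \<Rightarrow>\<^sub>0 complex)"
  define E where "E = (\<lambda>a j. c j * (1 - c a))"
  define h where "h = (\<lambda>i. (c (k i) - c (k (Suc i))) * f)"
  define P where "P = (SIGMA j:{..k n}. {..j})"
  have fourier_E: "fourier \<theta> (E a j) = fourier \<theta> (c j) * (1 - fourier \<theta> (c a))" for \<theta> a j
    by (simp add: E_def fourier_mult fourier_diff)
  have pairs: "(\<Sum>j\<le>k n. \<Sum>a\<le>j. sqnorm (E a j * f)) \<le> 16 * real CARD('d) * (L / (L - 1))\<^sup>2 * sqnorm f"
  proof -
    have "(\<Sum>(j, a)\<in>P. sqnorm (E a j * f)) \<le> 16 * real CARD('d) * (L / (L - 1))\<^sup>2 * sqnorm f"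
      unfolding case_prod_beta
    proof (rule multiplier_bound)
      fix \<theta> :: "real ^ 'd" assume \<theta>: "\<And>m. \<bar>\<theta> $ m\<bar> \<le> pi"
      show "(\<Sum>x\<in>P. (cmod (fourier \<theta> (E (snd x) (fst x))))\<^sup>2) \<le> 16 * real CARD('d) * (L / (L - 1))\<^sup>2"
        using sum_cube_pairs_multiplier_le[where R = R and \<theta> = \<theta> and M = "k n", OF L R \<theta>]
        by (simp add: P_def sum.Sigma case_prod_beta fourier_E c_def)
    qed (simp add: P_def)
    then show ?thesis by (simp add: P_def sum.Sigma)
  qed
  have split: "(cmod (lookup ((c (J i v) - c (k (Suc i))) * f) v))\<^sup>2 \<le> 3 * ((cmod (lookup (c (J i v) * h i) v))\<^sup>2
      + (cmod (lookup (E (k i) (J i v) * f) v))\<^sup>2 + (cmod (lookup (E (J i v) (k (Suc i)) * f) v))\<^sup>2)" for i v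
  proof -
    have "(c (J i v) - c (k (Suc i))) * f = c (J i v) * h i + E (k i) (J i v) * f - E (J i v) (k (Suc i)) * f"
      by (simp add: h_def E_def algebra_simps)
    then have "lookup ((c (J i v) - c (k (Suc i))) * f) v = lookup (c (J i v) * h i) v
        + lookup (E (k i) (J i v) * f) v + - lookup (E (J i v) (k (Suc i)) * f) v"
      by (simp add: lookup_add lookup_minus)
    from norm_sum_3_squared_le[OF this] show ?thesis by simp
  qed
  have 1: "(\<Sum>i\<in>F. \<Sum>v\<in>V. (cmod (lookup (c (J i v) * h i) v))\<^sup>2)
      \<le> 4 * (2 ^ (CARD('d) + 1))\<^sup>2 * (48 * (real CARD('d))\<^sup>2 * (L / (L - 1)) + 3) * sqnorm f"
  proof -
    have "(\<Sum>i\<in>F. \<Sum>v\<in>V. (cmod (lookup (c (J i v) * h i) v))\<^sup>2) \<le> (\<Sum>i\<in>F. 4 * (2 ^ (CARD('d) + 1))\<^sup>2 * sqnorm (h i))"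
      unfolding c_def by (intro sum_mono cube_maximal V)
    also have "\<dots> = 4 * (2 ^ (CARD('d) + 1))\<^sup>2 * (\<Sum>i\<in>F. sqnorm (h i))" by (simp add: sum_distrib_left)
    also have "\<dots> \<le> 4 * (2 ^ (CARD('d) + 1))\<^sup>2 * ((48 * (real CARD('d))\<^sup>2 * (L / (L - 1)) + 3) * sqnorm f)"
      unfolding h_def
    proof (intro mult_left_mono multiplier_bound finF)
      fix \<theta> :: "real ^ 'd" assume \<theta>: "\<And>m. \<bar>\<theta> $ m\<bar> \<le> pi"
      show "(\<Sum>i\<in>F. (cmod (fourier \<theta> (c (k i) - c (k (Suc i)))))\<^sup>2) \<le> 48 * (real CARD('d))\<^sup>2 * (L / (L - 1)) + 3"
        using sum_cube_blocks_multiplier_le[where R = R and \<theta> = \<theta> and n = n, OF L R \<theta> k] by (simp add: F_def c_def fourier_diff)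
    qed auto
    finally show ?thesis by (simp add: mult.assoc)
  qed
  \<comment> \<open>A value at a chosen index is dominated by the square sum over all indices that
    could be chosen.\<close>
  have one_le: "(\<Sum>v\<in>V. (cmod (lookup (g (J' v)) v))\<^sup>2) \<le> (\<Sum>j\<in>B. sqnorm (g j))"
    if "\<And>v. J' v \<in> B" "finite B" for g :: "nat \<Rightarrow> int ^ 'd \<Rightarrow>\<^sub>0 complex" and J' B
  proof -
    have "(\<Sum>v\<in>V. (cmod (lookup (g (J' v)) v))\<^sup>2) \<le> (\<Sum>v\<in>V. \<Sum>j\<in>B. (cmod (lookup (g j) v))\<^sup>2)"
      using that by (intro sum_mono member_le_sum[where f = "\<lambda>j. (cmod (lookup (g j) v))\<^sup>2" for v]) auto
    also have "\<dots> = (\<Sum>j\<in>B. \<Sum>v\<in>V. (cmod (lookup (g j) v))\<^sup>2)" by (rule sum.swap)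
    also have "\<dots> \<le> (\<Sum>j\<in>B. sqnorm (g j))" by (intro sum_mono sum_le_sqnorm V)
    finally show ?thesis .
  qed
  have 2: "(\<Sum>i\<in>F. \<Sum>v\<in>V. (cmod (lookup (E (k i) (J i v) * f) v))\<^sup>2) \<le> 16 * real CARD('d) * (L / (L - 1))\<^sup>2 * sqnorm f"
  proof -
    have "(\<Sum>i\<in>F. \<Sum>v\<in>V. (cmod (lookup (E (k i) (J i v) * f) v))\<^sup>2) \<le> (\<Sum>i\<in>F. \<Sum>j\<in>{k i..k n}. sqnorm (E (k i) j * f))"
    proof (intro sum_mono one_le)
      fix i v assume "i \<in> F"
      then show "J i v \<in> {k i..k n}"
        using J[where i = i and v = v] monoD[OF k, of "Suc i" n] by (auto simp: F_def)
    qed auto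
    also have "\<dots> \<le> (\<Sum>a\<le>k n. \<Sum>j\<in>{a..k n}. sqnorm (E a j * f))"
      unfolding F_def by (rule sum_sub_block_starts_le(1)[OF k]) (auto intro: sum_nonneg)
    also have "\<dots> = (\<Sum>j\<le>k n. \<Sum>a\<le>j. sqnorm (E a j * f))"
    proof -
      have "(SIGMA a:{..k n}. {a..k n}) = prod.swap ` P" by (force simp: P_def)
      moreover have "inj_on prod.swap P" by (auto simp: inj_on_def)
      ultimately have "(\<Sum>(a, j)\<in>(SIGMA a:{..k n}. {a..k n}). sqnorm (E a j * f)) = (\<Sum>(j, a)\<in>P. sqnorm (E a j * f))"
        by (simp add: sum.reindex case_prod_beta)
      then show ?thesis by (simp add: P_def sum.Sigma)
    qed
    finally show ?thesis using pairs by linarith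
  qed
  have 3: "(\<Sum>i\<in>F. \<Sum>v\<in>V. (cmod (lookup (E (J i v) (k (Suc i)) * f) v))\<^sup>2) \<le> 16 * real CARD('d) * (L / (L - 1))\<^sup>2 * sqnorm f"
  proof -
    have "(\<Sum>i\<in>F. \<Sum>v\<in>V. (cmod (lookup (E (J i v) (k (Suc i)) * f) v))\<^sup>2) \<le> (\<Sum>i\<in>F. \<Sum>a\<in>{..k (Suc i)}. sqnorm (E a (k (Suc i)) * f))"
      using J by (intro sum_mono one_le[where g = "\<lambda>a. E a (k (Suc i)) * f" for i]) auto
    also have "\<dots> \<le> (\<Sum>j\<le>k n. \<Sum>a\<le>j. sqnorm (E a j * f))"
      unfolding F_def by (rule sum_sub_block_starts_le(2)[OF k]) (auto intro: sum_nonneg)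
    finally show ?thesis using pairs by linarith
  qed
  have "(\<Sum>i\<in>F. \<Sum>v\<in>V. (cmod (lookup ((c (J i v) - c (k (Suc i))) * f) v))\<^sup>2)
      \<le> (\<Sum>i\<in>F. \<Sum>v\<in>V. 3 * ((cmod (lookup (c (J i v) * h i) v))\<^sup>2
      + (cmod (lookup (E (k i) (J i v) * f) v))\<^sup>2 + (cmod (lookup (E (J i v) (k (Suc i)) * f) v))\<^sup>2))"
    by (intro sum_mono split)
  also have "\<dots> = 3 * ((\<Sum>i\<in>F. \<Sum>v\<in>V. (cmod (lookup (c (J i v) * h i) v))\<^sup>2)
      + (\<Sum>i\<in>F. \<Sum>v\<in>V. (cmod (lookup (E (k i) (J i v) * f) v))\<^sup>2)
      + (\<Sum>i\<in>F. \<Sum>v\<in>V. (cmod (lookup (E (J i v) (k (Suc i)) * f) v))\<^sup>2))"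
    by (simp only: sum.distrib sum_distrib_left[symmetric])
  also have "\<dots> \<le> cube_osc_const CARD('d) L * sqnorm f"
    using 1 2 3 unfolding cube_osc_const_def by (simp add: distrib_right mult.assoc)
  finally show ?thesis by (simp add: F_def c_def)
qed

text \<open>Replacing the cubes by kernels \<open>A j\<close> costs only the square function of the
  differences \<open>D j\<close>: it dominates any choice of index, so no maximal inequality for
  \<open>A\<close> is required.\<close>

lemma perturbed_oscillation:
  fixes R k :: "nat \<Rightarrow> nat" and A :: "nat \<Rightarrow> int ^ 'd::finite \<Rightarrow>\<^sub>0 complex"
  assumes L: "L > 1" and R: "\<And>j. R j \<ge> 1" "\<And>j. L * real (R j) \<le> real (R (Suc j))"
    and k: "mono k" and V: "finite V"
    and J: "\<And>i v. k i \<le> J i v" "\<And>i v. J i v \<le> k (Suc i)"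
    and B: "\<And>M \<theta>. (\<And>m. \<bar>\<theta> $ m\<bar> \<le> pi) \<Longrightarrow> (\<Sum>j\<le>M. (cmod (fourier \<theta> (A j - cube (R j))))\<^sup>2) \<le> B"
  shows "(\<Sum>i<n. \<Sum>v\<in>V. (cmod (lookup ((A (J i v) - A (k (Suc i))) * f) v))\<^sup>2)
    \<le> 3 * (cube_osc_const CARD('d) L + 3 * B) * sqnorm f"
proof -
  define F where "F = {i. i < n \<and> k i < k (Suc i)}"
  define c where "c = (\<lambda>j. cube (R j) :: int ^ 'd \<Rightarrow>\<^sub>0 complex)"
  define D where "D = (\<lambda>j. (A j - c j) * f)"
  have DB: "(\<Sum>j\<le>M. sqnorm (D j)) \<le> B * sqnorm f" for M
    unfolding D_def c_def by (intro multiplier_bound B) auto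
  have "(\<Sum>i<n. \<Sum>v\<in>V. (cmod (lookup ((A (J i v) - A (k (Suc i))) * f) v))\<^sup>2)
      = (\<Sum>i\<in>F. \<Sum>v\<in>V. (cmod (lookup ((A (J i v) - A (k (Suc i))) * f) v))\<^sup>2)"
  proof (intro sum.mono_neutral_right ballI sum.neutral)
    fix i v assume i: "i \<in> {..<n} - F"
    then have "k (Suc i) \<le> k i" by (auto simp: F_def)
    \<comment> \<open>In a degenerate block the two averages coincide and the oscillation vanishes,
      so only nonempty blocks have to be summed.\<close>
    then have "J i v = k (Suc i)" using J[where i = i and v = v] by linarith
    then show "(cmod (lookup ((A (J i v) - A (k (Suc i))) * f) v))\<^sup>2 = 0" by simp
  qed (auto simp: F_def)
  also have "\<dots> \<le> (\<Sum>i\<in>F. \<Sum>v\<in>V. 3 * ((cmod (lookup ((c (J i v) - c (k (Suc i))) * f) v))\<^sup>2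
      + (cmod (lookup (D (J i v)) v))\<^sup>2 + (cmod (lookup (D (k (Suc i))) v))\<^sup>2))"
  proof (intro sum_mono)
    fix i v
    have "(A (J i v) - A (k (Suc i))) * f = (c (J i v) - c (k (Suc i))) * f + D (J i v) - D (k (Suc i))"
      by (simp add: D_def algebra_simps)
    then have "lookup ((A (J i v) - A (k (Suc i))) * f) v = lookup ((c (J i v) - c (k (Suc i))) * f) v
        + lookup (D (J i v)) v + - lookup (D (k (Suc i))) v"
      by (simp add: lookup_add lookup_minus)
    from norm_sum_3_squared_le[OF this] show "(cmod (lookup ((A (J i v) - A (k (Suc i))) * f) v))\<^sup>2
        \<le> 3 * ((cmod (lookup ((c (J i v) - c (k (Suc i))) * f) v))\<^sup>2
      + (cmod (lookup (D (J i v)) v))\<^sup>2 + (cmod (lookup (D (k (Suc i))) v))\<^sup>2)" by simp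
  qed
  also have "\<dots> = 3 * ((\<Sum>i\<in>F. \<Sum>v\<in>V. (cmod (lookup ((c (J i v) - c (k (Suc i))) * f) v))\<^sup>2)
      + (\<Sum>i\<in>F. \<Sum>v\<in>V. (cmod (lookup (D (J i v)) v))\<^sup>2)
      + (\<Sum>i\<in>F. \<Sum>v\<in>V. (cmod (lookup (D (k (Suc i))) v))\<^sup>2))"
    by (simp only: sum.distrib sum_distrib_left[symmetric])
  also have "\<dots> \<le> 3 * (cube_osc_const CARD('d) L * sqnorm f + 2 * B * sqnorm f + B * sqnorm f)"
  proof (intro mult_left_mono add_mono)
    show "(\<Sum>i\<in>F. \<Sum>v\<in>V. (cmod (lookup ((c (J i v) - c (k (Suc i))) * f) v))\<^sup>2) \<le> cube_osc_const CARD('d) L * sqnorm f"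
      unfolding F_def c_def by (rule cube_oscillation[where R = R and J = J, OF L R k V J])
    have end_bound: "(\<Sum>i\<in>F. sqnorm (D (k (Suc i)))) \<le> B * sqnorm f"
      using sum_sub_block_starts_le(2)[OF k, of "\<lambda>j. sqnorm (D j)" n] DB[of "k n"] by (simp add: F_def)
    have "(\<Sum>i\<in>F. \<Sum>v\<in>V. (cmod (lookup (D (k (Suc i))) v))\<^sup>2) \<le> (\<Sum>i\<in>F. sqnorm (D (k (Suc i))))"
      by (intro sum_mono sum_le_sqnorm V)
    then show "(\<Sum>i\<in>F. \<Sum>v\<in>V. (cmod (lookup (D (k (Suc i))) v))\<^sup>2) \<le> B * sqnorm f"
      using end_bound by linarith
    have "(\<Sum>i\<in>F. \<Sum>v\<in>V. (cmod (lookup (D (J i v)) v))\<^sup>2)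
        \<le> (\<Sum>i\<in>F. (\<Sum>j\<in>{k i..<k (Suc i)}. sqnorm (D j)) + sqnorm (D (k (Suc i))))"
    proof (rule sum_mono)
      fix i assume "i \<in> F"
      have "(\<Sum>v\<in>V. (cmod (lookup (D (J i v)) v))\<^sup>2) \<le> (\<Sum>v\<in>V. \<Sum>j\<in>{k i..k (Suc i)}. (cmod (lookup (D j) v))\<^sup>2)"
        using J by (intro sum_mono member_le_sum[where f = "\<lambda>j. (cmod (lookup (D j) v))\<^sup>2" for v]) auto
      also have "\<dots> = (\<Sum>j\<in>{k i..k (Suc i)}. \<Sum>v\<in>V. (cmod (lookup (D j) v))\<^sup>2)" by (rule sum.swap)
      also have "\<dots> \<le> (\<Sum>j\<in>{k i..k (Suc i)}. sqnorm (D j))" by (intro sum_mono sum_le_sqnorm V)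
      \<comment> \<open>Half-open blocks are disjoint, so together they cost one \<open>B\<close>.
        The right end, which also belongs to the next block, is charged separately to a second
        \<open>B\<close>.\<close>
      also have "{k i..k (Suc i)} = insert (k (Suc i)) {k i..<k (Suc i)}"
        using monoD[OF k, of i "Suc i"] by auto
      finally show "(\<Sum>v\<in>V. (cmod (lookup (D (J i v)) v))\<^sup>2)
          \<le> (\<Sum>j\<in>{k i..<k (Suc i)}. sqnorm (D j)) + sqnorm (D (k (Suc i)))" by simp
    qed
    also have "\<dots> = (\<Sum>i\<in>F. \<Sum>j\<in>{k i..<k (Suc i)}. sqnorm (D j)) + (\<Sum>i\<in>F. sqnorm (D (k (Suc i))))"
      by (rule sum.distrib)
    also have "(\<Sum>i\<in>F. \<Sum>j\<in>{k i..<k (Suc i)}. sqnorm (D j)) \<le> (\<Sum>i<n. \<Sum>j\<in>{k i..<k (Suc i)}. sqnorm (D j))"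
      by (intro sum_mono2) (auto simp: F_def intro: sum_nonneg)
    also have "\<dots> = (\<Sum>j\<in>{k 0..<k n}. sqnorm (D j))"
      by (induction n) (auto simp: sum.atLeastLessThan_concat monoD[OF k])
    also have "\<dots> \<le> (\<Sum>j\<le>k n. sqnorm (D j))" by (intro sum_mono2) auto
    also have "\<dots> \<le> B * sqnorm f" by (rule DB)
    finally show "(\<Sum>i\<in>F. \<Sum>v\<in>V. (cmod (lookup (D (J i v)) v))\<^sup>2) \<le> 2 * B * sqnorm f"
      using end_bound by linarith
  qed auto
  finally show ?thesis by (simp add: algebra_simps)
qed

section \<open>Weyl sums\<close>

definition ep :: "nat \<Rightarrow> int \<Rightarrow> complex" where
  "ep p x = cis (2 * pi * real_of_int x / real p)"

lemma ep_add: "ep p (x + y) = ep p x * ep p y"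
  by (simp add: ep_def cis_mult add_divide_distrib distrib_left)

lemma ep_0 [simp]: "ep p 0 = 1"
  by (simp add: ep_def)

lemma norm_ep [simp]: "norm (ep p x) = 1"
  by (simp add: ep_def)

lemma cnj_ep: "cnj (ep p x) = ep p (- x)"
  by (simp add: ep_def cis_cnj)

lemma ep_multiple:
  assumes "p > 0"
  shows "ep p (int p * k) = 1"
proof -
  have "2 * pi * real_of_int (int p * k) / real p = 2 * pi * real_of_int k"
    using assms by simp
  then show ?thesis unfolding ep_def by (simp only: cis_multiple_2pi Ints_of_int)
qed

lemma ep_cong:
  assumes "p > 0" "int p dvd x - y"
  shows "ep p x = ep p y"
proof -
  from assms(2) obtain k where "x = y + int p * k"
    by (metis dvdE diff_add_cancel add.commute)
  then show ?thesis using assms(1) by (simp add: ep_add ep_multiple)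
qed

lemma ep_eq_1_iff:
  assumes "p > 0"
  shows "ep p x = 1 \<longleftrightarrow> int p dvd x"
proof
  assume "ep p x = 1"
  then have "cos (2 * pi * real_of_int x / real p) = 1"
    unfolding ep_def by (metis cis.simps(1) one_complex.sel(1))
  then obtain k :: int where "2 * pi * real_of_int x / real p = real_of_int k * (2 * pi)"
    by (auto simp: cos_one_2pi_int)
  then have "(2 * pi) * real_of_int x = (2 * pi) * (real_of_int k * real p)"
    using assms by (simp add: field_simps)
  then have "real_of_int x = real_of_int (k * int p)"
    by (subst (asm) mult_cancel_left) simp
  then have "x = k * int p" by linarith
  then show "int p dvd x" by simp
next
  assume "int p dvd x"
  then show "ep p x = 1" using ep_cong[OF assms, of x 0] by simp
qed

lemma sum_ep_linear:
  assumes "p > 0"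
  shows "(\<Sum>j<p. ep p (a * int j)) = (if int p dvd a then of_nat p else 0)"
proof -
  have pow: "ep p (a * int j) = ep p a ^ j" for j
    by (simp add: ep_def Complex.DeMoivre mult_ac)
  show ?thesis
  proof (cases "int p dvd a")
    case True
    then have "ep p a = 1" using ep_eq_1_iff[OF assms] by simp
    then show ?thesis using True by (simp add: pow)
  next
    case False
    then have "ep p a \<noteq> 1" using ep_eq_1_iff[OF assms] by simp
    moreover have "ep p a ^ p = 1"
      unfolding pow[symmetric] using ep_multiple[OF assms, of a] by (simp add: mult.commute)
    ultimately show ?thesis using False by (simp add: pow geometric_sum)
  qed
qed

lemma sum_mod_shift:
  fixes F :: "int \<Rightarrow> 'b::comm_monoid_add"
  assumes "p > 0" and per: "\<And>x y. int p dvd x - y \<Longrightarrow> F x = F y"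
  shows "(\<Sum>j<p. F (int j + s)) = (\<Sum>j<p. F (int j))"
proof (rule sum.reindex_bij_witness[of _ "\<lambda>j. nat ((int j - s) mod int p)" "\<lambda>j. nat ((int j + s) mod int p)"])
  fix j assume "j \<in> {..<p}"
  then have j: "int j mod int p = int j" by simp
  show "nat ((int (nat ((int j + s) mod int p)) - s) mod int p) = j"
    using assms(1) j by (simp add: mod_diff_left_eq)
  show "nat ((int j + s) mod int p) \<in> {..<p}" using assms(1) by (simp add: nat_less_iff)
  show "F (int (nat ((int j + s) mod int p))) = F (int j + s)"
    using assms(1) by (intro per) (simp add: mod_eq_dvd_iff[symmetric])
next
  fix j assume "j \<in> {..<p}"
  then have j: "int j mod int p = int j" by simp
  show "nat ((int (nat ((int j - s) mod int p)) + s) mod int p) = j"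
    using assms(1) j by (simp add: mod_add_left_eq)
  show "nat ((int j - s) mod int p) \<in> {..<p}" using assms(1) by (simp add: nat_less_iff)
qed

lemma poly_cong_dvd:
  fixes Q :: "int poly"
  assumes "m dvd x - y"
  shows "m dvd poly Q x - poly Q y"
proof (induction Q)
  case (pCons a Q)
  have "poly (pCons a Q) x - poly (pCons a Q) y = x * (poly Q x - poly Q y) + (x - y) * poly Q y"
    by (simp add: algebra_simps)
  then show ?case using pCons.IH assms by (metis dvd_add dvd_mult dvd_mult2)
qed simp

text \<open>One differencing step lowers the degree and multiplies the leading coefficient by n h.
  For 1 \<le> n < p and 0 < h < p this factor is invertible modulo the prime \<open>p\<close>, so
  the hypotheses of Weyl's bound survive the induction.\<close>

lemma coeff_shift_difference:
  fixes Q :: "int poly" and h :: int and n :: nat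
  assumes "degree Q \<le> n" "n \<ge> 1"
  defines "Q' \<equiv> pcompose Q [:h, 1:] - Q"
  shows "degree Q' \<le> n - 1" "coeff Q' (n - 1) = int n * h * coeff Q n"
proof -
  have Q: "Q = (\<Sum>i\<le>n. monom (coeff Q i) i)"
    using assms(1) by (simp add: poly_as_sum_of_monoms')
  have co: "coeff (pcompose Q [:h, 1:]) k = (\<Sum>i\<le>n. coeff Q i * (if k \<le> i then of_nat (i choose k) * h ^ (i - k) else 0))" for k
  proof -
    have "pcompose Q [:h, 1:] = (\<Sum>i\<le>n. smult (coeff Q i) ([:h, 1:] ^ i))"
    proof -
      have "poly (pcompose Q [:h, 1:]) x = poly (\<Sum>i\<le>n. smult (coeff Q i) ([:h, 1:] ^ i)) x" for x
        unfolding poly_pcompose by (subst Q) (simp add: poly_sum poly_monom)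
      then show ?thesis by (simp add: poly_eq_poly_eq_iff[symmetric] fun_eq_iff)
    qed
    moreover have "coeff ([:h, 1:] ^ i) k = (if k \<le> i then of_nat (i choose k) * h ^ (i - k) else 0)" for i
      by (auto simp: coeff_linear_poly_power intro!: coeff_eq_0 simp: degree_linear_power)
    ultimately show ?thesis by (simp add: coeff_sum)
  qed
  have "coeff Q' k = 0" if "k > n - 1" for k
  proof (cases "k = n")
    case True
    have "coeff (pcompose Q [:h, 1:]) n = (\<Sum>i\<le>n. if i = n then coeff Q n else 0)"
      unfolding co by (intro sum.cong refl) auto
    then show ?thesis using True by (simp add: Q'_def)
  next
    case False
    then have "k > n" using that by simp
    then show ?thesis using assms(1) by (simp add: Q'_def co coeff_eq_0)
  qed
  then show "degree Q' \<le> n - 1" by (intro degree_le) auto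
  obtain m where n: "n = Suc m" using assms(2) by (cases n) auto
  have "coeff (pcompose Q [:h, 1:]) m = (\<Sum>i\<le>Suc m. (if i = m then coeff Q m else 0) + (if i = Suc m then coeff Q (Suc m) * (int (Suc m) * h) else 0))"
    unfolding co n by (intro sum.cong refl) auto
  also have "\<dots> = coeff Q m + coeff Q (Suc m) * (int (Suc m) * h)"
    unfolding sum.distrib by (subst (1 2) sum.delta) simp_all
  finally show "coeff Q' (n - 1) = int n * h * coeff Q n"
    by (simp add: Q'_def n)
qed

text \<open>Weyl differencing: the square of the sum is an average of sums of lower degree.\<close>

lemma weyl_sum_bound:
  assumes p: "prime p" and "1 \<le> n" "n < p" "degree Q \<le> n" "\<not> int p dvd coeff Q n"
  shows "cmod (\<Sum>j<p. ep p (poly Q (int j))) \<le> 2 * real p powr (1 - 1 / 2 ^ (n - 1))"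
  using assms(2-)
proof (induction n arbitrary: Q rule: nat_induct_at_least)
  case base
  have p0: "p > 0" using p by (simp add: prime_gt_0_nat)
  have "poly Q x = coeff Q 0 + coeff Q 1 * x" for x
  proof -
    have "Q = (\<Sum>i\<le>1. monom (coeff Q i) i)"
      using base.prems(2) by (simp only: poly_as_sum_of_monoms')
    then have "poly Q x = poly (\<Sum>i\<le>1. monom (coeff Q i) i) x" by (rule arg_cong)
    then show ?thesis by (simp add: poly_monom)
  qed
  then have "(\<Sum>j<p. ep p (poly Q (int j))) = ep p (coeff Q 0) * (\<Sum>j<p. ep p (coeff Q 1 * int j))"
    by (simp add: ep_add sum_distrib_left)
  also have "\<dots> = 0" using base.prems(3) p0 by (simp add: sum_ep_linear)
  finally show ?case by simp
next
  case (Suc n)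
  have p0: "p > 0" using p by (simp add: prime_gt_0_nat)
  define E :: real where "E = 1 - 1 / 2 ^ (n - 1)"
  define S where "S = (\<Sum>j<p. ep p (poly Q (int j)))"
  define D where "D = (\<lambda>h. pcompose Q [:h, 1:] - Q)"
  have D: "poly (D h) x = poly Q (x + h) - poly Q x" for h x
    by (simp add: D_def poly_pcompose add.commute)
  have per: "ep p (poly Q x - c) = ep p (poly Q y - c)" if "int p dvd x - y" for x y c
    using p0 poly_cong_dvd[OF that, of Q] by (intro ep_cong) auto
  have "S * cnj S = (\<Sum>j<p. \<Sum>i<p. ep p (poly Q (int i) - poly Q (int j)))"
    unfolding S_def cnj_sum sum_product cnj_ep ep_add[symmetric]
    by (subst sum.swap) simp
  also have "\<dots> = (\<Sum>j<p. \<Sum>h<p. ep p (poly Q (int h + int j) - poly Q (int j)))"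
    by (intro sum.cong refl sum_mod_shift[symmetric] p0 per)
  also have "\<dots> = (\<Sum>h<p. \<Sum>j<p. ep p (poly (D (int h)) (int j)))"
    unfolding D by (subst sum.swap) (simp add: add.commute)
  finally have "complex_of_real ((cmod S)\<^sup>2) = (\<Sum>h<p. \<Sum>j<p. ep p (poly (D (int h)) (int j)))"
    by (simp only: complex_norm_square)
  then have "(cmod S)\<^sup>2 = cmod (\<Sum>h<p. \<Sum>j<p. ep p (poly (D (int h)) (int j)))"
    by (metis norm_of_real abs_of_nonneg zero_le_power2)
  also have "\<dots> \<le> (\<Sum>h<p. cmod (\<Sum>j<p. ep p (poly (D (int h)) (int j))))"
    by (rule norm_sum)
  \<comment> \<open>The shift 0 gives the constant phase and only the trivial bound; all other
    shifts have lower degree and fall under the induction hypothesis.\<close>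
  also have "\<dots> \<le> (\<Sum>h<p. if h = 0 then real p else 2 * real p powr E)"
  proof (intro sum_mono)
    fix h assume "h \<in> {..<p}"
    show "cmod (\<Sum>j<p. ep p (poly (D (int h)) (int j))) \<le> (if h = 0 then real p else 2 * real p powr E)"
    proof (cases "h = 0")
      case True
      have "cmod (\<Sum>j<p. ep p (poly (D (int h)) (int j))) \<le> (\<Sum>j<p. cmod (ep p (poly (D (int h)) (int j))))"
        by (rule norm_sum)
      then show ?thesis using True by simp
    next
      case False
      have pi: "prime (int p)" using p by simp
      have "\<not> int p dvd int (Suc n)" using Suc.prems(1) by (metis int_dvd_int_iff dvd_imp_le not_le zero_less_Suc)
      moreover have "\<not> int p dvd int h" using False \<open>h \<in> {..<p}\<close> by (metis int_dvd_int_iff dvd_imp_le not_le lessThan_iff neq0_conv)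
      ultimately have "\<not> int p dvd int (Suc n) * int h * coeff Q (Suc n)"
        using Suc.prems(3) pi by (simp add: prime_dvd_mult_iff del: of_nat_Suc)
      then have "\<not> int p dvd coeff (D (int h)) n" "degree (D (int h)) \<le> n"
        using coeff_shift_difference[of Q "Suc n" "int h"] Suc.prems(2) by (simp_all add: D_def)
      then have "cmod (\<Sum>j<p. ep p (poly (D (int h)) (int j))) \<le> 2 * real p powr E"
        unfolding E_def using Suc.prems(1) by (intro Suc.IH) auto
      then show ?thesis using False by simp
    qed
  qed
  also have "\<dots> = real p + real (p - 1) * (2 * real p powr E)"
    using p0 by (simp add: sum.remove[of "{..<p}" 0])
  also have "\<dots> \<le> real p powr (1 + E) + 2 * real p powr (1 + E)"
  proof (intro add_mono)
    have "E \<ge> 0" by (simp add: E_def)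
    then show "real p \<le> real p powr (1 + E)"
      using p0 powr_mono[of 1 "1 + E" "real p"] by simp
    have "real (p - 1) * (2 * real p powr E) \<le> real p * (2 * real p powr E)"
      by (intro mult_right_mono) auto
    then show "real (p - 1) * (2 * real p powr E) \<le> 2 * real p powr (1 + E)"
      using p0 by (simp add: powr_add)
  qed
  \<comment> \<open>The constant 2 reproduces itself because 1 + 2 \<le> 2^2; the square root halves
    the saving in the exponent.\<close>
  also have "\<dots> \<le> (2 * real p powr ((1 + E) / 2))\<^sup>2"
    by (simp add: power_mult_distrib power2_eq_square flip: powr_add)
  finally have "cmod S \<le> 2 * real p powr ((1 + E) / 2)"
    by (rule power2_le_imp_le) simp
  also have "(1 + E) / 2 = 1 - 1 / 2 ^ (Suc n - 1)"
    using \<open>1 \<le> n\<close> by (cases n) (auto simp: E_def field_simps)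
  finally show ?case by (simp add: S_def)
qed

section \<open>Equidistribution of the digits\<close>

definition dcoeff :: "nat \<Rightarrow> (nat \<Rightarrow> complex) \<Rightarrow> nat \<Rightarrow> complex" where
  "dcoeff p \<psi> h = 1 / of_nat p * (\<Sum>y<p. \<psi> y * ep p (- (int h * int y)))"

lemma dcoeff_inversion:
  assumes "y < p"
  shows "(\<Sum>h<p. dcoeff p \<psi> h * ep p (int h * int y)) = \<psi> y"
proof -
  have p0: "p > 0" using assms by simp
  have "(\<Sum>h<p. dcoeff p \<psi> h * ep p (int h * int y))
      = (\<Sum>h<p. \<Sum>z<p. 1 / of_nat p * \<psi> z * ep p ((int y - int z) * int h))"
  proof (rule sum.cong[OF refl])
    fix h
    have "ep p (- (int h * int z)) * ep p (int h * int y) = ep p ((int y - int z) * int h)" for z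
      by (simp add: ep_add[symmetric] algebra_simps)
    then show "dcoeff p \<psi> h * ep p (int h * int y) = (\<Sum>z<p. 1 / of_nat p * \<psi> z * ep p ((int y - int z) * int h))"
      by (simp add: dcoeff_def sum_distrib_left sum_distrib_right mult.assoc)
  qed
  also have "\<dots> = (\<Sum>z<p. 1 / of_nat p * \<psi> z * (\<Sum>h<p. ep p ((int y - int z) * int h)))"
    by (subst sum.swap) (simp add: sum_distrib_left)
  also have "\<dots> = (\<Sum>z<p. if z = y then \<psi> y else 0)"
  proof (intro sum.cong refl)
    fix z assume z: "z \<in> {..<p}"
    have "int p dvd int y - int z \<longleftrightarrow> z = y"
    proof
      assume "int p dvd int y - int z"
      then have "int y mod int p = int z mod int p" by (simp add: mod_eq_dvd_iff)
      then show "z = y" using z assms by simp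
    qed simp
    then show "1 / of_nat p * \<psi> z * (\<Sum>h<p. ep p ((int y - int z) * int h)) = (if z = y then \<psi> y else 0)"
      using p0 by (simp add: sum_ep_linear)
  qed
  finally show ?thesis using assms by simp
qed

text \<open>The phase is written as -2x so that the ratio of the geometric series differs from 1 by
  exactly 2 sin x; the denominator is the distance from \<open>x\<close> to the ends of (0,
  pi).\<close>

lemma norm_sum_cis_le:
  assumes "0 < x" "x < pi"
  shows "cmod (\<Sum>y<r. cis (- (2 * x) * real y)) \<le> 2 / min x (pi - x)"
proof -
  have s: "sin x \<ge> min x (pi - x) / 2"
  proof (cases "x \<le> pi / 2")
    case True
    then show ?thesis using sin_ge_half[of x] assms by simp
  next
    case False
    then show ?thesis using sin_ge_half[of "pi - x"] assms by simp
  qed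
  have m: "min x (pi - x) > 0" using assms by simp
  define z where "z = cis (- (2 * x))"
  have "cmod (z - 1) = 2 * \<bar>sin (- (2 * x) / 2)\<bar>"
    unfolding z_def by (rule norm_cis_minus_1)
  then have nz: "cmod (z - 1) \<ge> min x (pi - x)" using s m by simp
  then have "z \<noteq> 1" using m by auto
  have "(\<Sum>y<r. cis (- (2 * x) * real y)) = (\<Sum>y<r. z ^ y)"
    unfolding z_def by (simp add: Complex.DeMoivre mult_ac)
  also have "\<dots> = (z ^ r - 1) / (z - 1)" using \<open>z \<noteq> 1\<close> by (rule geometric_sum)
  also have "cmod \<dots> = cmod (z ^ r - 1) / cmod (z - 1)" by (rule norm_divide)
  also have "\<dots> \<le> 2 / min x (pi - x)"
  proof (rule frac_le)
    have "cmod (z ^ r - 1) \<le> cmod (z ^ r) + cmod 1" by (rule norm_triangle_ineq4)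
    then show "cmod (z ^ r - 1) \<le> 2" by (simp add: norm_power z_def)
  qed (use nz m in auto)
  finally show ?thesis .
qed

lemma sum_inverse_le_ln:
  assumes "p > 0"
  shows "(\<Sum>k\<in>{1..<p}. 1 / real k) \<le> 1 + ln (real p)"
proof -
  obtain n where n: "p = Suc n" using assms by (cases p) auto
  have "(\<Sum>k\<in>{1..<p}. 1 / real k) \<le> (\<Sum>k\<in>{1..Suc n}. 1 / real k)"
    unfolding n by (intro sum_mono2) auto
  also have "\<dots> = harm (Suc n)" by (simp add: harm_def inverse_eq_divide)
  also have "\<dots> \<le> 1 + ln (real (Suc n))"
    using decseqD[OF decseq_harm_diff_ln, of 0 n] by (simp add: harm_expand)
  finally show ?thesis by (simp add: n)
qed

text \<open>The coefficients are normalised incomplete geometric sums. The \<open>k\<close>-th one,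
  counted from the frequency nearest to \<open>t\<close>, is O(1 / k + 1 / (p - k)), so their sum is
  harmonic. The central coefficient is bounded by 1, whence 5 + 4 ln p = 1 + 4 (1 + ln p).\<close>

lemma sum_dcoeff_le:
  fixes t :: real
  assumes p0: "p > 0" and r: "r \<le> p"
  shows "(\<Sum>h<p. cmod (dcoeff p (\<lambda>y. if y < r then cis (t * real y) else 0) h)) \<le> 5 + 4 * ln (real p)"
proof -
  \<comment> \<open>\<open>t\<close> need not be a multiple of 2 pi / p. Removing the nearest
    multiple leaves |s| \<le> pi / p, and the sum over all residues is invariant under the shift by
    \<open>h0\<close>.\<close>
  define h0 where "h0 = round (t * real p / (2 * pi))"
  define s where "s = t - 2 * pi * real_of_int h0 / real p"
  define F where "F = (\<lambda>k::int. cmod (1 / of_nat p * (\<Sum>y<r. cis (s * real y) * ep p (- (k * int y)))))"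
  have s: "\<bar>s\<bar> \<le> pi / real p"
  proof -
    have "\<bar>real_of_int h0 - t * real p / (2 * pi)\<bar> \<le> 1 / 2"
      unfolding h0_def by (rule of_int_round_abs_le)
    then have "2 * pi / real p * \<bar>real_of_int h0 - t * real p / (2 * pi)\<bar> \<le> 2 * pi / real p * (1 / 2)"
      by (intro mult_left_mono) auto
    also have "2 * pi / real p * \<bar>real_of_int h0 - t * real p / (2 * pi)\<bar> = \<bar>2 * pi / real p * (real_of_int h0 - t * real p / (2 * pi))\<bar>"
      by (simp add: abs_mult)
    also have "2 * pi / real p * (real_of_int h0 - t * real p / (2 * pi)) = - s"
      using p0 by (simp add: s_def field_simps)
    finally show ?thesis by simp
  qed
  have per: "F x = F y" if "int p dvd x - y" for x y
  proof -
    have "ep p (- (x * int i)) = ep p (- (y * int i))" for i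
    proof (rule ep_cong[OF p0])
      have "- (x * int i) - - (y * int i) = (x - y) * (- int i)" by (simp add: algebra_simps)
      then show "int p dvd - (x * int i) - - (y * int i)" using that by (metis dvd_mult2)
    qed
    then show ?thesis by (simp add: F_def)
  qed
  have F: "cmod (dcoeff p (\<lambda>y. if y < r then cis (t * real y) else 0) h) = F (int h + - h0)" for h
  proof -
    have eq: "cis (t * real y) * ep p (- (int h * int y)) = cis (s * real y) * ep p (- ((int h + - h0) * int y))" for y
      unfolding ep_def cis_mult s_def
      by (rule arg_cong[of _ _ cis]) (simp add: algebra_simps diff_divide_distrib add_divide_distrib)
    have "(\<Sum>y<p. (if y < r then cis (t * real y) else 0) * ep p (- (int h * int y)))
        = (\<Sum>y<r. cis (t * real y) * ep p (- (int h * int y)))"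
      using r by (intro sum.mono_neutral_cong_right) auto
    then show ?thesis unfolding dcoeff_def F_def eq by simp
  qed
  have "(\<Sum>h<p. cmod (dcoeff p (\<lambda>y. if y < r then cis (t * real y) else 0) h)) = (\<Sum>k<p. F (int k))"
    unfolding F by (intro sum_mod_shift p0 per)
  also have "\<dots> = F 0 + (\<Sum>k\<in>{1..<p}. F (int k))"
  proof -
    have "{..<p} = insert 0 {1..<p}" using p0 by auto
    then show ?thesis by simp
  qed
  also have "\<dots> \<le> 1 + (\<Sum>k\<in>{1..<p}. 2 / real k + 2 / real (p - k))"
  proof (intro add_mono sum_mono)
    have "cmod (\<Sum>y<r. cis (s * real y)) \<le> (\<Sum>y<r. cmod (cis (s * real y)))" by (rule norm_sum)
    then have "cmod (\<Sum>y<r. cis (s * real y)) \<le> real p" using r by simp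
    then show "F 0 \<le> 1" using p0 by (simp add: F_def norm_divide)
  next
    fix k assume k: "k \<in> {1..<p}"
    \<comment> \<open>The phase of the \<open>k\<close>-th sum is s - 2 pi k / p = -2x. As |s| / 2
      \<le> pi / (2p) and 1 \<le> k < p, both \<open>x\<close> and pi - x keep at least half of
      their values for s = 0.\<close>
    define x where "x = pi * real k / real p - s / 2"
    have k1: "real k \<ge> 1" "real p - real k \<ge> 1" using k by auto
    have b: "pi * (real k / 2) / real p \<le> x" "pi * ((real p - real k) / 2) / real p \<le> pi - x"
    proof -
      have "pi * (real k / 2) / real p = pi * real k / real p - pi * (real k / 2) / real p"
        by (simp add: field_simps)
      also have "\<dots> \<le> pi * real k / real p - pi * (1 / 2) / real p"
        using k1 by (intro diff_mono divide_right_mono mult_left_mono) auto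
      finally show "pi * (real k / 2) / real p \<le> x" using s by (simp add: x_def abs_le_iff)
      have "pi * ((real p - real k) / 2) / real p = pi * (real p - real k) / real p - pi * ((real p - real k) / 2) / real p"
        by (simp add: field_simps)
      also have "\<dots> \<le> pi * (real p - real k) / real p - pi * (1 / 2) / real p"
        using k1 by (intro diff_mono divide_right_mono mult_left_mono) auto
      also have "pi * (real p - real k) / real p = pi - pi * real k / real p"
        using p0 by (simp add: field_simps)
      finally show "pi * ((real p - real k) / 2) / real p \<le> pi - x" using s by (simp add: x_def abs_le_iff)
    qed
    have b0: "0 < pi * (real k / 2) / real p" "0 < pi * ((real p - real k) / 2) / real p"
      using k1 p0 by auto
    have x: "0 < x" "x < pi" using b b0 by linarith+
    have eq: "cis (s * real y) * ep p (- (int k * int y)) = cis (- (2 * x) * real y)" for y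
      unfolding ep_def cis_mult x_def
      by (rule arg_cong[of _ _ cis]) (simp add: algebra_simps diff_divide_distrib add_divide_distrib)
    have "F (int k) = 1 / real p * cmod (\<Sum>y<r. cis (- (2 * x) * real y))"
      unfolding F_def eq using p0 by (simp add: norm_divide)
    also have "\<dots> \<le> 1 / real p * (2 / min x (pi - x))"
      by (intro mult_left_mono norm_sum_cis_le x) auto
    also have "\<dots> \<le> 1 / real p * (2 / x + 2 / (pi - x))"
      using x by (intro mult_left_mono) (auto simp: min_def)
    also have "\<dots> \<le> 1 / real p * (2 / (pi * (real k / 2) / real p) + 2 / (pi * ((real p - real k) / 2) / real p))"
      using b b0 by (intro mult_left_mono add_mono divide_left_mono mult_pos_pos) auto
    also have "\<dots> = 4 / pi * (1 / real k + 1 / (real p - real k))"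
      using p0 k1 by (simp add: field_simps)
    also have "\<dots> \<le> 2 * (1 / real k + 1 / (real p - real k))"
      using pi_gt3 k1 by (intro mult_right_mono) (auto simp: field_simps)
    also have "\<dots> = 2 / real k + 2 / real (p - k)"
      using k by (simp add: of_nat_diff)
    finally show "F (int k) \<le> 2 / real k + 2 / real (p - k)" .
  qed
  also have "(\<Sum>k\<in>{1..<p}. 2 / real k + 2 / real (p - k)) = 2 * (\<Sum>k\<in>{1..<p}. 1 / real k) + 2 * (\<Sum>k\<in>{1..<p}. 1 / real (p - k))"
    by (simp add: sum.distrib sum_distrib_left)
  also have "(\<Sum>k\<in>{1..<p}. 1 / real (p - k)) = (\<Sum>k\<in>{1..<p}. 1 / real k)"
    by (rule sum.reindex_bij_witness[of _ "\<lambda>k. p - k" "\<lambda>k. p - k"]) auto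
  also have "1 + (2 * (\<Sum>k\<in>{1..<p}. 1 / real k) + 2 * (\<Sum>k\<in>{1..<p}. 1 / real k)) \<le> 5 + 4 * ln (real p)"
    using sum_inverse_le_ln[OF p0] by simp
  finally show ?thesis .
qed

text \<open>Expand each \<open>\<psi>\<^sub>u\<close> modulo \<open>p\<close>: all nonzero frequencies are controlled by Weyl's bound.\<close>

lemma moment_curve_equidistribution:
  assumes p: "prime p" and D: "1 \<le> D" "D < p"
    and L: "\<And>u. u \<in> {1..D} \<Longrightarrow> (\<Sum>h<p. cmod (dcoeff p (\<psi> u) h)) \<le> L"
  shows "cmod ((\<Sum>j<p. \<Prod>u\<in>{1..D}. \<psi> u (j ^ u mod p))
      - of_nat p * (\<Prod>u\<in>{1..D}. 1 / of_nat p * (\<Sum>y<p. \<psi> u y)))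
    \<le> L ^ D * (2 * real p powr (1 - 1 / 2 ^ (D - 1)))"
proof -
  have p0: "p > 0" using p by (simp add: prime_gt_0_nat)
  define X where "X = PiE {1..D} (\<lambda>_. {..<p})"
  have finX: "finite X" unfolding X_def by (intro finite_PiE) auto
  \<comment> \<open>The zero frequency vector, restricted so that it belongs to the extensional
    product \<open>X\<close>; its term is the main term, the product of the means.\<close>
  define g0 where "g0 = (\<lambda>u\<in>{1..D}. 0 :: nat)"
  have g0: "g0 \<in> X" using p0 by (auto simp: X_def g0_def)
  define co where "co = (\<lambda>g. \<Prod>u\<in>{1..D}. dcoeff p (\<psi> u) (g u))"
  define W where "W = (\<lambda>g. \<Sum>j<p. ep p (\<Sum>u\<in>{1..D}. int (g u) * int j ^ u))"
  have ep_sum: "ep p (\<Sum>u\<in>A. f u) = (\<Prod>u\<in>A. ep p (f u))" for A and f :: "nat \<Rightarrow> int"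
    by (induction A rule: infinite_finite_induct) (auto simp: ep_add)
  have "(\<Prod>u\<in>{1..D}. \<psi> u (j ^ u mod p)) = (\<Sum>g\<in>X. co g * ep p (\<Sum>u\<in>{1..D}. int (g u) * int j ^ u))" for j
  proof -
    have "\<psi> u (j ^ u mod p) = (\<Sum>h<p. dcoeff p (\<psi> u) h * ep p (int h * int j ^ u))" for u
    proof -
      have "ep p (int h * int (j ^ u mod p)) = ep p (int h * int j ^ u)" for h
        by (intro ep_cong p0) (simp add: mod_eq_dvd_iff[symmetric] zmod_int mod_mult_right_eq)
      then show ?thesis
        using dcoeff_inversion[of "j ^ u mod p" p "\<psi> u"] p0 by simp
    qed
    then have "(\<Prod>u\<in>{1..D}. \<psi> u (j ^ u mod p)) = (\<Prod>u\<in>{1..D}. \<Sum>h<p. dcoeff p (\<psi> u) h * ep p (int h * int j ^ u))"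
      by simp
    also have "\<dots> = (\<Sum>g\<in>X. \<Prod>u\<in>{1..D}. dcoeff p (\<psi> u) (g u) * ep p (int (g u) * int j ^ u))"
      unfolding X_def by (rule prod_sum_PiE) auto
    finally show ?thesis by (simp add: prod.distrib ep_sum co_def)
  qed
  then have "(\<Sum>j<p. \<Prod>u\<in>{1..D}. \<psi> u (j ^ u mod p)) = (\<Sum>g\<in>X. co g * W g)"
    unfolding W_def sum_distrib_left by (simp add: sum.swap[of _ X])
  also have "\<dots> = co g0 * W g0 + (\<Sum>g\<in>X - {g0}. co g * W g)"
    using finX g0 by (rule sum.remove)
  also have "co g0 * W g0 = of_nat p * (\<Prod>u\<in>{1..D}. 1 / of_nat p * (\<Sum>y<p. \<psi> u y))"
    unfolding co_def W_def g0_def dcoeff_def by (simp add: mult.commute)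
  finally have "cmod ((\<Sum>j<p. \<Prod>u\<in>{1..D}. \<psi> u (j ^ u mod p))
      - of_nat p * (\<Prod>u\<in>{1..D}. 1 / of_nat p * (\<Sum>y<p. \<psi> u y))) = cmod (\<Sum>g\<in>X - {g0}. co g * W g)"
    by simp
  also have "\<dots> \<le> (\<Sum>g\<in>X - {g0}. cmod (co g * W g))" by (rule norm_sum)
  also have "\<dots> \<le> (\<Sum>g\<in>X - {g0}. cmod (co g) * (2 * real p powr (1 - 1 / 2 ^ (D - 1))))"
    unfolding norm_mult
  proof (intro sum_mono mult_left_mono)
    fix g assume g: "g \<in> X - {g0}"
    \<comment> \<open>The largest index with nonzero frequency is the degree of the phase, and its
      coefficient lies strictly between 0 and \<open>p\<close>. The saving shrinks with the degree,
      so \<open>D\<close> is the worst case.\<close>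
    define n where "n = Max {u \<in> {1..D}. g u \<noteq> 0}"
    have "\<exists>u\<in>{1..D}. g u \<noteq> 0"
    proof (rule ccontr)
      assume "\<not> (\<exists>u\<in>{1..D}. g u \<noteq> 0)"
      then have "g = g0" using g by (auto simp: X_def g0_def PiE_def extensional_def restrict_def)
      then show False using g by simp
    qed
    then have ne: "{u \<in> {1..D}. g u \<noteq> 0} \<noteq> {}" by blast
    have n: "n \<in> {1..D}" "g n \<noteq> 0" using Max_in[OF _ ne] by (auto simp: n_def)
    have gt: "g u = 0" if "u \<in> {1..D}" "u > n" for u
      using that Max_ge[of "{u \<in> {1..D}. g u \<noteq> 0}" u] by (fastforce simp: n_def)
    define Q where "Q = (\<Sum>u\<in>{1..D}. monom (int (g u)) u)"
    have coQ: "coeff Q k = (if k \<in> {1..D} then int (g k) else 0)" for k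
      by (simp add: Q_def coeff_sum if_distrib cong: if_cong)
    have "W g = (\<Sum>j<p. ep p (poly Q (int j)))"
      by (simp add: W_def Q_def poly_sum poly_monom)
    also have "cmod \<dots> \<le> 2 * real p powr (1 - 1 / 2 ^ (n - 1))"
    proof (rule weyl_sum_bound[OF p])
      show "degree Q \<le> n" using gt by (intro degree_le) (auto simp: coQ)
      have "g n < p" using g n by (auto simp: X_def PiE_def Pi_def)
      then show "\<not> int p dvd coeff Q n" using n by (auto simp: coQ dest: dvd_imp_le)
    qed (use n D in auto)
    also have "\<dots> \<le> 2 * real p powr (1 - 1 / 2 ^ (D - 1))"
    proof (intro mult_left_mono powr_mono diff_left_mono divide_left_mono power_increasing)
      show "n - 1 \<le> D - 1" using n by auto
    qed (use p0 in auto)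
    finally show "cmod (W g) \<le> 2 * real p powr (1 - 1 / 2 ^ (D - 1))" .
  qed auto
  also have "\<dots> = (\<Sum>g\<in>X - {g0}. cmod (co g)) * (2 * real p powr (1 - 1 / 2 ^ (D - 1)))"
    by (rule sum_distrib_right[symmetric])
  also have "\<dots> \<le> L ^ D * (2 * real p powr (1 - 1 / 2 ^ (D - 1)))"
  proof (rule mult_right_mono)
    have "(\<Sum>g\<in>X - {g0}. cmod (co g)) \<le> (\<Sum>g\<in>X. cmod (co g))"
      using finX by (intro sum_mono2) auto
    also have "\<dots> = (\<Prod>u\<in>{1..D}. \<Sum>h<p. cmod (dcoeff p (\<psi> u) h))"
      unfolding co_def prod_norm[symmetric] X_def by (rule prod_sum_PiE[symmetric]) auto
    also have "\<dots> \<le> (\<Prod>u\<in>{1..D}. L)"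
      by (intro prod_mono) (auto intro: L sum_nonneg)
    finally show "(\<Sum>g\<in>X - {g0}. cmod (co g)) \<le> L ^ D" by simp
  qed auto
  finally show ?thesis .
qed

text \<open>The digits of all coordinates are numbered consecutively by u = pos m * q + i, so that
  digit \<open>u\<close> is the residue of j^u; inside its coordinate it has place value P^(i -
  1).\<close>

definition digit_freq :: "('d::finite \<Rightarrow> nat) \<Rightarrow> nat \<Rightarrow> nat \<Rightarrow> real ^ 'd \<Rightarrow> nat \<Rightarrow> real" where
  "digit_freq pos q P \<theta> u = \<theta> $ (inv pos ((u - 1) div q)) * real P ^ ((u - 1) mod q)"

lemma prod_digits:
  fixes g :: "nat \<Rightarrow> 'b::comm_monoid_mult"
  assumes pos: "bij_betw pos (UNIV :: 'd::finite set) {..<d}" and q: "q \<ge> 1"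
  shows "(\<Prod>u\<in>{1..d * q}. g u) = (\<Prod>m\<in>UNIV. \<Prod>i\<in>{1..q}. g (pos m * q + i))"
proof -
  have range: "range pos = {..<d}" using pos by (simp add: bij_betw_def)
  have inj: "inj pos" using pos by (simp add: bij_betw_def)
  have "(\<Prod>u\<in>{1..d * q}. g u) = (\<Prod>x\<in>UNIV \<times> {1..q}. g (pos (fst x) * q + snd x))"
  proof (rule prod.reindex_bij_witness[of _ "\<lambda>x. pos (fst x) * q + snd x" "\<lambda>u. (inv pos ((u - 1) div q), (u - 1) mod q + 1)"])
    fix u assume u: "u \<in> {1..d * q}"
    then have "u - 1 < d * q" by auto
    then have "(u - 1) div q < d" by (rule less_mult_imp_div_less)
    then have "pos (inv pos ((u - 1) div q)) = (u - 1) div q"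
      using range by (intro f_inv_into_f) auto
    then show eq: "pos (fst (inv pos ((u - 1) div q), (u - 1) mod q + 1)) * q + snd (inv pos ((u - 1) div q), (u - 1) mod q + 1) = u"
      using u by (simp add: add.assoc[symmetric])
    then show "g (pos (fst (inv pos ((u - 1) div q), (u - 1) mod q + 1)) * q + snd (inv pos ((u - 1) div q), (u - 1) mod q + 1)) = g u"
      by (rule arg_cong)
    show "(inv pos ((u - 1) div q), (u - 1) mod q + 1) \<in> UNIV \<times> {1..q}"
      using q mod_less_divisor[of q "u - 1"] by (auto simp: Suc_le_eq)
  next
    fix x :: "'d \<times> nat" assume x: "x \<in> UNIV \<times> {1..q}"
    then obtain m i where mi: "x = (m, Suc i)" "i < q" by (cases x; cases "snd x") auto
    then have "(pos (fst x) * q + snd x - 1) div q = pos m" "(pos (fst x) * q + snd x - 1) mod q = i"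
      by simp_all
    then show "(inv pos ((pos (fst x) * q + snd x - 1) div q), (pos (fst x) * q + snd x - 1) mod q + 1) = x"
      using inj mi by simp
    have "pos m < d" using range by auto
    then have "(pos m + 1) * q \<le> d * q" by (intro mult_right_mono) auto
    then show "pos (fst x) * q + snd x \<in> {1..d * q}" using mi by simp
  qed
  then show ?thesis by (simp add: prod.cartesian_product case_prod_beta)
qed

lemma digit_freq_eq:
  assumes "inj pos" "i \<in> {1..q}"
  shows "digit_freq pos q P \<theta> (pos m * q + i) = \<theta> $ m * real P ^ (i - 1)"
proof -
  obtain i' where i: "i = Suc i'" "i' < q" using assms(2) by (cases i) auto
  then have "(pos m * q + i - 1) div q = pos m" "(pos m * q + i - 1) mod q = i'" by simp_all
  then show ?thesis using assms(1) i by (simp add: digit_freq_def)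
qed

lemma chr_xvec:
  fixes pos :: "'d::finite \<Rightarrow> nat"
  assumes pos: "bij_betw pos UNIV {..<d}" and q: "q \<ge> 1"
  shows "chr \<theta> (xvec pos q P j) = (\<Prod>u\<in>{1..d * q}. cis (digit_freq pos q P \<theta> u * real (j ^ u mod P)))"
proof -
  have cis_sum: "cis (\<Sum>i\<in>A. f i) = (\<Prod>i\<in>A. cis (f i))" for f :: "nat \<Rightarrow> real" and A
    by (induction A rule: infinite_finite_induct) (auto simp flip: cis_mult)
  have inj: "inj pos" using pos by (simp add: bij_betw_def)
  have "chr \<theta> (xvec pos q P j) = (\<Prod>m\<in>UNIV. cis (\<Sum>i=1..q. \<theta> $ m * real P ^ (i - 1) * real (j ^ (pos m * q + i) mod P)))"
    unfolding chr_eq_prod xvec_def by (simp add: sum_distrib_left mult.assoc)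
  also have "\<dots> = (\<Prod>m\<in>UNIV. \<Prod>i\<in>{1..q}. cis (digit_freq pos q P \<theta> (pos m * q + i) * real (j ^ (pos m * q + i) mod P)))"
    using inj by (simp add: cis_sum digit_freq_eq)
  finally show ?thesis by (simp only: prod_digits[OF pos q])
qed

text \<open>The mean, over the box of all digit vectors with first digit below \<open>r\<close>, of the character \<open>\<theta>\<close>,
  multiplied by \<open>r / P\<close>.\<close>

definition digit_mean :: "('d::finite \<Rightarrow> nat) \<Rightarrow> nat \<Rightarrow> nat \<Rightarrow> nat \<Rightarrow> nat \<Rightarrow> real ^ 'd \<Rightarrow> complex" where
  "digit_mean pos d q P r \<theta> =
    (\<Prod>u\<in>{1..d * q}. 1 / of_nat P * (\<Sum>y<if u = 1 then r else P. cis (digit_freq pos q P \<theta> u * real y)))"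

text \<open>The first summand arises from (5 + 4 ln P)^D times Weyl's factor 2, with ln P \<le> 2^D
  D P^(1 / (2^D D)) absorbing the logarithms into a power of \<open>P\<close>. The second covers the
  primes P \<le> D.\<close>

definition weyl_const :: "nat \<Rightarrow> real" where
  "weyl_const D = 2 * (5 + 4 * (2 ^ D * real D)) ^ D + 2 * real D"

lemma norm_digit_factor_le_1:
  assumes "P > 0" "r \<le> P"
  shows "cmod (1 / of_nat P * (\<Sum>y<if u = 1 then r else P. cis (t * real y))) \<le> 1"
proof -
  have "cmod (\<Sum>y<if u = 1 then r else P. cis (t * real y)) \<le> (\<Sum>y<if u = 1 then r else P. cmod (cis (t * real y)))"
    by (rule norm_sum)
  also have "\<dots> \<le> real P" using assms by simp
  finally show ?thesis using assms by (simp add: norm_divide divide_le_eq_1)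
qed

lemma norm_digit_mean_le_1:
  assumes "P > 0" "r \<le> P"
  shows "cmod (digit_mean pos d q P r \<theta>) \<le> 1"
  unfolding digit_mean_def prod_norm[symmetric]
  by (intro prod_le_1 conjI norm_ge_zero norm_digit_factor_le_1 assms)

text \<open>For j < P the first digit is \<open>j\<close> itself, so the partial sum over j < r is a
  complete sum modulo \<open>P\<close> in which only the function of the first digit is cut off.
  Sharp cut-offs cost just a logarithm in \<open>sum_dcoeff_le\<close>.\<close>

lemma block_equidistribution:
  fixes pos :: "'d::finite \<Rightarrow> nat"
  assumes P: "prime P" and r: "r \<le> P" and d: "d \<ge> 1" and q: "q \<ge> 1" and pos: "bij_betw pos UNIV {..<d}"
  shows "cmod ((\<Sum>j<r. chr \<theta> (xvec pos q P j)) - of_nat P * digit_mean pos d q P r \<theta>)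
    \<le> weyl_const (d * q) * real P powr (1 - 1 / 2 ^ (d * q))"
proof -
  define D where "D = d * q"
  have D: "D \<ge> 1" using d q by (simp add: D_def)
  have P0: "P > 0" using P by (simp add: prime_gt_0_nat)
  define \<delta> :: real where "\<delta> = 1 / 2 ^ D"
  have \<delta>: "\<delta> > 0" "\<delta> \<le> 1" by (auto simp: \<delta>_def)
  show ?thesis
  proof (cases "D < P")
    case False
    have "cmod (\<Sum>j<r. chr \<theta> (xvec pos q P j)) \<le> (\<Sum>j<r. cmod (chr \<theta> (xvec pos q P j)))" by (rule norm_sum)
    then have "cmod (\<Sum>j<r. chr \<theta> (xvec pos q P j)) \<le> real P" using r by simp
    moreover have "cmod (of_nat P * digit_mean pos d q P r \<theta>) \<le> real P"
      using norm_digit_mean_le_1[OF P0 r, of pos d q \<theta>] by (simp add: norm_mult mult_left_le)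
    ultimately have "cmod ((\<Sum>j<r. chr \<theta> (xvec pos q P j)) - of_nat P * digit_mean pos d q P r \<theta>) \<le> 2 * real P"
      using norm_triangle_ineq4[of "\<Sum>j<r. chr \<theta> (xvec pos q P j)" "of_nat P * digit_mean pos d q P r \<theta>"] by linarith
    \<comment> \<open>For P \<le> D, where differencing could lose its leading coefficient, the
      trivial bound 2P suffices, since P powr \<delta> \<le> D.\<close>
    also have "real P = real P powr \<delta> * real P powr (1 - \<delta>)"
      using P0 by (simp flip: powr_add)
    also have "2 * (real P powr \<delta> * real P powr (1 - \<delta>)) \<le> 2 * (real D * real P powr (1 - \<delta>))"
    proof (intro mult_left_mono mult_right_mono)
      have "real P powr \<delta> \<le> real P powr 1" using \<delta> P0 by (intro powr_mono) auto
      then show "real P powr \<delta> \<le> real D" using False P0 by simp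
    qed auto
    also have "\<dots> \<le> weyl_const D * real P powr (1 - \<delta>)"
      unfolding weyl_const_def by (simp add: distrib_right)
    finally show ?thesis by (simp add: D_def \<delta>_def)
  next
    case True
    define \<psi> where "\<psi> = (\<lambda>u y. if y < (if u = 1 then r else P) then cis (digit_freq pos q P \<theta> u * real y) else 0)"
    have "(\<Sum>j<r. chr \<theta> (xvec pos q P j)) = (\<Sum>j<P. \<Prod>u\<in>{1..D}. \<psi> u (j ^ u mod P))"
    proof (rule sum.mono_neutral_cong_left)
      show "\<forall>j\<in>{..<P} - {..<r}. (\<Prod>u\<in>{1..D}. \<psi> u (j ^ u mod P)) = 0"
      proof
        fix j assume "j \<in> {..<P} - {..<r}"
        then have "\<psi> 1 (j ^ 1 mod P) = 0" by (simp add: \<psi>_def)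
        then show "(\<Prod>u\<in>{1..D}. \<psi> u (j ^ u mod P)) = 0" using D by (intro prod_zero) (auto intro!: bexI[of _ 1])
      qed
      fix j assume j: "j \<in> {..<r}"
      have "cis (digit_freq pos q P \<theta> u * real (j ^ u mod P)) = \<psi> u (j ^ u mod P)" for u
        using j r P0 by (auto simp: \<psi>_def)
      then show "chr \<theta> (xvec pos q P j) = (\<Prod>u\<in>{1..D}. \<psi> u (j ^ u mod P))"
        using chr_xvec[OF pos q, of \<theta> P j] by (simp add: D_def)
    qed (use r in auto)
    moreover have "of_nat P * digit_mean pos d q P r \<theta> = of_nat P * (\<Prod>u\<in>{1..D}. 1 / of_nat P * (\<Sum>y<P. \<psi> u y))"
    proof -
      have "(\<Sum>y<P. \<psi> u y) = (\<Sum>y<if u = 1 then r else P. cis (digit_freq pos q P \<theta> u * real y))" for u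
        using r by (intro sum.mono_neutral_cong_right) (auto simp: \<psi>_def)
      then show ?thesis by (simp add: digit_mean_def D_def)
    qed
    ultimately have "cmod ((\<Sum>j<r. chr \<theta> (xvec pos q P j)) - of_nat P * digit_mean pos d q P r \<theta>)
        = cmod ((\<Sum>j<P. \<Prod>u\<in>{1..D}. \<psi> u (j ^ u mod P)) - of_nat P * (\<Prod>u\<in>{1..D}. 1 / of_nat P * (\<Sum>y<P. \<psi> u y)))"
      by (simp only:)
    also have "\<dots> \<le> (5 + 4 * ln (real P)) ^ D * (2 * real P powr (1 - 1 / 2 ^ (D - 1)))"
      unfolding \<psi>_def using r
      by (intro moment_curve_equidistribution P D True sum_dcoeff_le[OF P0]) auto
    also have "\<dots> \<le> ((5 + 4 * (2 ^ D * real D)) * real P powr (\<delta> / real D)) ^ D * (2 * real P powr (1 - 1 / 2 ^ (D - 1)))"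
    proof (intro mult_right_mono power_mono)
      \<comment> \<open>The exponent \<delta> / D is chosen so that the \<open>D\<close>-th power of
        the logarithm costs P powr \<delta>, half of the Weyl saving 2 \<delta>.\<close>
      have "ln (real P) \<le> real P powr (\<delta> / real D) / (\<delta> / real D)"
        using P0 D \<delta> by (intro ln_powr_bound) auto
      also have "\<dots> = 2 ^ D * real D * real P powr (\<delta> / real D)" by (simp add: \<delta>_def)
      finally have "ln (real P) \<le> 2 ^ D * real D * real P powr (\<delta> / real D)" .
      moreover have "1 \<le> real P powr (\<delta> / real D)" using P0 D \<delta> by (intro ge_one_powr_ge_zero) auto
      ultimately show "5 + 4 * ln (real P) \<le> (5 + 4 * (2 ^ D * real D)) * real P powr (\<delta> / real D)"
        by (simp add: distrib_right)
      show "0 \<le> 5 + 4 * ln (real P)" using P0 by (simp add: ln_ge_zero add_nonneg_nonneg)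
    qed auto
    also have "\<dots> = 2 * (5 + 4 * (2 ^ D * real D)) ^ D * (real P powr \<delta> * real P powr (1 - 1 / 2 ^ (D - 1)))"
      using P0 D by (simp add: power_mult_distrib powr_power)
    also have "real P powr \<delta> * real P powr (1 - 1 / 2 ^ (D - 1)) = real P powr (1 - \<delta>)"
    proof -
      have "1 / 2 ^ (D - 1) = 2 * \<delta>" using D by (cases D) (auto simp: \<delta>_def)
      then show ?thesis by (simp flip: powr_add)
    qed
    also have "2 * (5 + 4 * (2 ^ D * real D)) ^ D * real P powr (1 - \<delta>) \<le> weyl_const D * real P powr (1 - \<delta>)"
      unfolding weyl_const_def by (intro mult_right_mono) auto
    finally show ?thesis by (simp add: D_def \<delta>_def)
  qed
qed

lemma norm_sum_cis_le_inverse: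
  assumes "\<bar>t\<bar> \<le> pi" "t \<noteq> 0"
  shows "cmod (\<Sum>y<r. cis (t * real y)) \<le> 4 / \<bar>t\<bar>"
proof -
  have "(cis t - 1) * (\<Sum>y<r. cis (t * real y)) = (\<Sum>y<r. cis (t * real (Suc y)) - cis (t * real y))"
    by (simp only: sum_distrib_left left_diff_distrib cis_mult) (simp add: algebra_simps)
  also have "\<dots> = cis (t * real r) - 1" by (subst sum_lessThan_telescope) simp
  finally have "cmod (cis t - 1) * cmod (\<Sum>y<r. cis (t * real y)) = cmod (cis (t * real r) - 1)"
    by (simp only: norm_mult[symmetric])
  also have "\<dots> \<le> 2" using norm_triangle_ineq4[of "cis (t * real r)" 1] by simp
  finally have "cmod (cis t - 1) * cmod (\<Sum>y<r. cis (t * real y)) \<le> 2" .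
  moreover have "\<bar>t\<bar> / 2 * cmod (\<Sum>y<r. cis (t * real y)) \<le> cmod (cis t - 1) * cmod (\<Sum>y<r. cis (t * real y))"
    using assms by (intro mult_right_mono norm_cis_minus_1_ge norm_ge_zero)
  ultimately show ?thesis using assms(2) by (simp add: field_simps)
qed

text \<open>By base \<open>P\<close> expansion the product is the geometric sum of cis (t y) over 0
  \<le> y < P^q; multiplication by cis t - 1 collapses it digit by digit.\<close>

lemma norm_digit_product_le_inverse:
  assumes "\<bar>t\<bar> \<le> pi" "t \<noteq> 0"
  shows "cmod (\<Prod>i<q. \<Sum>y<P. cis (t * real P ^ i * real y)) \<le> 4 / \<bar>t\<bar>"
proof -
  have "(cis t - 1) * (\<Prod>i<q. \<Sum>y<P. cis (t * real P ^ i * real y)) = cis (t * real P ^ q) - 1"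
  proof (induction q)
    case (Suc q)
    have "(cis (t * real P ^ q) - 1) * (\<Sum>y<P. cis (t * real P ^ q * real y))
        = (\<Sum>y<P. cis (t * real P ^ q * real (Suc y)) - cis (t * real P ^ q * real y))"
      by (simp only: sum_distrib_left left_diff_distrib cis_mult) (simp add: algebra_simps)
    also have "\<dots> = cis (t * real P ^ q * real P) - 1" by (subst sum_lessThan_telescope) simp
    finally show ?case using Suc by (simp add: mult.assoc[symmetric]) (simp add: mult_ac)
  qed simp
  then have "cmod (cis t - 1) * cmod (\<Prod>i<q. \<Sum>y<P. cis (t * real P ^ i * real y)) = cmod (cis (t * real P ^ q) - 1)"
    by (simp only: norm_mult[symmetric])
  also have "\<dots> \<le> 2" using norm_triangle_ineq4[of "cis (t * real P ^ q)" 1] by simp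
  finally have "cmod (cis t - 1) * cmod (\<Prod>i<q. \<Sum>y<P. cis (t * real P ^ i * real y)) \<le> 2" .
  moreover have "\<bar>t\<bar> / 2 * cmod (\<Prod>i<q. \<Sum>y<P. cis (t * real P ^ i * real y))
      \<le> cmod (cis t - 1) * cmod (\<Prod>i<q. \<Sum>y<P. cis (t * real P ^ i * real y))"
    using assms by (intro mult_right_mono norm_cis_minus_1_ge norm_ge_zero)
  ultimately show ?thesis using assms(2) by (simp add: field_simps)
qed

lemma norm_sum_cis_le_card: "cmod (\<Sum>y<P. cis (t * real y)) \<le> real P"
  using norm_sum[of "\<lambda>y. cis (t * real y)" "{..<P}"] by simp

text \<open>When the first digit is cut off at \<open>r < P\<close>, the remaining digits resonate near the multiples of
  \<open>2 * pi / P\<close>, but there the sum over the first digit supplies the decay.\<close>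

lemma digit_mean_decay:
  fixes pos :: "'d::finite \<Rightarrow> nat"
  assumes P: "P > 0" and r: "r \<le> P" and q: "q \<ge> 1" and pos: "bij_betw pos UNIV {..<d}"
    and t: "\<bar>\<theta> $ m\<bar> \<le> pi" "\<theta> $ m \<noteq> 0"
  shows "cmod (digit_mean pos d q P r \<theta>) \<le> 4 / (real P ^ q * \<bar>\<theta> $ m\<bar>)
    \<or> r < P \<and> real P * \<bar>\<theta> $ m\<bar> > pi \<and> cmod (digit_mean pos d q P r \<theta>) \<le> 4 / (real P * \<bar>\<theta> $ m\<bar>)"
proof -
  define t where "t = \<theta> $ m"
  have inj: "inj pos" using pos by (simp add: bij_betw_def)
  obtain q' where q': "q = Suc q'" using q by (cases q) auto
  \<comment> \<open>Only the coordinate with \<open>pos m = 0\<close> contains the truncated digit;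
    in every other one all digit sums are complete.\<close>
  define r' where "r' = (if pos m = 0 then r else P)"
  have r': "r' \<le> P" "r' < P \<Longrightarrow> r < P" using r by (auto simp: r'_def split: if_splits)
  define Z where "Z = (\<Sum>y<r'. cis (t * real y)) * (\<Prod>i<q'. \<Sum>y<P. cis (t * real P * real P ^ i * real y))"
  define g where "g = (\<lambda>u. 1 / of_nat P * (\<Sum>y<if u = 1 then r else P. cis (digit_freq pos q P \<theta> u * real y)) :: complex)"
  have le: "cmod (digit_mean pos d q P r \<theta>) \<le> cmod Z / real P ^ q"
  proof -
    have g1: "cmod (g u) \<le> 1" for u unfolding g_def using P r by (rule norm_digit_factor_le_1)
    have "cmod (digit_mean pos d q P r \<theta>) = (\<Prod>m\<in>UNIV. cmod (\<Prod>i\<in>{1..q}. g (pos m * q + i)))"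
      unfolding digit_mean_def g_def[symmetric] prod_digits[OF pos q] by (simp add: prod_norm)
    also have "\<dots> = cmod (\<Prod>i\<in>{1..q}. g (pos m * q + i)) * (\<Prod>m\<in>UNIV - {m}. cmod (\<Prod>i\<in>{1..q}. g (pos m * q + i)))"
      by (rule prod.remove) auto
    also have "\<dots> \<le> cmod (\<Prod>i\<in>{1..q}. g (pos m * q + i)) * 1"
      using g1 unfolding prod_norm[symmetric] by (intro mult_left_mono prod_le_1 conjI prod_nonneg) auto
    also have "(\<Prod>i\<in>{1..q}. g (pos m * q + i)) = (\<Prod>i<q. g (pos m * q + Suc i))"
      by (rule prod.reindex_bij_witness[of _ Suc "\<lambda>i. i - 1"]) auto
    also have "\<dots> = (\<Prod>i<q. 1 / of_nat P * (\<Sum>y<if i = 0 then r' else P. cis (t * real P ^ i * real y)))"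
    proof (rule prod.cong[OF refl])
      fix i assume "i \<in> {..<q}"
      then have "digit_freq pos q P \<theta> (pos m * q + Suc i) = t * real P ^ i"
        using digit_freq_eq[OF inj, of "Suc i" q P \<theta> m] by (simp add: t_def)
      moreover have "(if pos m * q + Suc i = 1 then r else P) = (if i = 0 then r' else P)"
        using q by (auto simp: r'_def)
      ultimately show "g (pos m * q + Suc i) = 1 / of_nat P * (\<Sum>y<if i = 0 then r' else P. cis (t * real P ^ i * real y))"
        unfolding g_def by (simp only:)
    qed
    also have "\<dots> = Z / of_nat P ^ q"
      unfolding Z_def q' prod.lessThan_Suc_shift
      by (simp add: prod_dividef mult_ac)
    also have "cmod (Z / of_nat P ^ q) * 1 = cmod Z / real P ^ q"
      by (simp add: norm_divide norm_power)
    finally show ?thesis .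
  qed
  have t': "\<bar>t\<bar> \<le> pi" "t \<noteq> 0" using t by (auto simp: t_def)
  have t0: "\<bar>t\<bar> > 0" using t' by simp
  have Pq: "real P ^ q > 0" using P by simp
  consider "r' = P" | "r' < P" "real P * \<bar>t\<bar> \<le> pi" | "r' < P" "real P * \<bar>t\<bar> > pi"
    using r' by linarith
  then show ?thesis
  proof cases
    case 1
    have "Z = (\<Prod>i<q. \<Sum>y<P. cis (t * real P ^ i * real y))"
      unfolding Z_def q' prod.lessThan_Suc_shift 1 by (simp add: mult_ac)
    then have "cmod Z \<le> 4 / \<bar>t\<bar>" using norm_digit_product_le_inverse[OF t'] by simp
    then have "cmod Z / real P ^ q \<le> 4 / \<bar>t\<bar> / real P ^ q" using Pq by (intro divide_right_mono) auto
    then show ?thesis using le by (simp add: t_def mult.commute)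
  next
    case 2
    \<comment> \<open>The higher digits form a full geometric sum of frequency t P, which still lies
      in [-pi, pi]; bounding the first digit trivially by \<open>P\<close> loses nothing.\<close>
    have "cmod Z \<le> real P * (4 / \<bar>t * real P\<bar>)"
      unfolding Z_def norm_mult
    proof (intro mult_mono)
      show "cmod (\<Sum>y<r'. cis (t * real y)) \<le> real P"
        using norm_sum_cis_le_card[of t r'] r' by linarith
      show "cmod (\<Prod>i<q'. \<Sum>y<P. cis (t * real P * real P ^ i * real y)) \<le> 4 / \<bar>t * real P\<bar>"
        using 2 t' P by (intro norm_digit_product_le_inverse) (auto simp: abs_mult mult.commute)
    qed auto
    also have "\<dots> = 4 / \<bar>t\<bar>" using P by (simp add: abs_mult)
    finally have "cmod Z / real P ^ q \<le> 4 / \<bar>t\<bar> / real P ^ q" using Pq by (intro divide_right_mono) auto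
    then show ?thesis using le by (simp add: t_def mult.commute)
  next
    case 3
    \<comment> \<open>Here t P may come close to a multiple of 2 pi, so the higher digits are
      bounded trivially and the decay is taken from the first digit.\<close>
    have "cmod Z \<le> 4 / \<bar>t\<bar> * real P ^ q'"
      unfolding Z_def norm_mult
    proof (intro mult_mono norm_sum_cis_le_inverse t')
      have "cmod (\<Prod>i<q'. \<Sum>y<P. cis (t * real P * real P ^ i * real y)) \<le> (\<Prod>i<q'. real P)"
        unfolding prod_norm[symmetric] by (intro prod_mono conjI norm_sum_cis_le_card) auto
      then show "cmod (\<Prod>i<q'. \<Sum>y<P. cis (t * real P * real P ^ i * real y)) \<le> real P ^ q'" by simp
    qed auto
    then have "cmod Z / real P ^ q \<le> 4 / \<bar>t\<bar> * real P ^ q' / real P ^ q" using Pq by (intro divide_right_mono) auto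
    also have "\<dots> = 4 / (real P * \<bar>t\<bar>)" using P t0 by (simp add: q' field_simps)
    finally show ?thesis using le r' 3 by (auto simp: t_def)
  qed
qed

section \<open>The averages along the sequence\<close>

lemma xvec_nth_bounds:
  fixes m :: "'d::finite"
  assumes "P > 0"
  shows "0 \<le> xvec pos q P j $ m" "xvec pos q P j $ m \<le> int P ^ q"
proof -
  have "(\<Sum>i=1..q. P ^ (i - 1) * f i) + 1 \<le> P ^ q" if "\<And>i. f i < P" for f :: "nat \<Rightarrow> nat"
  proof (induction q)
    case (Suc q)
    have "f (Suc q) + 1 \<le> P" using that[of "Suc q"] by simp
    then have "P ^ q * (f (Suc q) + 1) \<le> P ^ q * P" by (rule mult_left_mono) simp
    then show ?case using Suc by (simp add: algebra_simps)
  qed simp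
  from this[of "\<lambda>i. j ^ (pos m * q + i) mod P"]
  have "(\<Sum>i=1..q. P ^ (i - 1) * (j ^ (pos m * q + i) mod P)) \<le> P ^ q" using assms by simp
  then show "xvec pos q P j $ m \<le> int P ^ q"
    unfolding xvec_def by (simp only: vec_lambda_beta of_nat_power[symmetric] of_nat_le_iff)
  show "0 \<le> xvec pos q P j $ m" by (simp add: xvec_def sum_nonneg)
qed

lemma component_le_enorm: "\<bar>real_of_int (v $ m)\<bar> \<le> enorm v"
  using component_le_norm_cart[of "\<chi> m. real_of_int (v $ m)" m] by (simp add: enorm_def)

text \<open>An initial segment of the dictionary order consists of complete blocks and a part of the
  last one. That part has \<open>Suc r'\<close> elements because \<open>e N\<close> itself is
  included and the second index starts at 0.\<close>

lemma dict_enum_prefix_sum: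
  fixes G :: "nat \<times> nat \<Rightarrow> 'b::comm_monoid_add"
  assumes e: "dict_enum p e" and N: "N \<ge> 1" and kr: "e N = (k, r')"
  shows "k \<ge> 1" "r' < p k"
    and "(\<Sum>i=1..N. G (e i)) = (\<Sum>l\<in>{1..<k}. \<Sum>y<p l. G (l, y)) + (\<Sum>y<Suc r'. G (k, y))"
proof -
  define P where "P = {(k, j). 1 \<le> k \<and> j < p k}"
  have bij: "bij_betw e {1..} P"
    and lex: "\<And>i i'. i \<ge> 1 \<Longrightarrow> i < i' \<Longrightarrow> (e i, e i') \<in> less_than <*lex*> less_than"
    using e by (auto simp: dict_enum_def P_def)
  have inj: "inj_on e {1..}" and img: "e ` {1..} = P" using bij by (auto simp: bij_betw_def)
  have "e N \<in> P" using img N by auto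
  then show k: "k \<ge> 1" and r': "r' < p k" using kr by (auto simp: P_def)
  define S where "S = (SIGMA l:{1..<k}. {..<p l}) \<union> {k} \<times> {..<Suc r'}"
  have "e ` {1..N} = S"
  proof (intro equalityI subsetI)
    fix x assume "x \<in> e ` {1..N}"
    then obtain i where i: "1 \<le> i" "i \<le> N" "x = e i" by auto
    obtain l y where ly: "x = (l, y)" by (cases x)
    have "(l, y) \<in> P" using img i ly by force
    moreover have "i = N \<or> (e i, e N) \<in> less_than <*lex*> less_than" using lex i by (cases "i = N") auto
    then have "(l, y) = (k, r') \<or> ((l, y), (k, r')) \<in> less_than <*lex*> less_than"
      using i ly kr by auto
    ultimately show "x \<in> S" unfolding ly S_def P_def by auto
  next
    fix x assume x: "x \<in> S"
    then have "x \<in> P" using k r' by (auto simp: S_def P_def)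
    then obtain i where i: "i \<ge> 1" "x = e i" using img by auto
    have "i \<le> N"
    proof (rule ccontr)
      assume "\<not> i \<le> N"
      then have "(e N, e i) \<in> less_than <*lex*> less_than" using N by (intro lex) auto
      then show False using x kr i by (cases x) (auto simp: S_def)
    qed
    then show "x \<in> e ` {1..N}" using i by auto
  qed
  moreover have "inj_on e {1..N}" by (rule inj_on_subset[OF inj]) auto
  ultimately have "(\<Sum>i=1..N. G (e i)) = (\<Sum>x\<in>S. G x)"
    by (metis sum.reindex_cong)
  also have "\<dots> = (\<Sum>x\<in>(SIGMA l:{1..<k}. {..<p l}). G x) + (\<Sum>x\<in>{k} \<times> {..<Suc r'}. G x)"
    unfolding S_def by (rule sum.union_disjoint) auto
  also have "(\<Sum>x\<in>(SIGMA l:{1..<k}. {..<p l}). G x) = (\<Sum>l\<in>{1..<k}. \<Sum>y<p l. G (l, y))"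
    by (subst sum.Sigma) (auto simp: case_prod_beta)
  also have "(\<Sum>x\<in>{k} \<times> {..<Suc r'}. G x) = (\<Sum>y<Suc r'. G (k, y))"
    by (rule sum.reindex_bij_witness[of _ "Pair k" snd]) auto
  finally show "(\<Sum>i=1..N. G (e i)) = (\<Sum>l\<in>{1..<k}. \<Sum>y<p l. G (l, y)) + (\<Sum>y<Suc r'. G (k, y))" .
qed

section \<open>The multipliers of the averages: size, decay and partial blocks\<close>

locale prime_blocks =
  fixes d q :: nat and c C :: real and p :: "nat \<Rightarrow> nat"
    and pos :: "'d::finite \<Rightarrow> nat" and a n :: "nat \<Rightarrow> int ^ 'd" and e :: "nat \<Rightarrow> nat \<times> nat"
  assumes d: "d \<ge> 1" and q: "q \<ge> 1" and c: "c > 1" and C: "C > 1"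
    and pos: "bij_betw pos UNIV {..<d}"
    and prime: "\<And>k. k \<ge> 1 \<Longrightarrow> prime (p k)"
    and growth: "\<And>k. k \<ge> 1 \<Longrightarrow> c * real (p k) \<le> real (p (k + 1)) \<and> real (p (k + 1)) < C * real (p k)"
    and norm_a: "\<And>k. k \<ge> 1 \<Longrightarrow> enorm (a k) \<le> C * real (p k) ^ q"
    and e: "dict_enum p e"
    and n: "\<And>i k j. i \<ge> 1 \<Longrightarrow> e i = (k, j) \<Longrightarrow> n i = a k + xvec pos q (p k) j"
begin

lemma p_pos: "k \<ge> 1 \<Longrightarrow> p k > 0"
  using prime by (simp add: prime_gt_0_nat)

lemma p_mono:
  assumes "1 \<le> l" "l \<le> k"
  shows "real (p l) \<le> real (p k)"
  using assms(2)
proof (induction k rule: dec_induct)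
  case (step k)
  then have "1 \<le> k" using assms by simp
  have "1 * real (p k) \<le> c * real (p k)" using c by (intro mult_right_mono) auto
  then show ?case using step.IH growth[OF \<open>1 \<le> k\<close>] by simp
qed simp

text \<open>Geometric growth of the primes lets the last block dominate any positive power, so
  errors with a power saving can be added over all blocks at no cost.\<close>

lemma sum_p_powr_le:
  assumes s: "s > 0" and k: "k \<ge> 1"
  shows "(\<Sum>l=1..k. real (p l) powr s) \<le> c powr s / (c powr s - 1) * real (p k) powr s"
proof -
  have "c powr s > c powr 0" using c s by (intro powr_less_mono) auto
  then have cs: "c powr s > 1" using c by simp
  obtain k' where k': "k = Suc k'" using k by (cases k) auto
  have "(\<Sum>l\<le>k'. real (p (Suc l)) powr s) \<le> c powr s / (c powr s - 1) * real (p (Suc k')) powr s"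
  proof (rule sum_geometric_growth_le[OF cs])
    fix i
    have "c powr s * real (p (Suc i)) powr s = (c * real (p (Suc i))) powr s"
      using c by (simp add: powr_mult)
    also have "\<dots> \<le> real (p (Suc (Suc i))) powr s"
      using growth[of "Suc i"] c s by (intro powr_mono2) auto
    finally show "c powr s * real (p (Suc i)) powr s \<le> real (p (Suc (Suc i))) powr s" .
  qed simp
  moreover have "(\<Sum>l=1..k. real (p l) powr s) = (\<Sum>l\<le>k'. real (p (Suc l)) powr s)"
    unfolding k' by (rule sum.reindex_bij_witness[of _ Suc "\<lambda>l. l - 1"]) auto
  ultimately show ?thesis by (simp add: k')
qed

text \<open>For k \<ge> 2 the preceding block is complete and p_k < C p_(k-1) \<le> C N; in the
  first block \<open>N\<close> may be 1, which accounts for the factor \<open>p 1\<close>.\<close>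

definition p_over_N :: real where
  "p_over_N = C * real (p 1)"

lemma p_over_N_ge_1: "p_over_N \<ge> 1"
  using C p_pos[of 1] mult_mono[of 1 C 1 "real (p 1)"] by (simp add: p_over_N_def)

lemma p_le_N:
  assumes k: "k \<ge> 1" and N: "real N = (\<Sum>l\<in>{1..<k}. real (p l)) + real r" and r: "r \<ge> 1"
  shows "real (p k) \<le> p_over_N * real N"
proof (cases "k = 1")
  case True
  then have "real N \<ge> 1" using N r by simp
  have "real (p 1) * (1 * 1) \<le> real (p 1) * (C * real N)"
    using C \<open>real N \<ge> 1\<close> by (intro mult_left_mono mult_mono) auto
  then show ?thesis using True by (simp add: p_over_N_def mult_ac)
next
  case False
  then obtain k' where k': "k = Suc k'" "k' \<ge> 1" using k by (cases k) auto
  have "real (p k') \<le> (\<Sum>l\<in>{1..<k}. real (p l))"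
    using k' by (intro member_le_sum) auto
  then have "real (p k') \<le> real N" using N by simp
  have "real (p k) \<le> C * real (p k')" using growth[OF k'(2)] k' by simp
  also have "\<dots> \<le> C * real N" using C \<open>real (p k') \<le> real N\<close> by (intro mult_left_mono) auto
  also have "\<dots> \<le> p_over_N * real N"
    using C p_pos[of 1] mult_left_mono[of 1 "real (p 1)" C] by (intro mult_right_mono) (auto simp: p_over_N_def)
  finally show ?thesis .
qed

definition mean :: "nat \<Rightarrow> real ^ 'd \<Rightarrow> complex" where
  "mean N \<theta> = 1 / of_nat N * (\<Sum>i=1..N. chr \<theta> (n i))"

lemma prefix:
  assumes "N \<ge> 1"
  obtains k r where "k \<ge> 1" "1 \<le> r" "r \<le> p k" "real N = (\<Sum>l\<in>{1..<k}. real (p l)) + real r"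
    "\<And>i. i \<in> {1..N} \<Longrightarrow> fst (e i) \<in> {1..k}"
    "\<And>\<theta>. (\<Sum>i=1..N. chr \<theta> (n i)) = (\<Sum>l\<in>{1..<k}. chr \<theta> (a l) * (\<Sum>y<p l. chr \<theta> (xvec pos q (p l) y)))
      + chr \<theta> (a k) * (\<Sum>y<r. chr \<theta> (xvec pos q (p k) y))"
proof -
  obtain k r' where kr: "e N = (k, r')" by fastforce
  note * = dict_enum_prefix_sum[OF e assms kr]
  have "k \<ge> 1" "1 \<le> Suc r'" "Suc r' \<le> p k" using *(1,2) by auto
  moreover have "real N = (\<Sum>l\<in>{1..<k}. real (p l)) + real (Suc r')"
    using *(3)[of "\<lambda>_. 1 :: real"] by simp
  moreover have "fst (e i) \<in> {1..k}" if i: "i \<in> {1..N}" for i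
  proof -
    have "bij_betw e {1..} {(k, j). 1 \<le> k \<and> j < p k}" using e by (simp only: dict_enum_def)
    from bij_betwE[OF this] have "e i \<in> {(k, j). 1 \<le> k \<and> j < p k}"
      by (rule bspec) (use i in simp)
    moreover have "i = N \<or> (e i, e N) \<in> less_than <*lex*> less_than"
      using e i by (cases "i = N") (auto simp: dict_enum_def)
    ultimately show ?thesis using kr by auto
  qed
  moreover have "(\<Sum>i=1..N. chr \<theta> (n i)) = (\<Sum>l\<in>{1..<k}. chr \<theta> (a l) * (\<Sum>y<p l. chr \<theta> (xvec pos q (p l) y)))
      + chr \<theta> (a k) * (\<Sum>y<Suc r'. chr \<theta> (xvec pos q (p k) y))" for \<theta>
  proof -
    have "(\<Sum>i=1..N. chr \<theta> (n i)) = (\<Sum>i=1..N. chr \<theta> (a (fst (e i)) + xvec pos q (p (fst (e i))) (snd (e i))))"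
      by (intro sum.cong refl arg_cong[of _ _ "chr \<theta>"] n) auto
    also have "\<dots> = (\<Sum>l\<in>{1..<k}. \<Sum>y<p l. chr \<theta> (a l + xvec pos q (p l) y)) + (\<Sum>y<Suc r'. chr \<theta> (a k + xvec pos q (p k) y))"
      using *(3)[of "\<lambda>x. chr \<theta> (a (fst x) + xvec pos q (p (fst x)) (snd x))"] by simp
    finally show ?thesis by (simp only: chr_add sum_distrib_left)
  qed
  ultimately show thesis by (rule that)
qed

text \<open>Every coordinate of the first \<open>N\<close> points is at most (C + 1) p_k^q in
  modulus, hence O(N^q), so each character value differs from 1 by O(N^q \<tau>).\<close>

lemma mean_near_1:
  assumes N: "N \<ge> 1" and \<tau>: "\<And>m. \<bar>\<theta> $ m\<bar> \<le> \<tau>"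
  shows "cmod (mean N \<theta> - 1) \<le> real CARD('d) * (C + 1) * p_over_N ^ q * (real N ^ q * \<tau>)"
proof -
  obtain k r where k: "k \<ge> 1" and r: "1 \<le> r" and NN: "real N = (\<Sum>l\<in>{1..<k}. real (p l)) + real r"
    and fste: "\<And>i. i \<in> {1..N} \<Longrightarrow> fst (e i) \<in> {1..k}"
    by (rule prefix[OF N]) blast
  have "\<tau> \<ge> 0" using \<tau> by (meson abs_ge_zero order_trans)
  define B where "B = real CARD('d) * (\<tau> * ((C + 1) * (p_over_N * real N) ^ q))"
  have "cmod (chr \<theta> (n i) - 1) \<le> B" if i: "i \<in> {1..N}" for i
  proof -
    obtain l y where ly: "e i = (l, y)" by fastforce
    have l: "1 \<le> l" "l \<le> k" using fste[OF i] ly by auto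
    have ni: "n i = a l + xvec pos q (p l) y" using n[of i l y] i ly by simp
    have "real (p l) \<le> p_over_N * real N" using p_mono[OF l] p_le_N[OF k NN r] by simp
    then have pl: "real (p l) ^ q \<le> (p_over_N * real N) ^ q" by (intro power_mono) auto
    have "\<bar>real_of_int (n i $ m)\<bar> \<le> (C + 1) * (p_over_N * real N) ^ q" for m
    proof -
      have x: "0 \<le> xvec pos q (p l) y $ m" "xvec pos q (p l) y $ m \<le> int (p l) ^ q"
        using xvec_nth_bounds[where P = "p l" and q = q and j = y and m = m and pos = pos] p_pos[OF l(1)] by auto
      then have "\<bar>real_of_int (xvec pos q (p l) y $ m)\<bar> \<le> real (p l) ^ q"
        by (metis abs_of_nonneg of_int_0_le_iff of_int_le_iff of_int_of_nat_eq of_int_power)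
      moreover have "\<bar>real_of_int (a l $ m)\<bar> \<le> C * real (p l) ^ q"
        using component_le_enorm[of "a l" m] norm_a[OF l(1)] by linarith
      ultimately have "\<bar>real_of_int (n i $ m)\<bar> \<le> (C + 1) * real (p l) ^ q"
        unfolding ni by (simp add: algebra_simps)
      also have "\<dots> \<le> (C + 1) * (p_over_N * real N) ^ q"
        using pl C by (intro mult_left_mono) auto
      finally show ?thesis .
    qed
    then have "(\<Sum>m\<in>UNIV. \<bar>\<theta> $ m\<bar> * \<bar>real_of_int (n i $ m)\<bar>) \<le> (\<Sum>m\<in>(UNIV :: 'd set). \<tau> * ((C + 1) * (p_over_N * real N) ^ q))"
      using \<tau> \<open>\<tau> \<ge> 0\<close> by (intro sum_mono mult_mono) auto
    then show ?thesis using norm_chr_minus_1_le[of \<theta> "n i"] by (simp add: B_def)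
  qed
  then have "cmod (\<Sum>i=1..N. chr \<theta> (n i) - 1) \<le> (\<Sum>i=1..N. B)"
    by (intro sum_norm_le) auto
  then have "cmod ((\<Sum>i=1..N. chr \<theta> (n i)) - of_nat N) \<le> real N * B"
    by (simp add: sum_subtractf)
  moreover have "mean N \<theta> - 1 = ((\<Sum>i=1..N. chr \<theta> (n i)) - of_nat N) / of_nat N"
    using N by (simp add: mean_def field_simps)
  ultimately have "cmod (mean N \<theta> - 1) \<le> real N * B / real N"
    by (simp only: norm_divide norm_of_nat) (intro divide_right_mono, auto)
  then have "cmod (mean N \<theta> - 1) \<le> B" using N by simp
  then show ?thesis by (simp add: B_def power_mult_distrib mult_ac)
qed

definition decay_exp :: real where "decay_exp = 1 / 2 ^ (d * q)"

lemma decay_exp: "0 < decay_exp" "decay_exp < 1"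
  using d q by (auto simp: decay_exp_def intro: one_less_power)

text \<open>With \<open>\<sigma>\<^sup>q\<close> the size of the frequency, \<open>min 1 (4 / (p\<^sub>l \<sigma>)\<^sup>q) \<le> 4 / sqrt (p\<^sub>l \<sigma>)\<close>; the weaker
  right-hand side makes the sum over the blocks \<open>l\<close> geometric.\<close>

lemma mean_decay:
  obtains K where "K \<ge> 0" "\<And>N \<theta> m \<sigma>. N \<ge> 1 \<Longrightarrow> \<bar>\<theta> $ m\<bar> \<le> pi \<Longrightarrow> \<sigma> > 0 \<Longrightarrow> \<bar>\<theta> $ m\<bar> = \<sigma> ^ q \<Longrightarrow>
    cmod (mean N \<theta>) \<le> K * (real N powr (- decay_exp) + 1 / sqrt (real N * \<sigma>)
      + min (real N * \<bar>\<theta> $ m\<bar>) (1 / (real N * \<bar>\<theta> $ m\<bar>)))"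
proof -
  define s where "s = 1 - decay_exp"
  have s: "s > 0" "s \<le> 1" using decay_exp by (auto simp: s_def)
  define G where "G = (\<lambda>s. c powr s / (c powr s - 1))"
  have G: "G t \<ge> 0" if "t > 0" for t
  proof -
    have "c powr t > c powr 0" using c that by (intro powr_less_mono) auto
    then show ?thesis using c by (simp add: G_def)
  qed
  define W where "W = weyl_const (d * q)"
  have W: "W \<ge> 0" by (simp add: W_def weyl_const_def)
  define c1 where "c1 = p_over_N"
  have c1: "c1 \<ge> 1" using p_over_N_ge_1 by (simp add: c1_def)
  define K where "K = W * G s * c1 + 4 * G (1 / 2) * c1 + 4 * c1\<^sup>2"
  have terms: "W * G s * c1 \<ge> 0" "4 * G (1 / 2) * c1 \<ge> 0" "4 * c1\<^sup>2 \<ge> 0"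
    using W G[OF s(1)] G[of "1 / 2"] c1 by auto
  then have K: "K \<ge> 0" by (simp add: K_def)
  show thesis
  proof (rule that[OF K])
    fix N :: nat and \<theta> :: "real ^ 'd" and m :: 'd and \<sigma> :: real
    assume N: "N \<ge> 1" and \<theta>: "\<bar>\<theta> $ m\<bar> \<le> pi" and \<sigma>: "\<sigma> > 0" "\<bar>\<theta> $ m\<bar> = \<sigma> ^ q"
    define \<tau> where "\<tau> = \<bar>\<theta> $ m\<bar>"
    have \<tau>: "\<tau> > 0" using \<sigma> by (simp add: \<tau>_def)
    then have nz: "\<theta> $ m \<noteq> 0" by (simp add: \<tau>_def)
    obtain k r where k: "k \<ge> 1" and r: "1 \<le> r" "r \<le> p k" and NN: "real N = (\<Sum>l\<in>{1..<k}. real (p l)) + real r"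
      and sum: "(\<Sum>i=1..N. chr \<theta> (n i)) = (\<Sum>l\<in>{1..<k}. chr \<theta> (a l) * (\<Sum>y<p l. chr \<theta> (xvec pos q (p l) y)))
      + chr \<theta> (a k) * (\<Sum>y<r. chr \<theta> (xvec pos q (p k) y))"
      by (rule prefix[OF N]) blast
    have pN: "real (p k) \<le> c1 * real N" unfolding c1_def by (rule p_le_N[OF k NN r(1)])
    have N0: "real N > 0" using N by simp
    \<comment> \<open>Treats complete and partial blocks alike; \<open>rr l < p l\<close> is
      possible only for l = k.\<close>
    define rr where "rr = (\<lambda>l. if l < k then p l else r)"
    have "{1..k} = insert k {1..<k}" using k by auto
    then have sum': "(\<Sum>i=1..N. chr \<theta> (n i)) = (\<Sum>l=1..k. chr \<theta> (a l) * (\<Sum>y<rr l. chr \<theta> (xvec pos q (p l) y)))"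
      unfolding sum by (simp add: rr_def)
    \<comment> \<open>The resonance of the partial block: its bound p_k * 4 / (p_k \<tau>), present
      only if p_k \<tau> > pi.\<close>
    define comb where "comb = (if real (p k) * \<tau> > pi then 4 / \<tau> else 0)"
    have one: "cmod (\<Sum>y<rr l. chr \<theta> (xvec pos q (p l) y))
        \<le> W * real (p l) powr s + 4 * real (p l) powr (1 / 2) / sqrt \<sigma> + (if l = k then comb else 0)"
      if l: "l \<in> {1..k}" for l
    proof -
      have pl: "p l > 0" "prime (p l)" using l p_pos prime by auto
      have rl: "rr l \<le> p l" using l r by (auto simp: rr_def)
      define \<beta> where "\<beta> = digit_mean pos d q (p l) (rr l) \<theta>"
      have "cmod ((\<Sum>y<rr l. chr \<theta> (xvec pos q (p l) y)) - of_nat (p l) * \<beta>) \<le> W * real (p l) powr s"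
        using block_equidistribution[OF pl(2) rl d q pos, of \<theta>] by (simp add: W_def \<beta>_def s_def decay_exp_def)
      moreover have "cmod (of_nat (p l) * \<beta>) \<le> 4 * real (p l) powr (1 / 2) / sqrt \<sigma> + (if l = k then comb else 0)"
      proof -
        have comb0: "comb \<ge> 0" using \<tau> by (simp add: comb_def)
        define y where "y = real (p l) * \<sigma>"
        have y: "y > 0" using pl \<sigma> by (simp add: y_def)
        have eq: "4 * real (p l) powr (1 / 2) / sqrt \<sigma> = real (p l) * (4 / sqrt y)"
          using pl \<sigma> by (simp add: y_def powr_half_sqrt real_sqrt_mult field_simps)
        have \<beta>1: "cmod \<beta> \<le> 1" unfolding \<beta>_def by (rule norm_digit_mean_le_1[OF pl(1) rl])
        consider "cmod \<beta> \<le> 4 / y ^ q" | "rr l < p l" "real (p l) * \<tau> > pi" "cmod \<beta> \<le> 4 / (real (p l) * \<tau>)"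
          using digit_mean_decay[OF pl(1) rl q pos \<theta> nz]
          by (auto simp: \<beta>_def y_def \<sigma>(2) power_mult_distrib \<tau>_def)
        then show ?thesis
        proof cases
          case 1
          have "cmod \<beta> \<le> 4 / sqrt y"
          proof (cases "y \<le> 1")
            case True
            then have "4 / sqrt y \<ge> 1" using y by (simp add: le_divide_eq real_sqrt_le_1_iff order_trans[of "sqrt y" 1 4])
            then show ?thesis using \<beta>1 by linarith
          next
            case False
            have "sqrt y \<le> y ^ q"
            proof -
              have "sqrt y \<le> y" using False real_sqrt_le_mono[of y "y * y"] y by (simp add: mult_le_cancel_left1)
              also have "y \<le> y ^ q" using False q self_le_power[of y q] by simp
              finally show ?thesis .
            qed
            then have "4 / y ^ q \<le> 4 / sqrt y" using y by (intro divide_left_mono) auto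
            then show ?thesis using 1 by linarith
          qed
          then have "cmod (of_nat (p l) * \<beta>) \<le> real (p l) * (4 / sqrt y)"
            by (simp only: norm_mult norm_of_nat) (intro mult_left_mono, auto)
          then show ?thesis using comb0 unfolding eq by auto
        next
          case 2
          then have "l = k" using l by (auto simp: rr_def split: if_splits)
          have "cmod (of_nat (p l) * \<beta>) \<le> real (p l) * (4 / (real (p l) * \<tau>))"
            using 2 by (simp only: norm_mult norm_of_nat) (intro mult_left_mono, auto)
          also have "\<dots> = comb" using 2 pl \<open>l = k\<close> by (simp add: comb_def)
          finally show ?thesis using \<open>l = k\<close> \<sigma> by (simp add: add_increasing)
        qed
      qed
      ultimately show ?thesis
        using norm_triangle_sub[of "\<Sum>y<rr l. chr \<theta> (xvec pos q (p l) y)" "of_nat (p l) * \<beta>"] by linarith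
    qed
    have "cmod (\<Sum>i=1..N. chr \<theta> (n i)) \<le> (\<Sum>l=1..k. cmod (chr \<theta> (a l) * (\<Sum>y<rr l. chr \<theta> (xvec pos q (p l) y))))"
      unfolding sum' by (rule norm_sum)
    also have "\<dots> \<le> (\<Sum>l=1..k. W * real (p l) powr s + 4 * real (p l) powr (1 / 2) / sqrt \<sigma> + (if l = k then comb else 0))"
      unfolding norm_mult norm_chr mult_1 by (intro sum_mono one)
    also have "\<dots> = W * (\<Sum>l=1..k. real (p l) powr s) + 4 / sqrt \<sigma> * (\<Sum>l=1..k. real (p l) powr (1 / 2)) + comb"
      using k by (simp add: sum.distrib sum_distrib_left sum_divide_distrib)
    also have "\<dots> \<le> W * (G s * real (p k) powr s) + 4 / sqrt \<sigma> * (G (1 / 2) * real (p k) powr (1 / 2)) + comb"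
      unfolding G_def using W \<sigma> s k by (intro add_mono mult_left_mono sum_p_powr_le) auto
    also have "\<dots> \<le> W * (G s * (c1 * real N powr s)) + 4 / sqrt \<sigma> * (G (1 / 2) * (c1 * sqrt (real N))) + comb"
    proof (intro add_mono mult_left_mono order_refl)
      have p0: "real (p k) \<ge> 0" by simp
      have "real (p k) powr t \<le> c1 * real N powr t" if "0 < t" "t \<le> 1" for t
      proof -
        have "real (p k) powr t \<le> (c1 * real N) powr t" using pN that by (intro powr_mono2) auto
        also have "\<dots> = c1 powr t * real N powr t" using c1 by (simp add: powr_mult)
        also have "\<dots> \<le> c1 powr 1 * real N powr t" using c1 that by (intro mult_right_mono powr_mono) auto
        finally show ?thesis using c1 by simp
      qed
      from this[of s] this[of "1 / 2"] s
      show "real (p k) powr s \<le> c1 * real N powr s" "real (p k) powr (1 / 2) \<le> c1 * sqrt (real N)"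
        by (auto simp: powr_half_sqrt)
    qed (use W G s \<sigma> in auto)
    finally have "cmod (\<Sum>i=1..N. chr \<theta> (n i)) \<le> W * (G s * (c1 * real N powr s)) + 4 / sqrt \<sigma> * (G (1 / 2) * (c1 * sqrt (real N))) + comb" .
    then have "cmod (mean N \<theta>) \<le> (W * (G s * (c1 * real N powr s)) + 4 / sqrt \<sigma> * (G (1 / 2) * (c1 * sqrt (real N))) + comb) / real N"
      by (simp add: mean_def norm_divide divide_right_mono)
    also have "\<dots> = W * G s * c1 * (real N powr s / real N) + 4 * G (1 / 2) * c1 * (sqrt (real N) / (real N * sqrt \<sigma>)) + comb / real N"
      by (simp add: add_divide_distrib mult_ac)
    also have "real N powr s / real N = real N powr (- decay_exp)"
      using N0 by (simp add: s_def powr_diff powr_minus field_simps)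
    also have "sqrt (real N) / (real N * sqrt \<sigma>) = 1 / sqrt (real N * \<sigma>)"
      using N0 \<sigma> by (simp add: real_sqrt_mult field_simps flip: power2_eq_square)
    \<comment> \<open>Since p_k \<le> c1 N, resonance forces w = N \<tau> \<ge> 1 / c1. Hence 1 / w
      is at most c1^2 min w (1 / w), a form that is summable over lacunary \<open>N\<close>
      uniformly in \<tau>.\<close>
    also have "comb / real N \<le> 4 * c1\<^sup>2 * min (real N * \<tau>) (1 / (real N * \<tau>))"
    proof (cases "real (p k) * \<tau> > pi")
      case True
      define w where "w = real N * \<tau>"
      have w: "w > 0" using N0 \<tau> by (simp add: w_def)
      have "1 \<le> real (p k) * \<tau>" using True pi_gt3 by linarith
      also have "\<dots> \<le> c1 * real N * \<tau>" using pN \<tau> by (intro mult_right_mono) auto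
      finally have cw: "1 \<le> c1 * w" by (simp add: w_def mult.assoc)
      have "1 / w \<le> c1\<^sup>2 * min w (1 / w)"
      proof (cases "w \<le> 1 / w")
        case True
        have "1 * 1 \<le> (c1 * w) * (c1 * w)" using cw by (intro mult_mono) auto
        then show ?thesis using True w by (simp add: power2_eq_square field_simps)
      next
        case False
        have "1 \<le> c1\<^sup>2" using c1 by simp
        then have "1 * (1 / w) \<le> c1\<^sup>2 * (1 / w)" using w by (intro mult_right_mono) auto
        then show ?thesis using False by (simp add: min_def)
      qed
      moreover have "comb / real N = 4 * (1 / w)" using True by (simp add: comb_def w_def)
      ultimately show ?thesis by (simp add: w_def)
    next
      case False
      then show ?thesis using N0 \<tau> by (simp add: comb_def)
    qed
    finally have main: "cmod (mean N \<theta>) \<le> W * G s * c1 * real N powr (- decay_exp) + 4 * G (1 / 2) * c1 * (1 / sqrt (real N * \<sigma>))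
        + 4 * c1\<^sup>2 * min (real N * \<tau>) (1 / (real N * \<tau>))" by simp
    also have "\<dots> \<le> K * real N powr (- decay_exp) + K * (1 / sqrt (real N * \<sigma>)) + K * min (real N * \<tau>) (1 / (real N * \<tau>))"
      using terms \<tau> \<sigma> by (intro add_mono mult_right_mono) (auto simp: K_def)
    finally show "cmod (mean N \<theta>) \<le> K * (real N powr (- decay_exp) + 1 / sqrt (real N * \<sigma>)
      + min (real N * \<bar>\<theta> $ m\<bar>) (1 / (real N * \<bar>\<theta> $ m\<bar>)))"
      by (simp add: \<tau>_def distrib_left)
  qed
qed

end

section \<open>Square function comparison of the averages with cubes\<close>

context prime_blocks
begin

text \<open>Multiplication by a single at \<open>w\<close> evaluates at v - w, whereas the average
  evaluates at v + n_i; hence the minus sign, which reappears as \<open>- \<theta>\<close> in the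
  multiplier and is harmless since all bounds depend on absolute values.\<close>

definition avg_kernel :: "nat \<Rightarrow> int ^ 'd \<Rightarrow>\<^sub>0 complex" where
  "avg_kernel N = (\<Sum>i=1..N. Poly_Mapping.single (- n i) (1 / of_nat N))"

lemma lookup_avg_kernel_mult: "lookup (avg_kernel N * F) v = avg n N (lookup F) v"
  unfolding avg_kernel_def lookup_sum_single_mult avg_def by (simp add: sum_distrib_left)

lemma fourier_avg_kernel: "fourier \<theta> (avg_kernel N) = mean N (- \<theta>)"
  by (simp add: avg_kernel_def fourier_sum mean_def chr_def sum_distrib_left sum_negf)

text \<open>The natural scale is z = N \<tau>^(1/q), as z^q = N^q \<tau>. For z \<le> 1 both
  multipliers are within O(z) of 1; for z > 1 both decay, at worst like 1 / sqrt z, whose square is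
  1 / z. The other two terms are the Weyl error and the resonances of the partial block, which live
  at the scale N \<tau>.\<close>

lemma avg_minus_cube_bound:
  obtains K where "K \<ge> 0" "\<And>N \<theta> m. N \<ge> 1 \<Longrightarrow> (\<And>m'. \<bar>\<theta> $ m'\<bar> \<le> \<bar>\<theta> $ m\<bar>) \<Longrightarrow> \<bar>\<theta> $ m\<bar> \<le> pi \<Longrightarrow> \<theta> $ m \<noteq> 0 \<Longrightarrow>
    (cmod (fourier \<theta> (avg_kernel N - cube (N ^ q))))\<^sup>2 \<le> K * (real N powr (- 2 * decay_exp)
      + min (real N * root q \<bar>\<theta> $ m\<bar>) (1 / (real N * root q \<bar>\<theta> $ m\<bar>))
      + min (real N * \<bar>\<theta> $ m\<bar>) (1 / (real N * \<bar>\<theta> $ m\<bar>)))"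
proof -
  obtain K where K0: "K \<ge> 0" and K: "\<And>N \<theta> m \<sigma>. N \<ge> 1 \<Longrightarrow> \<bar>\<theta> $ m\<bar> \<le> pi \<Longrightarrow> \<sigma> > 0 \<Longrightarrow> \<bar>\<theta> $ m\<bar> = \<sigma> ^ q \<Longrightarrow>
    cmod (mean N \<theta>) \<le> K * (real N powr (- decay_exp) + 1 / sqrt (real N * \<sigma>)
      + min (real N * \<bar>\<theta> $ m\<bar>) (1 / (real N * \<bar>\<theta> $ m\<bar>)))"
    using mean_decay by metis
  define K1 where "K1 = real CARD('d) * (C + 1) * p_over_N ^ q + real CARD('d)"
  have K1: "K1 \<ge> 0" using C p_over_N_ge_1 by (simp add: K1_def)
  define K2 where "K2 = K1\<^sup>2 + 3 * (K + 2)\<^sup>2"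
  show thesis
  proof (rule that[of K2])
    show "K2 \<ge> 0" by (simp add: K2_def)
    fix N :: nat and \<theta> :: "real ^ 'd" and m
    assume N: "N \<ge> 1" and max: "\<And>m'. \<bar>\<theta> $ m'\<bar> \<le> \<bar>\<theta> $ m\<bar>" and le_pi: "\<bar>\<theta> $ m\<bar> \<le> pi" and nz: "\<theta> $ m \<noteq> 0"
    define \<tau> where "\<tau> = \<bar>\<theta> $ m\<bar>"
    define \<sigma> where "\<sigma> = root q \<tau>"
    have \<tau>: "\<tau> > 0" using nz by (simp add: \<tau>_def)
    have \<sigma>: "\<sigma> > 0" "\<sigma> ^ q = \<tau>" using \<tau> q by (auto simp: \<sigma>_def real_root_gt_zero)
    define z where "z = real N * \<sigma>"
    have z: "z > 0" "z ^ q = real (N ^ q) * \<tau>" using N \<sigma> by (auto simp: z_def power_mult_distrib)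
    define w where "w = real N * \<tau>"
    have w: "w > 0" using N \<tau> by (simp add: w_def)
    define A where "A = real N powr (- decay_exp)"
    have A: "A \<ge> 0" "A\<^sup>2 = real N powr (- 2 * decay_exp)"
      by (simp_all add: A_def power2_eq_square flip: powr_add)
    define \<mu> where "\<mu> = mean N (- \<theta>)"
    define \<rho> where "\<rho> = fourier \<theta> (cube (N ^ q) :: int ^ 'd \<Rightarrow>\<^sub>0 complex)"
    have "(cmod (\<mu> - \<rho>))\<^sup>2 \<le> K2 * (A\<^sup>2 + min z (1 / z) + min w (1 / w))"
    proof (cases "z \<le> 1")
      case True
      have "cmod (\<mu> - \<rho>) \<le> cmod (\<mu> - 1) + cmod (1 - \<rho>)"
        using norm_triangle_ineq[of "\<mu> - 1" "1 - \<rho>"] by simp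
      also have "cmod (\<mu> - 1) \<le> real CARD('d) * (C + 1) * p_over_N ^ q * (real N ^ q * \<tau>)"
        unfolding \<mu>_def using max by (intro mean_near_1 N) (simp add: \<tau>_def)
      also have "cmod (1 - \<rho>) \<le> real CARD('d) * (real (N ^ q) * \<tau>)"
        unfolding \<rho>_def using max by (intro norm_1_minus_fourier_cube_le) (simp add: \<tau>_def)
      finally have "cmod (\<mu> - \<rho>) \<le> K1 * z ^ q"
        using z by (simp add: K1_def distrib_right)
      also have "\<dots> \<le> K1 * z"
        using K1 True z q power_decreasing[of 1 q z] by (intro mult_left_mono) auto
      finally have "(cmod (\<mu> - \<rho>))\<^sup>2 \<le> (K1 * z)\<^sup>2" by (intro power_mono) auto
      also have "\<dots> = K1\<^sup>2 * (z * z)" by (simp add: power2_eq_square)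
      also have "\<dots> \<le> K2 * (A\<^sup>2 + min z (1 / z) + min w (1 / w))"
      proof (rule mult_mono)
        have zz: "z * z \<le> z" using True z by (simp add: mult_left_le)
        then have "z * z \<le> 1" using True by linarith
        then have "z \<le> 1 / z" using z by (simp add: le_divide_eq)
        then have "min z (1 / z) = z" by simp
        moreover have "min w (1 / w) \<ge> 0" using w by simp
        ultimately show "z * z \<le> A\<^sup>2 + min z (1 / z) + min w (1 / w)"
          using zz zero_le_power2[of A] by linarith
      qed (use z in \<open>auto simp: K2_def\<close>)
      finally show ?thesis .
    next
      case False
      then have z1: "z > 1" by simp
      define g where "g = min w (1 / w)"
      have g: "0 \<le> g" "g \<le> 1" using w by (cases "w \<le> 1"; simp add: g_def min_le_iff_disj)+
      have sz: "sqrt z > 0" using z by simp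
      have "cmod (\<mu> - \<rho>) \<le> cmod \<mu> + cmod \<rho>" by (rule norm_triangle_ineq4)
      also have "cmod \<mu> \<le> K * (A + 1 / sqrt z + g)"
        using K[OF N, of "- \<theta>" m \<sigma>] le_pi \<sigma> by (simp add: \<mu>_def A_def z_def g_def w_def \<tau>_def)
      also have "cmod \<rho> \<le> 2 * (1 / sqrt z)"
      proof -
        have "cmod \<rho> * (real (N ^ q) * \<tau>) \<le> 2"
          unfolding \<rho>_def \<tau>_def by (rule norm_fourier_cube_decay[OF le_pi])
        then have "cmod \<rho> * z ^ q \<le> 2" using z by simp
        moreover have "sqrt z \<le> z ^ q"
        proof -
          have "sqrt z \<le> z" using z1 real_sqrt_le_mono[of z "z * z"] by (simp add: mult_le_cancel_left1)
          also have "z \<le> z ^ q" using z1 q self_le_power[of z q] by simp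
          finally show ?thesis .
        qed
        then have "cmod \<rho> * sqrt z \<le> cmod \<rho> * z ^ q" by (intro mult_left_mono) auto
        ultimately have "cmod \<rho> * sqrt z \<le> 2" by linarith
        then show ?thesis using sz by (simp add: field_simps)
      qed
      finally have "cmod (\<mu> - \<rho>) \<le> K * (A + 1 / sqrt z + g) + 2 * (1 / sqrt z)" by simp
      also have "\<dots> \<le> (K + 2) * (A + 1 / sqrt z + g)"
        using A g sz by (simp add: algebra_simps)
      finally have "(cmod (\<mu> - \<rho>))\<^sup>2 \<le> ((K + 2) * (A + 1 / sqrt z + g))\<^sup>2" by (intro power_mono) auto
      also have "\<dots> = (K + 2)\<^sup>2 * (A + 1 / sqrt z + g)\<^sup>2" by (rule power_mult_distrib)
      also have "\<dots> \<le> (K + 2)\<^sup>2 * (3 * (A\<^sup>2 + (1 / sqrt z)\<^sup>2 + g\<^sup>2))"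
        by (intro mult_left_mono sum_squares_3_le) auto
      also have "\<dots> = 3 * (K + 2)\<^sup>2 * (A\<^sup>2 + 1 / z + g\<^sup>2)"
        using z by (simp add: power_divide)
      also have "\<dots> \<le> K2 * (A\<^sup>2 + min z (1 / z) + g)"
      proof (rule mult_mono)
        have "1 / z \<le> z" using z1 mult_mono[of 1 z 1 z] by (simp add: field_simps)
        moreover have "g\<^sup>2 \<le> g" using g by (simp add: power2_eq_square mult_left_le)
        ultimately show "A\<^sup>2 + 1 / z + g\<^sup>2 \<le> A\<^sup>2 + min z (1 / z) + g" by (simp add: min_def)
      qed (use z in \<open>auto simp: K2_def\<close>)
      finally show ?thesis by (simp add: g_def)
    qed
    then show "(cmod (fourier \<theta> (avg_kernel N - cube (N ^ q))))\<^sup>2 \<le> K2 * (real N powr (- 2 * decay_exp)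
      + min (real N * root q \<bar>\<theta> $ m\<bar>) (1 / (real N * root q \<bar>\<theta> $ m\<bar>))
      + min (real N * \<bar>\<theta> $ m\<bar>) (1 / (real N * \<bar>\<theta> $ m\<bar>)))"
      unfolding fourier_diff fourier_avg_kernel A(2)
      by (simp add: \<mu>_def \<rho>_def z_def w_def \<sigma>_def \<tau>_def)
  qed
qed

text \<open>For a fixed frequency both scales N \<tau>^(1/q) and N \<tau> grow at least by the
  factor \<open>L\<close> along the sequence, so all three terms sum geometrically, uniformly in the
  frequency. At frequency 0 both multipliers are exactly 1.\<close>

lemma avg_minus_cube_square_summable:
  assumes L: "L > 1" and Ns: "\<And>j. Ns j \<ge> 1" "\<And>j. L * real (Ns j) \<le> real (Ns (Suc j))"
  obtains B where "\<And>M \<theta>. (\<And>m. \<bar>\<theta> $ m\<bar> \<le> pi) \<Longrightarrow>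
    (\<Sum>j\<le>M. (cmod (fourier \<theta> (avg_kernel (Ns j) - cube (Ns j ^ q))))\<^sup>2) \<le> B"
proof -
  obtain K where K0: "K \<ge> 0" and K: "\<And>N \<theta> m. N \<ge> 1 \<Longrightarrow> (\<And>m'. \<bar>\<theta> $ m'\<bar> \<le> \<bar>\<theta> $ m\<bar>) \<Longrightarrow> \<bar>\<theta> $ m\<bar> \<le> pi \<Longrightarrow> \<theta> $ m \<noteq> 0 \<Longrightarrow>
    (cmod (fourier \<theta> (avg_kernel N - cube (N ^ q))))\<^sup>2 \<le> K * (real N powr (- 2 * decay_exp)
      + min (real N * root q \<bar>\<theta> $ m\<bar>) (1 / (real N * root q \<bar>\<theta> $ m\<bar>))
      + min (real N * \<bar>\<theta> $ m\<bar>) (1 / (real N * \<bar>\<theta> $ m\<bar>)))"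
    by (rule avg_minus_cube_bound) blast
  define s where "s = 2 * decay_exp"
  have s: "s > 0" using decay_exp by (simp add: s_def)
  define L' where "L' = L powr s"
  have "L powr s > L powr 0" using L s by (intro powr_less_mono) auto
  then have L': "L' > 1" using L by (simp add: L'_def)
  define B where "B = K * (L' / (L' - 1) + 2 * (L / (L - 1)) + 2 * (L / (L - 1)))"
  have B: "B \<ge> 0" using K0 L L' by (simp add: B_def)
  have N0: "real (Ns j) > 0" for j using Ns(1)[of j] by simp
  show thesis
  proof (rule that[of B])
    fix M and \<theta> :: "real ^ 'd" assume \<theta>: "\<And>m. \<bar>\<theta> $ m\<bar> \<le> pi"
    obtain m where m: "\<And>m'. \<bar>\<theta> $ m'\<bar> \<le> \<bar>\<theta> $ m\<bar>" using max_coordinate[of \<theta>] by blast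
    show "(\<Sum>j\<le>M. (cmod (fourier \<theta> (avg_kernel (Ns j) - cube (Ns j ^ q))))\<^sup>2) \<le> B"
    proof (cases "\<theta> $ m = 0")
      case True
      then have z: "\<theta> $ m' = 0" for m' using m[of m'] by simp
      have "mean (Ns j) (- \<theta>) = 1" for j
        using mean_near_1[OF Ns(1)[of j], of "- \<theta>" 0] z by simp
      then show ?thesis using B z by (simp add: fourier_diff fourier_avg_kernel fourier_cube_zero_frequency)
    next
      case False
      define \<tau> where "\<tau> = \<bar>\<theta> $ m\<bar>"
      have \<tau>: "\<tau> > 0" "root q \<tau> > 0" using False q by (auto simp: \<tau>_def real_root_gt_zero)
      have min_sum: "(\<Sum>j\<le>M. min (real (Ns j) * x) (1 / (real (Ns j) * x))) \<le> 2 * (L / (L - 1))" if "x > 0" for x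
        unfolding lessThan_Suc_atMost[symmetric]
      proof (rule sum_min_inverse_le[OF L])
        fix j
        show "real (Ns j) * x > 0" using N0 that by simp
        show "L * (real (Ns j) * x) \<le> real (Ns (Suc j)) * x"
          using mult_right_mono[OF Ns(2)[of j], of x] that by (simp add: mult_ac)
      qed
      have pow_sum: "(\<Sum>j\<le>M. real (Ns j) powr (- s)) \<le> L' / (L' - 1)"
      proof -
        have "(\<Sum>j<Suc M. real (Ns j) powr (- s)) \<le> L' / (L' - 1) * real (Ns 0) powr (- s)"
        proof (rule sum_geometric_decay_le[OF L'])
          fix j
          have "L' * real (Ns j) powr s = (L * real (Ns j)) powr s"
            using L by (simp add: L'_def powr_mult)
          also have "\<dots> \<le> real (Ns (Suc j)) powr s" using Ns(2)[of j] L s by (intro powr_mono2) auto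
          finally show "L' * real (Ns (Suc j)) powr (- s) \<le> real (Ns j) powr (- s)"
            using N0[of j] N0[of "Suc j"] by (simp add: powr_minus field_simps)
        qed simp
        also have "\<dots> \<le> L' / (L' - 1) * 1"
          using Ns(1)[of 0] s powr_mono[of "- s" 0 "real (Ns 0)"] L' by (intro mult_left_mono) auto
        finally show ?thesis by (simp add: lessThan_Suc_atMost)
      qed
      have "(\<Sum>j\<le>M. (cmod (fourier \<theta> (avg_kernel (Ns j) - cube (Ns j ^ q))))\<^sup>2)
          \<le> (\<Sum>j\<le>M. K * (real (Ns j) powr (- s) + min (real (Ns j) * root q \<tau>) (1 / (real (Ns j) * root q \<tau>))
            + min (real (Ns j) * \<tau>) (1 / (real (Ns j) * \<tau>))))"
        unfolding \<tau>_def s_def using K[OF Ns(1) m \<theta> False] by (intro sum_mono) simp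
      also have "\<dots> = K * ((\<Sum>j\<le>M. real (Ns j) powr (- s)) + (\<Sum>j\<le>M. min (real (Ns j) * root q \<tau>) (1 / (real (Ns j) * root q \<tau>)))
            + (\<Sum>j\<le>M. min (real (Ns j) * \<tau>) (1 / (real (Ns j) * \<tau>))))"
        by (simp only: sum.distrib sum_distrib_left[symmetric])
      also have "\<dots> \<le> B"
        unfolding B_def using K0 \<tau> by (intro mult_left_mono add_mono pow_sum min_sum) auto
      finally show ?thesis .
    qed
  qed
qed

text \<open>The bound is proved for finitely many blocks and points, with a constant that depends
  neither on these nor on \<open>t\<close> and \<open>f\<close>. In this range the averages of
  \<open>f\<close> equal those of its restriction to a finite set, which is a group ring
  element.\<close>

lemma finite_oscillation:
  assumes I: "lacunary I"
  obtains C\<^sub>I where "C\<^sub>I \<ge> 0" "\<And>(t :: nat \<Rightarrow> nat) (f :: int ^ 'd \<Rightarrow> complex) V M.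
    (\<forall>i\<ge>1. t i \<in> I \<and> t i \<le> t (i + 1)) \<Longrightarrow> in_ell2 f \<Longrightarrow> finite V \<Longrightarrow>
    (\<Sum>i<M. \<Sum>v\<in>V. (osc n I (t (Suc i)) (t (Suc (Suc i))) f v)\<^sup>2) \<le> C\<^sub>I * (ell2_norm f)\<^sup>2"
proof -
  define Ns where "Ns = enumerate I"
  have inf: "infinite I" and I0: "0 \<notin> I" using I by (auto simp: lacunary_def)
  define L where "L = (INF j. real (Ns (Suc j)) / real (Ns j))"
  have L: "L > 1" using I by (simp add: lacunary_def L_def Ns_def)
  have NsI: "Ns j \<in> I" for j using inf by (simp add: Ns_def enumerate_in_set)
  have Ns1: "Ns j \<ge> 1" for j using NsI[of j] I0 by (cases "Ns j") auto
  have Ns2: "L * real (Ns j) \<le> real (Ns (Suc j))" for j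
  proof -
    have "L \<le> real (Ns (Suc j)) / real (Ns j)"
      unfolding L_def by (intro cINF_lower bdd_belowI[of _ 0]) auto
    then show ?thesis using Ns1[of j] by (simp add: field_simps)
  qed
  have Nsq1: "Ns j ^ q \<ge> 1" for j using Ns1[of j] by simp
  \<comment> \<open>The cube radii N^q keep the lacunarity ratio \<open>L\<close>, because L \<le>
    L^q.\<close>
  have Nsq2: "L * real (Ns j ^ q) \<le> real (Ns (Suc j) ^ q)" for j
  proof -
    have "L * real (Ns j) ^ q \<le> L ^ q * real (Ns j) ^ q"
      using L q self_le_power[of L q] by (intro mult_right_mono) auto
    also have "\<dots> = (L * real (Ns j)) ^ q" by (simp add: power_mult_distrib)
    also have "\<dots> \<le> real (Ns (Suc j)) ^ q" using Ns2 L by (intro power_mono) auto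
    finally show ?thesis by simp
  qed
  obtain B where B: "\<And>M \<theta>. (\<And>m. \<bar>\<theta> $ m\<bar> \<le> pi) \<Longrightarrow>
    (\<Sum>j\<le>M. (cmod (fourier \<theta> (avg_kernel (Ns j) - cube (Ns j ^ q))))\<^sup>2) \<le> B"
    by (rule avg_minus_cube_square_summable[where Ns = Ns, OF L Ns1 Ns2]) blast
  have B0: "B \<ge> 0"
    by (rule order_trans[OF _ B[where M = 0 and \<theta> = 0]]) (auto intro: sum_nonneg)
  define C\<^sub>I where "C\<^sub>I = 3 * (cube_osc_const CARD('d) L + 3 * B)"
  have CI0: "C\<^sub>I \<ge> 0"
    using L B0 by (simp add: C\<^sub>I_def cube_osc_const_def)
  show thesis
  proof (rule that[OF CI0])
    fix t :: "nat \<Rightarrow> nat" and f :: "int ^ 'd \<Rightarrow> complex" and V :: "(int ^ 'd) set" and M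
    assume t: "\<forall>i\<ge>1. t i \<in> I \<and> t i \<le> t (i + 1)" and f: "in_ell2 f" and V: "finite V"
    \<comment> \<open>The times start at index 1 and the blocks at 0: block \<open>i\<close> runs
      from \<open>t (i + 1)\<close> to \<open>t (i + 2)\<close>, and \<open>k i\<close> is the
      position of its left end in \<open>I\<close>.\<close>
    have "\<exists>j. Ns j = t (Suc i)" for i
      using t inf enumerate_Ex[of I "t (Suc i)"] by (auto simp: Ns_def)
    then obtain k where k: "\<And>i. Ns (k i) = t (Suc i)" by metis
    have le_iff: "Ns i \<le> Ns j \<longleftrightarrow> i \<le> j" for i j using inf by (simp add: Ns_def)
    have kmono: "mono k"
    proof (rule incseq_SucI)
      fix i
      have "Ns (k i) \<le> Ns (k (Suc i))" using t by (simp add: k)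
      then show "k i \<le> k (Suc i)" by (simp only: le_iff)
    qed
    \<comment> \<open>The supremum is over a finite nonempty set, hence attained, at a position in
      \<open>I\<close> that depends on the block and on the point.\<close>
    have ex: "\<exists>j. k i \<le> j \<and> j \<le> k (Suc i) \<and>
        osc n I (t (Suc i)) (t (Suc (Suc i))) f v = cmod (avg n (Ns j) f v - avg n (Ns (k (Suc i))) f v)" for i v
    proof -
      define S where "S = {s \<in> I. t (Suc i) \<le> s \<and> s \<le> t (Suc (Suc i))}"
      define g where "g = (\<lambda>s. cmod (avg n s f v - avg n (t (Suc (Suc i))) f v))"
      have fin: "finite (g ` S)" by (rule finite_imageI, rule finite_subset[of _ "{..t (Suc (Suc i))}"]) (auto simp: S_def)
      have "t (Suc (Suc i)) \<in> S" using t by (auto simp: S_def)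
      then have ne: "g ` S \<noteq> {}" by blast
      have "osc n I (t (Suc i)) (t (Suc (Suc i))) f v = Max (g ` S)"
        unfolding osc_def S_def[symmetric] g_def[symmetric] using fin ne by (rule cSup_eq_Max)
      moreover have "Max (g ` S) \<in> g ` S" using fin ne by (rule Max_in)
      ultimately obtain s where s: "s \<in> S" "osc n I (t (Suc i)) (t (Suc (Suc i))) f v = g s" by auto
      then obtain j where "Ns j = s" using inf enumerate_Ex[of I s] by (auto simp: S_def Ns_def)
      then show ?thesis using s le_iff[of "k i" j] le_iff[of j "k (Suc i)"] by (auto simp: S_def k g_def)
    qed
    define J where "J = (\<lambda>i v. SOME j. k i \<le> j \<and> j \<le> k (Suc i) \<and>
        osc n I (t (Suc i)) (t (Suc (Suc i))) f v = cmod (avg n (Ns j) f v - avg n (Ns (k (Suc i))) f v))"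
    have J: "k i \<le> J i v" "J i v \<le> k (Suc i)"
      "osc n I (t (Suc i)) (t (Suc (Suc i))) f v = cmod (avg n (Ns (J i v)) f v - avg n (Ns (k (Suc i))) f v)" for i v
      using someI_ex[OF ex[of i v]] by (auto simp: J_def)
    \<comment> \<open>Every point of \<open>V\<close> shifted by every \<open>n i\<close> that
      occurs up to the last time \<open>Ns (k M)\<close>.\<close>
    define W where "W = (\<Union>v\<in>V. (\<lambda>i. v + n i) ` {1..Ns (k M)})"
    have W: "finite W" using V by (simp add: W_def)
    define F where "F = (\<Sum>w\<in>W. Poly_Mapping.single w (f w))"
    have F: "lookup F w = (if w \<in> W then f w else 0)" for w
      using W by (simp add: F_def lookup_sum lookup_single when_def)
    have "sqnorm F = (\<Sum>w\<in>W. (cmod (lookup F w))\<^sup>2)"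
      by (rule sqnorm_superset[OF W]) (auto simp: in_keys_iff F split: if_splits)
    also have "\<dots> = (\<Sum>w\<in>W. (cmod (f w))\<^sup>2)" by (simp add: F)
    also have "\<dots> \<le> (\<Sum>\<^sub>\<infinity>w\<in>UNIV. (cmod (f w))\<^sup>2)"
      using f W by (intro finite_sum_le_infsum) (auto simp: in_ell2_def)
    also have "\<dots> = (ell2_norm f)\<^sup>2"
      unfolding ell2_norm_def by (simp add: infsum_nonneg)
    finally have sqF: "sqnorm F \<le> (ell2_norm f)\<^sup>2" .
    have avgF: "avg n (Ns j) f v = lookup (avg_kernel (Ns j) * F) v" if "v \<in> V" "j \<le> k M" for v j
    proof -
      have "Ns j \<le> Ns (k M)" using that le_iff by simp
      then have "v + n i \<in> W" if "i \<in> {1..Ns j}" for i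
        using that \<open>v \<in> V\<close> by (auto simp: W_def intro!: bexI[of _ v] imageI)
      then show ?thesis unfolding lookup_avg_kernel_mult avg_def by (simp add: F)
    qed
    have "(\<Sum>i<M. \<Sum>v\<in>V. (osc n I (t (Suc i)) (t (Suc (Suc i))) f v)\<^sup>2)
        = (\<Sum>i<M. \<Sum>v\<in>V. (cmod (lookup ((avg_kernel (Ns (J i v)) - avg_kernel (Ns (k (Suc i)))) * F) v))\<^sup>2)"
    proof (intro sum.cong refl)
      fix i v assume iv: "i \<in> {..<M}" "v \<in> V"
      then have "k (Suc i) \<le> k M" using monoD[OF kmono, of "Suc i" M] by simp
      moreover then have "J i v \<le> k M" using J(2)[of i v] by linarith
      ultimately show "(osc n I (t (Suc i)) (t (Suc (Suc i))) f v)\<^sup>2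
          = (cmod (lookup ((avg_kernel (Ns (J i v)) - avg_kernel (Ns (k (Suc i)))) * F) v))\<^sup>2"
        using iv unfolding J(3) by (simp add: avgF left_diff_distrib lookup_minus)
    qed
    also have "\<dots> \<le> C\<^sub>I * sqnorm F"
      unfolding C\<^sub>I_def
      by (rule perturbed_oscillation[where A = "\<lambda>j. avg_kernel (Ns j)" and R = "\<lambda>j. Ns j ^ q" and J = J and k = k,
            OF L Nsq1 Nsq2 kmono V J(1,2) B])
    also have "\<dots> \<le> C\<^sub>I * (ell2_norm f)\<^sup>2" using sqF CI0 by (rule mult_left_mono)
    finally show "(\<Sum>i<M. \<Sum>v\<in>V. (osc n I (t (Suc i)) (t (Suc (Suc i))) f v)\<^sup>2) \<le> C\<^sub>I * (ell2_norm f)\<^sup>2" .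
  qed
qed

end

text \<open>All terms are squares, so one bound for finite rectangles gives summability in both
  variables as well as the bound. Summability is asserted alongside because a divergent infinite sum
  has the default value 0, which would make the inequality meaningless.\<close>

lemma infsum_of_ell2_norms_le:
  fixes g :: "nat \<Rightarrow> 'a \<Rightarrow> real"
  assumes "\<And>M V. finite V \<Longrightarrow> (\<Sum>i<M. \<Sum>v\<in>V. (g (i + 2) v)\<^sup>2) \<le> B"
  shows "\<forall>i\<ge>2. in_ell2 (g i)" "(\<lambda>i. (ell2_norm (g i))\<^sup>2) summable_on {2..}"
    "(\<Sum>\<^sub>\<infinity>i\<in>{2..}. (ell2_norm (g i))\<^sup>2) \<le> B"
proof -
  have fin: "(\<Sum>i\<in>X. \<Sum>v\<in>V. (g i v)\<^sup>2) \<le> B" if X: "finite X" "X \<subseteq> {2..}" and V: "finite V" for X V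
  proof -
    have "X \<subseteq> (\<lambda>i. i + 2) ` {..<Suc (Max X)}"
    proof
      fix i assume i: "i \<in> X"
      then have "i \<le> Max X" "i \<ge> 2" using X by auto
      then show "i \<in> (\<lambda>i. i + 2) ` {..<Suc (Max X)}" by (intro image_eqI[of _ _ "i - 2"]) auto
    qed
    then have "(\<Sum>i\<in>X. \<Sum>v\<in>V. (g i v)\<^sup>2) \<le> (\<Sum>i\<in>(\<lambda>i. i + 2) ` {..<Suc (Max X)}. \<Sum>v\<in>V. (g i v)\<^sup>2)"
      by (intro sum_mono2) (auto intro: sum_nonneg)
    also have "\<dots> = (\<Sum>i<Suc (Max X). \<Sum>v\<in>V. (g (i + 2) v)\<^sup>2)"
      by (subst sum.reindex) (auto simp: inj_on_def)
    also have "\<dots> \<le> B" by (rule assms[OF V])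
    finally show ?thesis .
  qed
  have sm: "(\<lambda>v. (g i v)\<^sup>2) summable_on UNIV" if "i \<ge> 2" for i
  proof (rule nonneg_bdd_above_summable_on)
    show "bdd_above (sum (\<lambda>v. (g i v)\<^sup>2) ` {F. F \<subseteq> UNIV \<and> finite F})"
      using fin[of "{i}"] that by (intro bdd_aboveI[of _ B]) auto
  qed simp
  then show "\<forall>i\<ge>2. in_ell2 (g i)" by (simp add: in_ell2_def)
  have norm: "(ell2_norm (g i))\<^sup>2 = (\<Sum>\<^sub>\<infinity>v\<in>UNIV. (g i v)\<^sup>2)" for i
    unfolding ell2_norm_def by (simp add: infsum_nonneg)
  have le: "(\<Sum>i\<in>X. (ell2_norm (g i))\<^sup>2) \<le> B" if X: "finite X" "X \<subseteq> {2..}" for X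
  proof -
    have "((\<lambda>v. \<Sum>i\<in>X. (g i v)\<^sup>2) has_sum (\<Sum>i\<in>X. (ell2_norm (g i))\<^sup>2)) UNIV"
      unfolding norm using X sm
      by (induction X rule: finite_induct) (auto intro!: has_sum_add has_sum_infsum)
    then show ?thesis
    proof (rule has_sum_le_finite_sums)
      fix V :: "'a set" assume "finite V"
      then show "(\<Sum>v\<in>V. \<Sum>i\<in>X. (g i v)\<^sup>2) \<le> B" using fin[OF X] by (subst sum.swap) auto
    qed
  qed
  show s: "(\<lambda>i. (ell2_norm (g i))\<^sup>2) summable_on {2..}"
    using le by (intro nonneg_bdd_above_summable_on bdd_aboveI[of _ B]) auto
  show "(\<Sum>\<^sub>\<infinity>i\<in>{2..}. (ell2_norm (g i))\<^sup>2) \<le> B"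
    using s le by (rule infsum_le_finite_sums)
qed

theorem theorem4p3:
  fixes d q :: nat and c C :: real and p :: "nat \<Rightarrow> nat"
    and pos :: "'d::finite \<Rightarrow> nat"
    and a n :: "nat \<Rightarrow> int ^ 'd"
    and e :: "nat \<Rightarrow> nat \<times> nat"
  assumes "d \<ge> 1" and "q \<ge> 1" and "c > 1" and "C > 1"
    and "bij_betw pos UNIV {..<d}"
    and "\<And>k. k \<ge> 1 \<Longrightarrow> prime (p k)"
    and "\<And>k. k \<ge> 1 \<Longrightarrow> c * real (p k) \<le> real (p (k + 1)) \<and> real (p (k + 1)) < C * real (p k)"
    and "\<And>k. k \<ge> 2 \<Longrightarrow> enorm (a (k - 1)) + real (p (k - 1)) ^ q < enorm (a k)"
    and "\<And>k. k \<ge> 1 \<Longrightarrow> enorm (a k) \<le> C * real (p k) ^ q"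
    and "dict_enum p e"
    and "\<And>i k j. i \<ge> 1 \<Longrightarrow> e i = (k, j) \<Longrightarrow> n i = a k + xvec pos q (p k) j"
  shows "\<forall>I. lacunary I \<longrightarrow>
    (\<exists>C\<^sub>I::real. \<forall>(t :: nat \<Rightarrow> nat) (f :: int ^ 'd \<Rightarrow> complex).
       (\<forall>i\<ge>1. t i \<in> I \<and> t i \<le> t (i + 1)) \<longrightarrow> in_ell2 f \<longrightarrow>
         (\<forall>i\<ge>2. in_ell2 (osc n I (t (i - 1)) (t i) f)) \<and>
         (\<lambda>i. (ell2_norm (osc n I (t (i - 1)) (t i) f))\<^sup>2) summable_on {2..} \<and>
         (\<Sum>\<^sub>\<infinity>i\<in>{2..}. (ell2_norm (osc n I (t (i - 1)) (t i) f))\<^sup>2) \<le> C\<^sub>I * (ell2_norm f)\<^sup>2)"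
proof (intro allI impI)
  fix I assume I: "lacunary I"
  interpret prime_blocks d q c C p pos a n e
    by unfold_locales (fact assms)+
  obtain C\<^sub>I where CI: "\<And>(t :: nat \<Rightarrow> nat) (f :: int ^ 'd \<Rightarrow> complex) V M.
    (\<forall>i\<ge>1. t i \<in> I \<and> t i \<le> t (i + 1)) \<Longrightarrow> in_ell2 f \<Longrightarrow> finite V \<Longrightarrow>
    (\<Sum>i<M. \<Sum>v\<in>V. (osc n I (t (Suc i)) (t (Suc (Suc i))) f v)\<^sup>2) \<le> C\<^sub>I * (ell2_norm f)\<^sup>2"
    by (rule finite_oscillation[OF I]) blast
  show "\<exists>C\<^sub>I::real. \<forall>(t :: nat \<Rightarrow> nat) (f :: int ^ 'd \<Rightarrow> complex).
       (\<forall>i\<ge>1. t i \<in> I \<and> t i \<le> t (i + 1)) \<longrightarrow> in_ell2 f \<longrightarrow>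
         (\<forall>i\<ge>2. in_ell2 (osc n I (t (i - 1)) (t i) f)) \<and>
         (\<lambda>i. (ell2_norm (osc n I (t (i - 1)) (t i) f))\<^sup>2) summable_on {2..} \<and>
         (\<Sum>\<^sub>\<infinity>i\<in>{2..}. (ell2_norm (osc n I (t (i - 1)) (t i) f))\<^sup>2) \<le> C\<^sub>I * (ell2_norm f)\<^sup>2"
  proof (rule exI[of _ C\<^sub>I], intro allI impI)
    fix t :: "nat \<Rightarrow> nat" and f :: "int ^ 'd \<Rightarrow> complex"
    assume t: "\<forall>i\<ge>1. t i \<in> I \<and> t i \<le> t (i + 1)" and f: "in_ell2 f"
    have "(\<Sum>i<M. \<Sum>v\<in>V. (osc n I (t (i + 2 - 1)) (t (i + 2)) f v)\<^sup>2) \<le> C\<^sub>I * (ell2_norm f)\<^sup>2"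
      if "finite V" for M V
      using CI[OF t f that, of M] by simp
    from infsum_of_ell2_norms_le[where g = "\<lambda>i. osc n I (t (i - 1)) (t i) f", OF this]
    show "(\<forall>i\<ge>2. in_ell2 (osc n I (t (i - 1)) (t i) f)) \<and>
         (\<lambda>i. (ell2_norm (osc n I (t (i - 1)) (t i) f))\<^sup>2) summable_on {2..} \<and>
         (\<Sum>\<^sub>\<infinity>i\<in>{2..}. (ell2_norm (osc n I (t (i - 1)) (t i) f))\<^sup>2) \<le> C\<^sub>I * (ell2_norm f)\<^sup>2"
      by blast
  qed
qed

end
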